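(* There exists a dense $G_\delta$ subset $E\subset[0,1]$ such that for every $\alpha\in E$, the closure $\overline{\mathcal{A}_\alpha}$ of $\mathcal{A}_\alpha$ in $(\mathrm{Diff}(\mathbb{T}^2),\tau)$ contains a subset which is dense in $\overline{\mathcal{A}_\alpha}$ and consists of uniquely ergodic diffeomorphisms.
   Context: $\mathbb{T}^2=\mathbb{R}^2/\mathbb{Z}^2$. $\mathrm{Diff}(\mathbb{T}^2)$ is the set of real-analytic diffeomorphisms of $\mathbb{T}^2$ homotopic to the identity; each has a lift $F(x,y)=(x+f_1(x,y),y+f_2(x,y))$ with $f_1,f_2$ real-analytic and $\mathbb{Z}^2$-periodic. For $r>0$ let $A^r=\{(x,y)\in\mathbb{C}^2:|\mathrm{Im}\,x|<r,\ |\mathrm{Im}\,y|<r\}$, and let $\mathrm{Diff}_r(\mathbb{T}^2)$ be the set of those $F$ for which $f_1,f_2$ extend holomorphically to $A^r$ with finite sup norm; it carries the topology $\tau_r$ of the distance $|F-G|_r=\max_{i=1,2}\sup_{A^r}|f_i-g_i|$. The topology $\tau$ on $\mathrm{Diff}(\mathbb{T}^2)=\bigcup_{r>0}\mathrm{Diff}_r(\mathbb{T}^2)$ is the inductive limit topology: a set $O$ is open iff $O\cap\mathrm{Diff}_r(\mathbb{T}^2)$ is $\tau_r$-open for every $r>0$. $R_\alpha(x,y)=(x+\alpha,y)$. $\mathcal{A}_\alpha$ is the set of $F\in\mathrm{Diff}(\mathbb{T}^2)$ such that $F=T^{-1}\circ R_\alpha\circ T$ for some real-analytic area-preserving diffeomorphism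 $T$ of $\mathbb{T}^2$. A homeomorphism of a compact space is uniquely ergodic if it has exactly one invariant Borel probability measure. *)

theory Defs
  imports "HOL-Probability.Probability"
begin

definition holo2 :: "(complex \<times> complex \<Rightarrow> complex) \<Rightarrow> (complex \<times> complex) set \<Rightarrow> bool" where
  "holo2 g U \<longleftrightarrow> (\<forall>z\<in>U. \<exists>L. (g has_derivative L) (at z) \<and>
       (\<forall>v. L (\<i> * fst v, \<i> * snd v) = \<i> * L v))"

definition real_analytic2 :: "(real \<times> real \<Rightarrow> real) \<Rightarrow> bool" where
  "real_analytic2 f \<longleftrightarrow> (\<exists>U g. open U \<and> (\<forall>x y. (complex_of_real x, complex_of_real y) \<in> U)
      \<and> holo2 g U \<and> (\<forall>x y. g (complex_of_real x, complex_of_real y) = complex_of_real (f (x, y))))"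

definition ra_diffeo2 :: "(real \<times> real \<Rightarrow> real \<times> real) \<Rightarrow> bool" where
  "ra_diffeo2 F \<longleftrightarrow> bij F \<and> real_analytic2 (\<lambda>p. fst (F p)) \<and> real_analytic2 (\<lambda>p. snd (F p))
      \<and> real_analytic2 (\<lambda>p. fst (inv F p)) \<and> real_analytic2 (\<lambda>p. snd (inv F p))"

definition disp1 :: "(real \<times> real \<Rightarrow> real \<times> real) \<Rightarrow> real \<times> real \<Rightarrow> real" where
  "disp1 F p = fst (F p) - fst p"
definition disp2 :: "(real \<times> real \<Rightarrow> real \<times> real) \<Rightarrow> real \<times> real \<Rightarrow> real" where
  "disp2 F p = snd (F p) - snd p"

text \<open>Lift of a real-analytic diffeomorphism of T^2 homotopic to the identity.\<close>
definition torus_diffeo_lift :: "(real \<times> real \<Rightarrow> real \<times> real) \<Rightarrow> bool" where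
  "torus_diffeo_lift F \<longleftrightarrow> ra_diffeo2 F \<and>
     (\<forall>x y. \<forall>m n :: int. F (x + of_int m, y + of_int n) = F (x, y) + (of_int m, of_int n))"

definition strip :: "real \<Rightarrow> (complex \<times> complex) set" where
  "strip r = {z. \<bar>Im (fst z)\<bar> < r \<and> \<bar>Im (snd z)\<bar> < r}"

definition bounded_holo_ext :: "real \<Rightarrow> (real \<times> real \<Rightarrow> real) \<Rightarrow> (complex \<times> complex \<Rightarrow> complex) \<Rightarrow> bool" where
  "bounded_holo_ext r f g \<longleftrightarrow> holo2 g (strip r) \<and> (\<exists>B. \<forall>z\<in>strip r. norm (g z) \<le> B)
     \<and> (\<forall>x y. g (complex_of_real x, complex_of_real y) = complex_of_real (f (x, y)))"

text \<open>The holomorphic extension to A^r (unique by the identity theorem when it exists).\<close>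
definition hext :: "real \<Rightarrow> (real \<times> real \<Rightarrow> real) \<Rightarrow> complex \<times> complex \<Rightarrow> complex" where
  "hext r f = (SOME g. bounded_holo_ext r f g)"

definition Diff_r :: "real \<Rightarrow> (real \<times> real \<Rightarrow> real \<times> real) set" where
  "Diff_r r = {F. torus_diffeo_lift F \<and> (\<exists>g. bounded_holo_ext r (disp1 F) g)
                  \<and> (\<exists>g. bounded_holo_ext r (disp2 F) g)}"

definition Diff :: "(real \<times> real \<Rightarrow> real \<times> real) set" where
  "Diff = (\<Union>r\<in>{0<..}. Diff_r r)"

definition dist_r :: "real \<Rightarrow> (real \<times> real \<Rightarrow> real \<times> real) \<Rightarrow> (real \<times> real \<Rightarrow> real \<times> real) \<Rightarrow> real" where
  "dist_r r F G = max (SUP z\<in>strip r. cmod (hext r (disp1 F) z - hext r (disp1 G) z))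
                      (SUP z\<in>strip r. cmod (hext r (disp2 F) z - hext r (disp2 G) z))"

text \<open>Open sets of the inductive limit topology tau.\<close>
definition tau_open :: "(real \<times> real \<Rightarrow> real \<times> real) set \<Rightarrow> bool" where
  "tau_open W \<longleftrightarrow> W \<subseteq> Diff \<and> (\<forall>r>0. \<forall>F\<in>W \<inter> Diff_r r. \<exists>e>0.
       \<forall>G\<in>Diff_r r. dist_r r F G < e \<longrightarrow> G \<in> W)"

definition tau_closure :: "(real \<times> real \<Rightarrow> real \<times> real) set \<Rightarrow> (real \<times> real \<Rightarrow> real \<times> real) set" where
  "tau_closure S = {F\<in>Diff. \<forall>W. tau_open W \<and> F \<in> W \<longrightarrow> W \<inter> S \<noteq> {}}"

definition tau_dense_in :: "(real \<times> real \<Rightarrow> real \<times> real) set \<Rightarrow> (real \<times> real \<Rightarrow> real \<times> real) set \<Rightarrow> bool" where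
  "tau_dense_in D C \<longleftrightarrow> D \<subseteq> C \<and> (\<forall>F\<in>C. \<forall>W. tau_open W \<and> F \<in> W \<longrightarrow> W \<inter> D \<noteq> {})"

definition rot :: "real \<Rightarrow> real \<times> real \<Rightarrow> real \<times> real" where
  "rot \<alpha> p = (fst p + \<alpha>, snd p)"

text \<open>Lift of a real-analytic area-preserving diffeomorphism of T^2 (any isotopy class).\<close>
definition area_pres_torus_diffeo_lift :: "(real \<times> real \<Rightarrow> real \<times> real) \<Rightarrow> bool" where
  "area_pres_torus_diffeo_lift T \<longleftrightarrow> ra_diffeo2 T \<and>
     (\<exists>a b c d :: int. \<bar>a * d - b * c\<bar> = 1 \<and>
        (\<forall>x y. \<forall>m n :: int. T (x + of_int m, y + of_int n)
             = T (x, y) + (of_int (a * m + b * n), of_int (c * m + d * n))))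
     \<and> distr lborel lborel T = lborel"

definition A_conj :: "real \<Rightarrow> (real \<times> real \<Rightarrow> real \<times> real) set" where
  "A_conj \<alpha> = {F\<in>Diff. \<exists>T. area_pres_torus_diffeo_lift T \<and> F = inv T \<circ> rot \<alpha> \<circ> T}"

text \<open>Projection R^2 \<rightarrow> [0,1)^2, a Borel isomorphism of [0,1)^2 onto T^2.\<close>
definition torus_proj :: "real \<times> real \<Rightarrow> real \<times> real" where
  "torus_proj p = (frac (fst p), frac (snd p))"

text \<open>Borel probability measures on T^2 are represented as Borel probability measures on R^2
  concentrated on [0,1)^2; the induced map of T^2 is torus_proj \<circ> F.\<close>
definition uniquely_ergodic :: "(real \<times> real \<Rightarrow> real \<times> real) \<Rightarrow> bool" where
  "uniquely_ergodic F \<longleftrightarrow> (\<exists>!M :: (real \<times> real) measure.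
      prob_space M \<and> sets M = sets borel \<and> emeasure M ({0..<1} \<times> {0..<1}) = 1
      \<and> distr M borel (torus_proj \<circ> F) = M)"

end

theory Submission
  imports Defs "HOL-Complex_Analysis.Complex_Analysis" "HOL-Real_Asymp.Real_Asymp"
begin

text \<open>
  A neighbourhood of \<open>T\<^sup>-\<^sup>1 \<circ> R\<^sub>\<alpha> \<circ> T\<close> contains the maps \<open>T\<^sup>-\<^sup>1 \<circ> H \<circ> T\<close> for every skew product
  \<open>H (x, y) = (x + \<alpha>, y + \<phi> x)\<close> whose \<open>\<phi>\<close> is small on a fixed complex strip. If
  \<open>\<phi> x = \<Psi> (x + \<alpha>) - \<Psi> x\<close> with a trigonometric polynomial \<open>\<Psi>\<close>, then \<open>H\<close> is conjugate to
  \<open>R\<^sub>\<alpha>\<close> by the shear \<open>(x, y - \<Psi> x)\<close>. It thus suffices to find a small limit of such \<open>\<phi>\<close> for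
  which \<open>H\<close> is uniquely ergodic.

  For \<open>\<alpha>\<close> with reduced approximations \<open>|\<alpha> - p/q| < exp (-q\<^sup>2)\<close> take
  \<open>\<Psi> = \<Sum>\<^sub>i cos (2 pi q\<^sub>i x)\<close>, where the \<open>q\<^sub>i\<close> are rapidly increasing denominators: each
  summand changes \<open>\<phi>\<close> very little although its amplitude is 1. Up to small errors, adding a
  summand multiplies the mean of \<open>exp (2 pi i (j x + k \<Psi> x))\<close> by the mean of
  \<open>exp (2 pi i k cos (2 pi x))\<close>, which has modulus less than 1 if \<open>k \<noteq> 0\<close>. Hence these means
  tend to 0, and so do the Birkhoff averages of all nontrivial characters along the times \<open>q\<^sub>i\<close>,
  uniformly on the torus. All Fourier coefficients of an invariant measure are therefore
  determined.
\<close>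

section \<open>Holomorphic functions of two variables\<close>

text \<open>Every finite stage is conjugate to \<open>rot \<alpha>\<close>, which preserves each
  horizontal circle and so has many invariant measures; unique ergodicity can only appear in the
  limit. The coboundaries \<phi> therefore have to converge while the transfer functions \<Psi> must
  not: a continuous limit of them would again give a map conjugate to the rotation. Amplitude 1
  serves this purpose, as it keeps the contraction factor the same at every stage. The analytic
  setting is the obstacle: \<open>T\<close> dictates the width \<rho> of the strip on which \<phi>
  must be small, and there a wave of frequency \<open>q\<close> grows like
  \<open>exp (2 pi q \<rho>)\<close>. The rate \<open>exp (-q\<^sup>2)\<close> beats this for every
  \<rho> at once, so one generic set of angles serves all \<open>T\<close>. The inductive limit
  topology adds no difficulty: for a given \<open>T\<close> all maps involved lie in one
  \<open>Diff_r r\<close>, so that open sets are tested by a single metric.\<close>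

lemma holo2_iff:
  "holo2 g U \<longleftrightarrow> (\<forall>z\<in>U. \<exists>a b. (g has_derivative (\<lambda>v. a * fst v + b * snd v)) (at z))"
proof
  assume h: "holo2 g U"
  show "\<forall>z\<in>U. \<exists>a b. (g has_derivative (\<lambda>v. a * fst v + b * snd v)) (at z)"
  proof
    fix z assume "z \<in> U"
    with h obtain L where L: "(g has_derivative L) (at z)"
      and c: "\<And>v. L (\<i> * fst v, \<i> * snd v) = \<i> * L v"
      unfolding holo2_def by blast
    interpret L: bounded_linear L using L by (rule has_derivative_bounded_linear)
    \<comment> \<open>Splitting \<open>v\<close> along (1,0), (\<i>,0), (0,1), (0,\<i>) uses real
      linearity only; commuting with multiplication by \<i> then merges the four values of
      \<open>L\<close> into two complex partial derivatives.\<close>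
    have "L v = L (1,0) * fst v + L (0,1) * snd v" for v
    proof -
      have "v = Re (fst v) *\<^sub>R (1,0) + Im (fst v) *\<^sub>R (\<i>,0) + Re (snd v) *\<^sub>R (0,1) + Im (snd v) *\<^sub>R (0,\<i>)"
        by (auto simp: prod_eq_iff complex_eq_iff)
      then have "L v = L (Re (fst v) *\<^sub>R (1,0) + Im (fst v) *\<^sub>R (\<i>,0) + Re (snd v) *\<^sub>R (0,1) + Im (snd v) *\<^sub>R (0,\<i>))"
        by (rule arg_cong)
      also have "\<dots> = Re (fst v) *\<^sub>R L (1,0) + Im (fst v) *\<^sub>R L (\<i>,0) + Re (snd v) *\<^sub>R L (0,1) + Im (snd v) *\<^sub>R L (0,\<i>)"
        by (simp only: L.add L.scaleR)
      finally have "L v = Re (fst v) *\<^sub>R L (1,0) + Im (fst v) *\<^sub>R L (\<i>,0) + Re (snd v) *\<^sub>R L (0,1) + Im (snd v) *\<^sub>R L (0,\<i>)" .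
      moreover have "L (\<i>,0) = \<i> * L (1,0)" "L (0,\<i>) = \<i> * L (0,1)"
        using c[of "(1,0)"] c[of "(0,1)"] by auto
      ultimately show ?thesis
        by (auto simp: complex_eq_iff algebra_simps)
    qed
    then have "L = (\<lambda>v. L (1,0) * fst v + L (0,1) * snd v)" by blast
    with L show "\<exists>a b. (g has_derivative (\<lambda>v. a * fst v + b * snd v)) (at z)" by metis
  qed
next
  assume h: "\<forall>z\<in>U. \<exists>a b. (g has_derivative (\<lambda>v. a * fst v + b * snd v)) (at z)"
  show "holo2 g U"
    unfolding holo2_def
  proof
    fix z assume "z \<in> U"
    with h obtain a b where "(g has_derivative (\<lambda>v. a * fst v + b * snd v)) (at z)" by blast
    then show "\<exists>L. (g has_derivative L) (at z) \<and> (\<forall>v. L (\<i> * fst v, \<i> * snd v) = \<i> * L v)"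
      by (intro exI conjI) (auto simp: algebra_simps)
  qed
qed

lemma holo2_subset: "holo2 g U \<Longrightarrow> V \<subseteq> U \<Longrightarrow> holo2 g V"
  unfolding holo2_def by blast

lemma holo2_const: "holo2 (\<lambda>z. c) U"
  unfolding holo2_def by (auto intro!: exI[of _ "\<lambda>_. 0"])

lemma holo2_fst: "holo2 fst U"
  unfolding holo2_def by (auto intro!: exI[of _ fst] derivative_intros)

lemma holo2_snd: "holo2 snd U"
  unfolding holo2_def by (auto intro!: exI[of _ snd] derivative_intros)

lemma holo2_add: "holo2 f U \<Longrightarrow> holo2 g U \<Longrightarrow> holo2 (\<lambda>z. f z + g z) U"
  unfolding holo2_def
proof
  fix z
  assume "\<forall>z\<in>U. \<exists>L. (f has_derivative L) (at z) \<and> (\<forall>v. L (\<i> * fst v, \<i> * snd v) = \<i> * L v)"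
    "\<forall>z\<in>U. \<exists>L. (g has_derivative L) (at z) \<and> (\<forall>v. L (\<i> * fst v, \<i> * snd v) = \<i> * L v)" "z \<in> U"
  then obtain L M where "(f has_derivative L) (at z)" "\<forall>v. L (\<i> * fst v, \<i> * snd v) = \<i> * L v"
    "(g has_derivative M) (at z)" "\<forall>v. M (\<i> * fst v, \<i> * snd v) = \<i> * M v" by blast
  then show "\<exists>L. ((\<lambda>z. f z + g z) has_derivative L) (at z) \<and> (\<forall>v. L (\<i> * fst v, \<i> * snd v) = \<i> * L v)"
    by (intro exI[of _ "\<lambda>v. L v + M v"]) (auto intro: has_derivative_add simp: algebra_simps)
qed

lemma holo2_diff: "holo2 f U \<Longrightarrow> holo2 g U \<Longrightarrow> holo2 (\<lambda>z. f z - g z) U"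
  unfolding holo2_def
proof
  fix z
  assume "\<forall>z\<in>U. \<exists>L. (f has_derivative L) (at z) \<and> (\<forall>v. L (\<i> * fst v, \<i> * snd v) = \<i> * L v)"
    "\<forall>z\<in>U. \<exists>L. (g has_derivative L) (at z) \<and> (\<forall>v. L (\<i> * fst v, \<i> * snd v) = \<i> * L v)" "z \<in> U"
  then obtain L M where "(f has_derivative L) (at z)" "\<forall>v. L (\<i> * fst v, \<i> * snd v) = \<i> * L v"
    "(g has_derivative M) (at z)" "\<forall>v. M (\<i> * fst v, \<i> * snd v) = \<i> * M v" by blast
  then show "\<exists>L. ((\<lambda>z. f z - g z) has_derivative L) (at z) \<and> (\<forall>v. L (\<i> * fst v, \<i> * snd v) = \<i> * L v)"
    by (intro exI[of _ "\<lambda>v. L v - M v"]) (auto intro: has_derivative_diff simp: algebra_simps)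
qed

lemma holo2_continuous_on: "holo2 g U \<Longrightarrow> continuous_on U g"
  unfolding holo2_def
  by (metis continuous_at_imp_continuous_on has_derivative_continuous)

lemma holo2_compose1:
  assumes "holo2 g U" "f holomorphic_on V" "open V" "\<And>z. z \<in> U \<Longrightarrow> g z \<in> V"
  shows "holo2 (\<lambda>z. f (g z)) U"
  unfolding holo2_def
proof
  fix z assume z: "z \<in> U"
  then obtain L where L: "(g has_derivative L) (at z)"
      and c: "\<forall>v. L (\<i> * fst v, \<i> * snd v) = \<i> * L v"
    using assms(1) unfolding holo2_def by blast
  have "(f has_field_derivative deriv f (g z)) (at (g z))"
    using assms z by (meson holomorphic_derivI)
  then have "((\<lambda>z. f (g z)) has_derivative (\<lambda>v. deriv f (g z) * L v)) (at z)"
    using has_derivative_compose[OF L] unfolding has_field_derivative_def by blast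
  then show "\<exists>L. ((\<lambda>z. f (g z)) has_derivative L) (at z) \<and> (\<forall>v. L (\<i> * fst v, \<i> * snd v) = \<i> * L v)"
    using c by (intro exI[of _ "\<lambda>v. deriv f (g z) * L v"]) auto
qed

lemma holo2_compose2:
  assumes "holo2 g1 U" "holo2 g2 U" "holo2 f V" "\<And>z. z \<in> U \<Longrightarrow> (g1 z, g2 z) \<in> V"
  shows "holo2 (\<lambda>z. f (g1 z, g2 z)) U"
  unfolding holo2_def
proof
  fix z assume z: "z \<in> U"
  obtain L1 where L1: "(g1 has_derivative L1) (at z)"
      and c1: "\<forall>v. L1 (\<i> * fst v, \<i> * snd v) = \<i> * L1 v"
    using assms(1) z unfolding holo2_def by blast
  obtain L2 where L2: "(g2 has_derivative L2) (at z)"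
      and c2: "\<forall>v. L2 (\<i> * fst v, \<i> * snd v) = \<i> * L2 v"
    using assms(2) z unfolding holo2_def by blast
  obtain L where L: "(f has_derivative L) (at (g1 z, g2 z))"
      and c: "\<forall>v. L (\<i> * fst v, \<i> * snd v) = \<i> * L v"
    using assms(3) assms(4)[OF z] unfolding holo2_def by blast
  have "((\<lambda>z. f (g1 z, g2 z)) has_derivative (\<lambda>v. L (L1 v, L2 v))) (at z)"
    using has_derivative_compose[OF has_derivative_Pair[OF L1 L2] L] .
  then show "\<exists>L. ((\<lambda>z. f (g1 z, g2 z)) has_derivative L) (at z) \<and> (\<forall>v. L (\<i> * fst v, \<i> * snd v) = \<i> * L v)"
    using c[rule_format, of "(L1 _, L2 _)"] c1 c2 by (intro exI[of _ "\<lambda>v. L (L1 v, L2 v)"]) simp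
qed

lemma holo2_slice1:
  assumes "holo2 g (A \<times> B)" "y \<in> B"
  shows "(\<lambda>x. g (x, y)) holomorphic_on A"
proof (rule holomorphic_onI, rule field_differentiable_at_within)
  fix x assume "x \<in> A"
  then obtain a b where d: "(g has_derivative (\<lambda>v. a * fst v + b * snd v)) (at (x, y))"
    using assms unfolding holo2_iff by blast
  have "((\<lambda>x. (x, y)) has_derivative (\<lambda>h. (h, 0))) (at x)"
    by (auto intro!: derivative_eq_intros)
  from has_derivative_compose[OF this d]
  have "((\<lambda>x. g (x, y)) has_field_derivative a) (at x)"
    by (simp add: has_field_derivative_def)
  then show "(\<lambda>x. g (x, y)) field_differentiable at x"
    unfolding field_differentiable_def by blast
qed

lemma holo2_slice2:
  assumes "holo2 g (A \<times> B)" "x \<in> A"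
  shows "(\<lambda>y. g (x, y)) holomorphic_on B"
proof (rule holomorphic_onI, rule field_differentiable_at_within)
  fix y assume "y \<in> B"
  then obtain a b where d: "(g has_derivative (\<lambda>v. a * fst v + b * snd v)) (at (x, y))"
    using assms unfolding holo2_iff by blast
  have "((\<lambda>y. (x, y)) has_derivative (\<lambda>h. (0, h))) (at y)"
    by (auto intro!: derivative_eq_intros)
  from has_derivative_compose[OF this d]
  have "((\<lambda>y. g (x, y)) has_field_derivative b) (at y)"
    by (simp add: has_field_derivative_def)
  then show "(\<lambda>y. g (x, y)) field_differentiable at y"
    unfolding field_differentiable_def by blast
qed

lemma holomorphic_zero_if_zero_on_reals:
  assumes "h holomorphic_on A" "open A" "connected A" "complex_of_real a \<in> A"
    and z: "\<And>x. complex_of_real x \<in> A \<Longrightarrow> h (complex_of_real x) = 0" and "w \<in> A"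
  shows "h w = 0"
proof (rule analytic_continuation[OF assms(1-3), of "A \<inter> range complex_of_real" "complex_of_real a"])
  show "complex_of_real a islimpt A \<inter> range complex_of_real"
    unfolding islimpt_approachable
  proof (intro allI impI)
    fix e :: real assume "e > 0"
    obtain d where d: "d > 0" "ball (complex_of_real a) d \<subseteq> A"
      using assms(2,4) open_contains_ball by blast
    define c where "c = min d e / 2"
    have c: "c > 0" "c < d" "c < e" using d \<open>e > 0\<close> by (auto simp: c_def)
    have "dist (complex_of_real (a + c)) (complex_of_real a) = c"
      using c by (simp add: dist_of_real dist_real_def del: of_real_add)
    then show "\<exists>x'\<in>A \<inter> range complex_of_real. x' \<noteq> complex_of_real a \<and> dist x' (complex_of_real a) < e"
      using c d by (intro bexI[of _ "complex_of_real (a + c)"]) (auto simp: dist_commute subset_iff simp del: of_real_add)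
  qed
qed (use assms in auto)

text \<open>Two one-variable continuations: for real \<open>x\<close> the equality spreads from real
  to complex second coordinates, and then, for each fixed complex second coordinate, from real to
  complex first coordinates. Product domains cover both strips and overlaps of translated
  boxes.\<close>

lemma holo2_identity:
  assumes f: "holo2 f (A \<times> B)" and g: "holo2 g (A \<times> B)"
    and A: "open A" "connected A" "complex_of_real a \<in> A"
    and B: "open B" "connected B" "complex_of_real b \<in> B"
    and eq: "\<And>x y. complex_of_real x \<in> A \<Longrightarrow> complex_of_real y \<in> B \<Longrightarrow>
               f (complex_of_real x, complex_of_real y) = g (complex_of_real x, complex_of_real y)"
    and z: "z \<in> A \<times> B"
  shows "f z = g z"
proof -
  have h: "holo2 (\<lambda>z. f z - g z) (A \<times> B)" using f g by (rule holo2_diff)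
  have 1: "f (complex_of_real x, w) - g (complex_of_real x, w) = 0"
    if "complex_of_real x \<in> A" "w \<in> B" for x w
    using holomorphic_zero_if_zero_on_reals[OF holo2_slice2[OF h that(1)] B] eq that by auto
  have "f (w, w') - g (w, w') = 0" if "w \<in> A" "w' \<in> B" for w w'
    using holomorphic_zero_if_zero_on_reals[OF holo2_slice1[OF h that(2)] A] 1 that by auto
  then show ?thesis using z by (cases z) auto
qed

section \<open>Strips around the real plane and uniqueness of extensions\<close>

lemma strip_eq_Times: "strip r = {z. \<bar>Im z\<bar> < r} \<times> {z. \<bar>Im z\<bar> < r}"
  by (auto simp: strip_def)

lemma open_Im_strip: "open {z. \<bar>Im z\<bar> < r}"
  by (intro open_Collect_less continuous_intros)

lemma convex_Im_strip: "convex {z. \<bar>Im z\<bar> < r}"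
proof -
  have "{z. \<bar>Im z\<bar> < r} = {z. Im z < r} \<inter> {z. Im z > - r}" by auto
  then show ?thesis
    by (simp add: convex_Int convex_halfspace_Im_lt convex_halfspace_Im_gt)
qed

lemma open_strip: "open (strip r)"
  unfolding strip_eq_Times by (intro open_Times open_Im_strip)

lemma strip_mono: "r \<le> s \<Longrightarrow> strip r \<subseteq> strip s"
  by (auto simp: strip_def)

lemma holo2_identity_strip:
  assumes "holo2 f (strip r)" "holo2 g (strip r)" "r > 0"
    and "\<And>x y. f (complex_of_real x, complex_of_real y) = g (complex_of_real x, complex_of_real y)"
    and "z \<in> strip r"
  shows "f z = g z"
proof (rule holo2_identity[where a=0 and b=0])
  show "holo2 f ({z. \<bar>Im z\<bar> < r} \<times> {z. \<bar>Im z\<bar> < r})" "holo2 g ({z. \<bar>Im z\<bar> < r} \<times> {z. \<bar>Im z\<bar> < r})"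
    "z \<in> {z. \<bar>Im z\<bar> < r} \<times> {z. \<bar>Im z\<bar> < r}"
    using assms by (auto simp flip: strip_eq_Times)
qed (use assms in \<open>auto intro: open_Im_strip convex_connected convex_Im_strip\<close>)

text \<open>Uniqueness of the extension makes the choice in \<open>hext\<close> harmless: any
  explicit extension may be used to estimate \<open>dist_r\<close>.\<close>

lemma hext_eq:
  assumes "bounded_holo_ext r f g" "r > 0" "z \<in> strip r"
  shows "hext r f z = g z"
proof -
  have "bounded_holo_ext r f (hext r f)"
    unfolding hext_def by (rule someI[of "bounded_holo_ext r f", OF assms(1)])
  with assms show ?thesis
    unfolding bounded_holo_ext_def by (auto intro: holo2_identity_strip[of _ r])
qed

lemma dist_r_le:
  assumes "bounded_holo_ext r (disp1 F) f1" "bounded_holo_ext r (disp2 F) f2"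
    and "bounded_holo_ext r (disp1 G) g1" "bounded_holo_ext r (disp2 G) g2"
    and "r > 0"
    and "\<And>z. z \<in> strip r \<Longrightarrow> cmod (f1 z - g1 z) \<le> e"
    and "\<And>z. z \<in> strip r \<Longrightarrow> cmod (f2 z - g2 z) \<le> e"
  shows "dist_r r F G \<le> e"
proof -
  have ne: "strip r \<noteq> {}" using \<open>r > 0\<close> by (auto simp: strip_def intro!: exI[of _ 0])
  show ?thesis
    unfolding dist_r_def using assms
    by (intro max.boundedI cSUP_least ne) (auto simp: hext_eq)
qed

section \<open>Extension of equivariant analytic functions to a strip\<close>

definition shift2 :: "int \<times> int \<Rightarrow> complex \<times> complex" where
  "shift2 k = (of_int (fst k), of_int (snd k))"

text \<open>The constant \<open>c k\<close> records the effect of the deck transformation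
  \<open>k\<close>. For a coordinate of a torus map it is a row of the integer matrix of the map
  applied to \<open>k\<close>; for a displacement of a map homotopic to the identity it is
  0.\<close>

definition equivariant :: "real \<Rightarrow> (int \<times> int \<Rightarrow> complex) \<Rightarrow> (complex \<times> complex \<Rightarrow> complex) \<Rightarrow> bool" where
  "equivariant r c g \<longleftrightarrow> (\<forall>z\<in>strip r. \<forall>k. g (z + shift2 k) = g z + c k)"

text \<open>The domain \<open>U\<close> may become arbitrarily thin far from the origin, so no strip
  is given in advance. Compactness supplies a uniform width over one cell, equivariance carries it
  to all others, and the identity theorem on overlaps makes the translates of the local extension
  fit together.\<close>

lemma real_analytic2_extension:
  assumes an: "real_analytic2 f"
    and eqv: "\<And>x y m n. f (x + of_int m, y + of_int n) = f (x, y) + c (m, n)"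
  obtains r g where "r > 0" "holo2 g (strip r)"
    "\<And>x y. g (complex_of_real x, complex_of_real y) = complex_of_real (f (x, y))"
    "equivariant r (\<lambda>k. complex_of_real (c k)) g"
proof -
  obtain U g where U: "open U" "\<And>x y. (complex_of_real x, complex_of_real y) \<in> U"
    and g: "holo2 g U" "\<And>x y. g (complex_of_real x, complex_of_real y) = complex_of_real (f (x, y))"
    using an unfolding real_analytic2_def by blast
  define K where "K = (\<lambda>(x,y). (complex_of_real x, complex_of_real y)) ` ({-1..2} \<times> {-1..2})"
  have "compact K"
    unfolding K_def case_prod_unfold
    by (intro compact_continuous_image compact_Times continuous_intros) auto
  moreover have "K \<subseteq> U" using U(2) by (auto simp: K_def)
  ultimately obtain d where d: "d > 0" "\<And>x. x \<in> K \<Longrightarrow> ball x d \<subseteq> U"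
    using compact_subset_open_imp_ball_epsilon_subset[of K U] U(1)
    by (metis UN_subset_iff)
  \<comment> \<open>A point of the box is at most the sum of the moduli of its two imaginary parts
    away from the real plane, hence the factor 2.\<close>
  define r where "r = d / 2"
  have r: "r > 0" using d by (simp add: r_def)
  \<comment> \<open>The open box exceeds the unit cell, so that neighbouring translates overlap and
    every point of the strip can be moved into its interior.\<close>
  define I where "I = {z. -1 < Re z \<and> Re z < 2 \<and> \<bar>Im z\<bar> < r}"
  have box: "I \<times> I \<subseteq> U"
  proof
    fix z assume z: "z \<in> I \<times> I"
    define w where "w = (complex_of_real (Re (fst z)), complex_of_real (Re (snd z)))"
    have "w \<in> K"
      unfolding K_def
      by (rule image_eqI[of _ _ "(Re (fst z), Re (snd z))"]) (use z in \<open>auto simp: w_def I_def\<close>)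
    moreover have "dist w z < d"
    proof -
      have "dist w z \<le> dist (fst w) (fst z) + dist (snd w) (snd z)"
        using sqrt_sum_squares_le_sum[of "dist (fst w) (fst z)" "dist (snd w) (snd z)"]
        by (simp add: dist_prod_def)
      also have "\<dots> = \<bar>Im (fst z)\<bar> + \<bar>Im (snd z)\<bar>"
        by (simp add: w_def dist_complex_def cmod_def)
      also have "\<dots> < d" using z by (auto simp: I_def r_def mem_Times_iff)
      finally show ?thesis .
    qed
    ultimately show "z \<in> U" using d(2) mem_ball by blast
  qed
  have opI: "open (I)"
    unfolding I_def by (intro open_Collect_conj open_Collect_less continuous_intros)
  have cvI: "convex I"
  proof -
    have "I = {z. Re z > -1} \<inter> {z. Re z < 2} \<inter> {z. \<bar>Im z\<bar> < r}" by (auto simp: I_def)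
    then show ?thesis
      by (simp add: convex_Int convex_halfspace_Re_lt convex_halfspace_Re_gt convex_Im_strip)
  qed
  have gI: "holo2 g (I \<times> I)" using g(1) box by (rule holo2_subset)
  have key: "g (z + shift2 k) = g z + complex_of_real (c k)"
    if z: "z \<in> I \<times> I" "z + shift2 k \<in> I \<times> I" for z k
  proof -
    \<comment> \<open>\<open>A \<times> B\<close> is the overlap of the box with its translate. Both
      factors are convex and contain a real point, as the identity theorem demands.\<close>
    define A where "A = I \<inter> ((\<lambda>z. z + of_int (fst k)) -` I)"
    define B where "B = I \<inter> ((\<lambda>z. z + of_int (snd k)) -` I)"
    have cv: "convex ((\<lambda>z. z + a) -` I)" for a
    proof -
      have "(\<lambda>z. z + a) -` I = (\<lambda>z. - a + z) ` I"
        by (auto simp: image_iff algebra_simps intro!: bexI[of _ "_ + a"])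
      then show ?thesis using cvI by (simp add: convex_translation)
    qed
    have op: "open ((\<lambda>z. z + a) -` I)" for a
      by (intro open_vimage opI continuous_intros)
    have AB: "open A" "open B" "connected A" "connected B"
      unfolding A_def B_def by (auto intro!: open_Int op opI convex_connected convex_Int cv cvI)
    have zA: "fst z \<in> A" "snd z \<in> B" using z by (auto simp: A_def B_def shift2_def mem_Times_iff)
    have reA: "complex_of_real (Re (fst z)) \<in> A" "complex_of_real (Re (snd z)) \<in> B"
      using z r by (auto simp: A_def B_def shift2_def mem_Times_iff I_def)
    have h1: "holo2 (\<lambda>z. g (fst z + of_int (fst k), snd z + of_int (snd k))) (A \<times> B)"
      by (rule holo2_compose2[where V="I \<times> I"])
         (auto intro!: holo2_add holo2_fst holo2_snd holo2_const gI simp: A_def B_def)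
    have h2: "holo2 (\<lambda>z. g z + complex_of_real (c k)) (A \<times> B)"
      by (intro holo2_add holo2_const holo2_subset[OF gI]) (auto simp: A_def B_def)
    have "g (fst z + of_int (fst k), snd z + of_int (snd k)) = g z + complex_of_real (c k)"
    proof (rule holo2_identity[OF h1 h2 AB(1,3) reA(1) AB(2,4) reA(2)])
      fix x y
      have "g (complex_of_real (x + of_int (fst k)), complex_of_real (y + of_int (snd k)))
            = g (complex_of_real x, complex_of_real y) + complex_of_real (c k)"
        unfolding g(2) using eqv[of x "fst k" y "snd k"] by simp
      then show "g (fst (complex_of_real x, complex_of_real y) + of_int (fst k), snd (complex_of_real x, complex_of_real y) + of_int (snd k))
            = g (complex_of_real x, complex_of_real y) + complex_of_real (c k)" by simp
    qed (use zA in \<open>auto simp: mem_Times_iff\<close>)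
    then show ?thesis by (simp add: shift2_def plus_prod_def)
  qed
  define fl where "fl z = (\<lfloor>Re (fst z)\<rfloor>, \<lfloor>Re (snd z)\<rfloor>)" for z :: "complex \<times> complex"
  define G where "G z = g (z - shift2 (fl z)) + complex_of_real (c (fl z))" for z
  \<comment> \<open>Additivity of \<open>c\<close> comes from comparing one shift of
    \<open>f\<close> at the origin with two successive ones.\<close>
  have cadd: "c (k + l) = c k + c l" for k l
  proof -
    have "f (0 + of_int (fst k + fst l), 0 + of_int (snd k + snd l)) = f (0,0) + c (k + l)"
      unfolding eqv by (simp add: plus_prod_def)
    moreover have "f ((0 + of_int (fst k)) + of_int (fst l), (0 + of_int (snd k)) + of_int (snd l)) = f (0,0) + c k + c l"
      unfolding eqv by simp
    ultimately show ?thesis by (simp add: add.assoc)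
  qed
  have shadd: "shift2 (k + l) = shift2 k + shift2 l" for k l
    by (simp add: shift2_def)
  have base: "z - shift2 (fl z) \<in> I \<times> I" if "z \<in> strip r" for z
    using that unfolding I_def strip_def fl_def shift2_def mem_Times_iff
    by (simp) linarith
  \<comment> \<open>The integer part \<open>fl\<close> jumps at the edges of the cells. Near a given
    point one fixed \<open>k\<close> can replace it, which exhibits \<open>G\<close> as a translate
    of \<open>g\<close> on an open set.\<close>
  have Geq: "G z = g (z - shift2 k) + complex_of_real (c k)"
    if z: "z \<in> strip r" "z - shift2 k \<in> I \<times> I" for z k
  proof -
    have "g ((z - shift2 k) + shift2 (k - fl z)) = g (z - shift2 k) + complex_of_real (c (k - fl z))"
      using key[of "z - shift2 k" "k - fl z"] z base[OF z(1)] shadd[of "k - fl z" "fl z"]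
      by (auto simp: algebra_simps)
    moreover have "(z - shift2 k) + shift2 (k - fl z) = z - shift2 (fl z)"
      using shadd[of "k - fl z" "fl z"] by (auto simp: algebra_simps)
    moreover have "c (k - fl z) + c (fl z) = c k" using cadd[of "k - fl z" "fl z"] by simp
    ultimately show ?thesis unfolding G_def
      by (metis (no_types, lifting) add.assoc of_real_add)
  qed
  show ?thesis
  proof (rule that[OF r])
    show "holo2 G (strip r)"
      unfolding holo2_iff
    proof
      fix z assume z: "z \<in> strip r"
      define k where "k = fl z"
      have op: "open (strip r \<inter> ((\<lambda>z. z - shift2 k) -` (I \<times> I)))"
        by (intro open_Int open_strip open_vimage open_Times opI continuous_intros)
      have zin: "z \<in> strip r \<inter> ((\<lambda>z. z - shift2 k) -` (I \<times> I))"
        using z base[OF z] by (auto simp: k_def)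
      obtain a b where ab: "(g has_derivative (\<lambda>v. a * fst v + b * snd v)) (at (z - shift2 k))"
        using gI[unfolded holo2_iff, rule_format, of "z - shift2 k"] zin by (auto simp only: Int_iff vimage_eq)
      have "((\<lambda>z. z - shift2 k) has_derivative (\<lambda>v. v)) (at z)"
        by (auto intro!: derivative_eq_intros)
      from has_derivative_compose[OF this ab]
      have "((\<lambda>z. g (z - shift2 k) + complex_of_real (c k)) has_derivative (\<lambda>v. a * fst v + b * snd v)) (at z)"
        by (auto intro!: derivative_eq_intros)
      then have "(G has_derivative (\<lambda>v. a * fst v + b * snd v)) (at z)"
        by (rule has_derivative_transform_within_open[OF _ op zin]) (metis Int_iff vimage_eq Geq)
      then show "\<exists>a b. (G has_derivative (\<lambda>v. a * fst v + b * snd v)) (at z)" by blast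
    qed
  next
    fix x y
    have "complex_of_real x - of_int \<lfloor>x\<rfloor> = complex_of_real (x - of_int \<lfloor>x\<rfloor>)" for x by simp
    then have "G (complex_of_real x, complex_of_real y) =
       complex_of_real (f (x - of_int \<lfloor>x\<rfloor>, y - of_int \<lfloor>y\<rfloor>) + c (\<lfloor>x\<rfloor>, \<lfloor>y\<rfloor>))"
      unfolding G_def fl_def shift2_def by (simp del: of_real_diff add: g(2))
    also have "f (x - of_int \<lfloor>x\<rfloor>, y - of_int \<lfloor>y\<rfloor>) + c (\<lfloor>x\<rfloor>, \<lfloor>y\<rfloor>) = f (x, y)"
      using eqv[of "x - of_int \<lfloor>x\<rfloor>" "\<lfloor>x\<rfloor>" "y - of_int \<lfloor>y\<rfloor>" "\<lfloor>y\<rfloor>"] by simp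
    finally show "G (complex_of_real x, complex_of_real y) = complex_of_real (f (x, y))" .
  next
    show "equivariant r (\<lambda>k. complex_of_real (c k)) G"
      unfolding equivariant_def
    proof (intro ballI allI)
      fix z k
      have "fl (z + shift2 k) = fl z + k" by (simp add: fl_def shift2_def plus_prod_def)
      then show "G (z + shift2 k) = G z + complex_of_real (c k)"
        unfolding G_def by (simp add: shadd cadd)
    qed
  qed
qed

text \<open>An integer translation brings \<open>z\<close> into a unit cell and the nearby
  \<open>w\<close>, moved by the same vector, into the larger compact rectangle \<open>Q\<close>;
  the additive constants cancel in the difference. The margin \<open>s < r\<close> keeps the closed
  rectangle inside the domain.\<close>

lemma equivariant_uniformly_continuous:
  assumes "holo2 g (strip r)" "equivariant r c g" "s < r"
  shows "uniformly_continuous_on (strip s) g"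
proof -
  define Q where "Q = cbox (Complex (-1) (-s)) (Complex 2 s)"
  have Qs: "Q \<times> Q \<subseteq> strip r"
    using assms(3) by (auto simp: Q_def strip_def in_cbox_complex_iff)
  have "continuous_on (Q \<times> Q) g"
    using holo2_continuous_on[OF assms(1)] Qs continuous_on_subset by blast
  then have uc: "uniformly_continuous_on (Q \<times> Q) g"
    by (rule compact_uniformly_continuous) (simp add: Q_def compact_Times)
  show ?thesis
    unfolding uniformly_continuous_on_def
  proof (intro allI impI)
    fix e :: real assume "e > 0"
    obtain d where d: "d > 0"
      "\<And>z w. z \<in> Q \<times> Q \<Longrightarrow> w \<in> Q \<times> Q \<Longrightarrow> dist w z < d \<Longrightarrow> dist (g w) (g z) < e"
      using uc[unfolded uniformly_continuous_on_def, rule_format, OF \<open>e > 0\<close>] by metis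
    have "dist (g w) (g z) < e"
      if zw: "z \<in> strip s" "w \<in> strip s" "dist w z < min d 1" for z w
    proof -
      define k where "k = (\<lfloor>Re (fst z)\<rfloor>, \<lfloor>Re (snd z)\<rfloor>)"
      have z': "z - shift2 k \<in> Q \<times> Q"
        using zw(1) unfolding k_def shift2_def Q_def mem_Times_iff in_cbox_complex_iff strip_def
        by simp linarith
      have "\<bar>Re (fst w) - Re (fst z)\<bar> \<le> dist w z"
        using abs_Re_le_cmod[of "fst w - fst z"] dist_fst_le[of w z] by (simp add: dist_norm)
      moreover have "\<bar>Re (snd w) - Re (snd z)\<bar> \<le> dist w z"
        using abs_Re_le_cmod[of "snd w - snd z"] dist_snd_le[of w z] by (simp add: dist_norm)
      ultimately have w': "w - shift2 k \<in> Q \<times> Q"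
        using zw unfolding k_def shift2_def Q_def mem_Times_iff in_cbox_complex_iff strip_def
        by simp linarith
      have "dist (g (w - shift2 k)) (g (z - shift2 k)) < e"
        using d(2)[OF z' w'] zw(3) by (simp add: dist_norm)
      moreover have "g (w - shift2 k) + c k = g w" "g (z - shift2 k) + c k = g z"
        using assms(2,3) zw strip_mono[of s r] Qs z' w' unfolding equivariant_def
        by (metis diff_add_cancel subsetD)+
      ultimately show ?thesis by (metis dist_add_cancel2)
    qed
    then show "\<exists>d>0. \<forall>z\<in>strip s. \<forall>w\<in>strip s. dist w z < d \<longrightarrow> dist (g w) (g z) < e"
      using d(1) by (intro exI[of _ "min d 1"]) auto
  qed
qed

lemma periodic_bounded_on_strip:
  assumes "holo2 g (strip r)" "equivariant r (\<lambda>_. 0) g" "s < r"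
  shows "\<exists>B. \<forall>z\<in>strip s. norm (g z) \<le> B"
proof -
  define Q where "Q = cbox (Complex (-1) (-s)) (Complex 2 s)"
  have Qs: "Q \<times> Q \<subseteq> strip r"
    using assms(3) by (auto simp: Q_def strip_def in_cbox_complex_iff)
  have "continuous_on (Q \<times> Q) g"
    using holo2_continuous_on[OF assms(1)] Qs continuous_on_subset by blast
  then have "compact (g ` (Q \<times> Q))"
    by (rule compact_continuous_image) (simp add: Q_def compact_Times)
  then obtain B where B: "\<And>z. z \<in> Q \<times> Q \<Longrightarrow> norm (g z) \<le> B"
    by (meson bounded_iff compact_imp_bounded image_eqI)
  have "norm (g z) \<le> B" if zw: "z \<in> strip s" for z
  proof -
    define k where "k = (\<lfloor>Re (fst z)\<rfloor>, \<lfloor>Re (snd z)\<rfloor>)"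
    have z': "z - shift2 k \<in> Q \<times> Q"
      using zw unfolding k_def shift2_def Q_def mem_Times_iff in_cbox_complex_iff strip_def
      by simp linarith
    then have "g (z - shift2 k) = g z"
      using assms(2) Qs unfolding equivariant_def by (metis diff_add_cancel subsetD add_0_right)
    then show ?thesis using B[OF z'] by simp
  qed
  then show ?thesis by blast
qed

section \<open>Measures on the torus\<close>

definition torus_char :: "int \<Rightarrow> int \<Rightarrow> real \<times> real \<Rightarrow> complex" where
  "torus_char j k p = cis (2 * pi * (of_int j * fst p + of_int k * snd p))"

inductive trig_poly :: "(real \<times> real \<Rightarrow> complex) \<Rightarrow> bool" where
  trig_poly_char: "trig_poly (\<lambda>p. c * torus_char j k p)"
| trig_poly_add: "trig_poly f \<Longrightarrow> trig_poly g \<Longrightarrow> trig_poly (\<lambda>p. f p + g p)"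

lemma torus_char_mult: "torus_char j k p * torus_char j' k' p = torus_char (j + j') (k + k') p"
  by (simp add: torus_char_def cis_mult algebra_simps)

lemma continuous_on_cis_comp [continuous_intros]:
  "continuous_on S f \<Longrightarrow> continuous_on S (\<lambda>x. cis (f x))"
  unfolding cis_conv_exp by (intro continuous_intros)

lemma torus_char_continuous: "continuous_on S (torus_char j k)"
  unfolding torus_char_def by (intro continuous_intros)

lemma torus_char_measurable [measurable]: "torus_char j k \<in> borel_measurable borel"
  by (intro borel_measurable_continuous_onI torus_char_continuous)

lemma norm_torus_char [simp]: "norm (torus_char j k p) = 1"
  by (simp add: torus_char_def)

lemma trig_poly_mult:
  assumes "trig_poly f" "trig_poly g"
  shows "trig_poly (\<lambda>p. f p * g p)"
proof -
  have 1: "trig_poly (\<lambda>p. c * torus_char j k p * g p)" for c j k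
    using assms(2)
  proof induction
    case (trig_poly_char c' j' k')
    have "(\<lambda>p. c * torus_char j k p * (c' * torus_char j' k' p)) =
          (\<lambda>p. (c * c') * torus_char (j + j') (k + k') p)"
      by (simp add: torus_char_mult[symmetric] algebra_simps)
    then show ?case by (simp only: trig_poly.trig_poly_char)
  next
    case (trig_poly_add f g)
    then show ?case unfolding distrib_left by (intro trig_poly.trig_poly_add)
  qed
  show ?thesis using assms(1)
  proof induction
    case (trig_poly_char c j k)
    then show ?case by (rule 1)
  next
    case (trig_poly_add f g)
    then show ?case unfolding distrib_right by (intro trig_poly.trig_poly_add)
  qed
qed

text \<open>Placing the torus as a compact set in C^2 avoids the artificial discontinuities along
  the edges of the half-open square and makes Stone-Weierstrass available.\<close>

definition torus_embed :: "real \<times> real \<Rightarrow> complex \<times> complex" where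
  "torus_embed p = (cis (2 * pi * fst p), cis (2 * pi * snd p))"

lemma torus_embed_continuous: "continuous_on S torus_embed"
  unfolding torus_embed_def by (intro continuous_intros)

lemma torus_embed_inj: "inj_on torus_embed ({0..<1} \<times> {0..<1})"
proof -
  have "a = b" if "a \<in> {0..<1}" "b \<in> {0..<1}" "cis (2 * pi * a) = cis (2 * pi * b)" for a b :: real
  proof -
    have "cis (2 * pi * a - 2 * pi * b) = 1"
      using that(3) by (simp add: cis_divide[symmetric])
    then have "cos (2 * pi * a - 2 * pi * b) = 1" by (metis cis.sel(1) one_complex.sel(1))
    then obtain n :: int where "2 * pi * a - 2 * pi * b = of_int n * 2 * pi"
      using cos_one_2pi_int by metis
    then have "2 * pi * (a - b) = 2 * pi * of_int n" by (simp add: algebra_simps)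
    then have "a - b = of_int n" by simp
    moreover from this have "\<bar>real_of_int n\<bar> < 1" using that(1,2) by auto
    then have "n = 0" by linarith
    ultimately show ?thesis by simp
  qed
  then show ?thesis by (auto simp: inj_on_def torus_embed_def)
qed

lemma trig_poly_polynomial:
  assumes "real_polynomial_function F"
  shows "trig_poly (\<lambda>p. complex_of_real (F (torus_embed p)))"
  using assms
proof induction
  case (linear F)
  interpret F: bounded_linear F by fact
  \<comment> \<open>Euler's formula: \<open>A cos x + B sin x\<close> has the coefficients (A - i
    B)/2 and (A + i B)/2 at \<open>cis x\<close> and \<open>cis (-x)\<close>.\<close>
  have "complex_of_real (F (torus_embed p)) =
     (of_real (F (1,0)) - \<i> * of_real (F (\<i>,0))) / 2 * torus_char 1 0 p
     + (of_real (F (1,0)) + \<i> * of_real (F (\<i>,0))) / 2 * torus_char (-1) 0 p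
     + ((of_real (F (0,1)) - \<i> * of_real (F (0,\<i>))) / 2 * torus_char 0 1 p
     + (of_real (F (0,1)) + \<i> * of_real (F (0,\<i>))) / 2 * torus_char 0 (-1) p)" for p
  proof -
    define x where "x = 2 * pi * fst p"
    define y where "y = 2 * pi * snd p"
    have "torus_embed p = cos x *\<^sub>R (1,0) + sin x *\<^sub>R (\<i>,0) + cos y *\<^sub>R (0,1) + sin y *\<^sub>R (0,\<i>)"
      by (auto simp: torus_embed_def prod_eq_iff complex_eq_iff x_def y_def)
    then have "F (torus_embed p) = cos x * F (1,0) + sin x * F (\<i>,0) + cos y * F (0,1) + sin y * F (0,\<i>)"
      by (metis F.add F.scaleR real_scaleR_def)
    moreover have "torus_char 1 0 p = cis x" "torus_char (-1) 0 p = cis (-x)"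
      "torus_char 0 1 p = cis y" "torus_char 0 (-1) p = cis (-y)"
      by (simp_all add: torus_char_def x_def y_def)
    ultimately show ?thesis
      by (simp add: complex_eq_iff field_simps)
  qed
  then show ?case
    by (simp only:) (intro trig_poly_add trig_poly_char)
next
  case (const c)
  then show ?case using trig_poly_char[of "of_real c" 0 0] by (simp add: torus_char_def)
next
  case (add f g)
  then show ?case by (simp add: trig_poly_add)
next
  case (mult f g)
  then show ?case by (simp add: trig_poly_mult)
qed

definition torus_prob :: "(real \<times> real) measure \<Rightarrow> bool" where
  "torus_prob M \<longleftrightarrow> prob_space M \<and> sets M = sets borel \<and> emeasure M ({0..<1} \<times> {0..<1}) = 1"

lemma torus_prob_AE:
  assumes "torus_prob M"
  shows "AE p in M. p \<in> {0..<1} \<times> {0..<1}"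
proof -
  interpret prob_space M using assms by (simp add: torus_prob_def)
  have "({0..<1::real} \<times> {0..<1::real}) \<in> sets M"
    using assms by (simp add: torus_prob_def borel_Times)
  then show ?thesis
    using assms by (subst AE_in_set_eq_1) (auto simp: torus_prob_def measure_def)
qed

lemma prob_integrable_bounded_borel:
  fixes f :: "'a::topological_space \<Rightarrow> 'b::{banach, second_countable_topology}"
  assumes "prob_space M" "sets M = sets borel" "f \<in> borel_measurable borel" "\<And>x. norm (f x) \<le> B"
  shows "integrable M f"
proof -
  interpret prob_space M by fact
  show ?thesis
    using assms by (intro integrable_const_bound[where B=B]) (auto cong: measurable_cong_sets)
qed

text \<open>The coefficients fix the integrals of trigonometric polynomials, by Stone-Weierstrass
  those of continuous functions on the torus, through cut-off functions the masses of compact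
  subsets of the half-open square, and by inner regularity the whole measure. The coefficient at (0,
  0) is the total mass 1.\<close>

lemma torus_prob_eqI:
  assumes M: "torus_prob M" and N: "torus_prob N"
    and eq: "\<And>j k. (j, k) \<noteq> (0, 0) \<Longrightarrow> (\<integral>p. torus_char j k p \<partial>M) = (\<integral>p. torus_char j k p \<partial>N)"
  shows "M = N"
proof -
  interpret M: prob_space M using M by (simp add: torus_prob_def)
  interpret N: prob_space N using N by (simp add: torus_prob_def)
  have sM: "sets M = sets borel" and sN: "sets N = sets borel"
    using M N by (auto simp: torus_prob_def)
  have spM: "space M = UNIV" and spN: "space N = UNIV"
    using sM sN by (metis sets_eq_imp_space_eq space_borel)+
  have mM: "f \<in> borel_measurable M" and mN: "f \<in> borel_measurable N"
    if "f \<in> borel_measurable borel" for f :: "real \<times> real \<Rightarrow> 'b::topological_space"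
    using that sM sN by (auto cong: measurable_cong_sets)
  have eq': "(\<integral>p. torus_char j k p \<partial>M) = (\<integral>p. torus_char j k p \<partial>N)" for j k
  proof (cases "(j, k) = (0, 0)")
    case True
    then show ?thesis by (simp add: torus_char_def M.prob_space N.prob_space)
  qed (use eq in auto)
  have trig: "integrable M f \<and> integrable N f \<and> (\<integral>p. f p \<partial>M) = (\<integral>p. f p \<partial>N)" if "trig_poly f" for f
    using that
  proof induction
    case (trig_poly_char c j k)
    have "integrable M (torus_char j k)" "integrable N (torus_char j k)"
      by (auto intro!: prob_integrable_bounded_borel[where B=1] M.prob_space_axioms N.prob_space_axioms sM sN)
    then show ?case using eq' by simp
  qed simp
  define K where "K = sphere (0::complex) 1 \<times> sphere (0::complex) 1"
  have K: "compact K" by (simp add: K_def compact_Times)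
  have EK: "torus_embed p \<in> K" for p by (simp add: torus_embed_def K_def)
  have cont: "(\<integral>p. F (torus_embed p) \<partial>M) = (\<integral>p. F (torus_embed p) \<partial>N)"
    if F: "continuous_on UNIV F" for F :: "complex \<times> complex \<Rightarrow> real"
  proof -
    have FE: "(\<lambda>p. F (torus_embed p)) \<in> borel_measurable borel"
      by (intro borel_measurable_continuous_onI continuous_on_compose2[OF F] torus_embed_continuous) auto
    have "compact (F ` K)"
      using F K compact_continuous_image continuous_on_subset by blast
    then obtain B where B: "\<And>z. z \<in> K \<Longrightarrow> norm (F z) \<le> B"
      by (meson bounded_iff compact_imp_bounded image_eqI)
    have iM: "integrable M (\<lambda>p. F (torus_embed p))" and iN: "integrable N (\<lambda>p. F (torus_embed p))"
      using prob_integrable_bounded_borel[OF M.prob_space_axioms sM FE, of B]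
        prob_integrable_bounded_borel[OF N.prob_space_axioms sN FE, of B] B[OF EK] by simp_all
    have small: "\<bar>(\<integral>p. F (torus_embed p) \<partial>M) - (\<integral>p. F (torus_embed p) \<partial>N)\<bar> \<le> e" if "e > 0" for e
    proof -
      obtain P where P: "real_polynomial_function P" "\<And>z. z \<in> K \<Longrightarrow> \<bar>F z - P z\<bar> < e / 2"
        using Stone_Weierstrass_real_polynomial_function[OF K, of F "e / 2"] F \<open>e > 0\<close>
        by (metis continuous_on_subset half_gt_zero subset_UNIV)
      have Pe: "\<bar>F (torus_embed p) - P (torus_embed p)\<bar> \<le> e / 2" for p
        using P(2)[OF EK] by (rule less_imp_le)
      note T = trig[OF trig_poly_polynomial[OF P(1)]]
      have pM: "integrable M (\<lambda>p. P (torus_embed p))" and pN: "integrable N (\<lambda>p. P (torus_embed p))"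
        using T by (auto simp: complex_of_real_integrable_eq)
      have pe: "(\<integral>p. P (torus_embed p) \<partial>M) = (\<integral>p. P (torus_embed p) \<partial>N)"
        using T by (simp add: of_real_eq_iff)
      have "\<bar>(\<integral>p. F (torus_embed p) - P (torus_embed p) \<partial>M)\<bar> \<le> (\<integral>p. e / 2 \<partial>M)"
        using iM pM Pe by (intro order_trans[OF integral_abs_bound] integral_mono) simp_all
      moreover have "\<bar>(\<integral>p. F (torus_embed p) - P (torus_embed p) \<partial>N)\<bar> \<le> (\<integral>p. e / 2 \<partial>N)"
        using iN pN Pe by (intro order_trans[OF integral_abs_bound] integral_mono) simp_all
      moreover have "\<bar>a - b\<bar> \<le> e" if "\<bar>a - c\<bar> \<le> e / 2" "\<bar>b - c\<bar> \<le> e / 2" for a b c :: real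
        using that by linarith
      ultimately show ?thesis
        unfolding Bochner_Integration.integral_diff[OF iM pM] Bochner_Integration.integral_diff[OF iN pN] pe
        by (simp only: lebesgue_integral_const M.prob_space N.prob_space scaleR_one)
    qed
    \<comment> \<open>Applied to half of the difference itself, \<open>small\<close> leaves only the
      value 0.\<close>
    show ?thesis
      using small[of "\<bar>(\<integral>p. F (torus_embed p) \<partial>M) - (\<integral>p. F (torus_embed p) \<partial>N)\<bar> / 2"] by force
  qed
  have comp: "emeasure M A = emeasure N A" if A: "compact A" "A \<subseteq> {0..<1} \<times> {0..<1}" for A
  proof (cases "A = {}")
    case False
    define C where "C = torus_embed ` A"
    have C: "compact C" "C \<noteq> {}"
      using A False by (auto simp: C_def intro!: compact_continuous_image torus_embed_continuous)
    \<comment> \<open>Continuous cut-offs that decrease to the indicator of the closed set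
      \<open>C\<close> as \<open>n\<close> grows.\<close>
    define F where "F n z = max 0 (1 - real n * infdist z C)" for n z
    have contF: "continuous_on UNIV (F n)" for n
      unfolding F_def by (intro continuous_intros)
    have FE: "(\<lambda>p. F n (torus_embed p)) \<in> borel_measurable borel" for n
      by (intro borel_measurable_continuous_onI continuous_on_compose2[OF contF] torus_embed_continuous) auto
    have bnd: "norm (F n z) \<le> 1" for n z
      by (auto simp: F_def infdist_nonneg)
    have Aset: "A \<in> sets borel" using A(1) by (simp add: borel_compact)
    have lim: "(\<lambda>n. F n (torus_embed p)) \<longlonglongrightarrow> indicator A p" if p: "p \<in> {0..<1} \<times> {0..<1}" for p
    proof (cases "p \<in> A")
      case True
      then have "infdist (torus_embed p) C = 0" by (simp add: C_def)
      then show ?thesis using True by (simp add: F_def)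
    next
      case False
      \<comment> \<open>Injectivity of the embedding is at hand only on the half-open square; both
        measures live there, so convergence almost everywhere is enough.\<close>
      then have "torus_embed p \<notin> C"
        unfolding C_def using inj_on_image_mem_iff[OF torus_embed_inj p A(2)] by simp
      then have pos: "infdist (torus_embed p) C > 0"
        using C by (metis compact_imp_closed in_closed_iff_infdist_zero infdist_nonneg less_eq_real_def)
      then obtain m where m: "1 < real m * infdist (torus_embed p) C"
        using ex_less_of_nat_mult by blast
      have "F n (torus_embed p) = 0" if "n \<ge> m" for n
      proof -
        have "real m * infdist (torus_embed p) C \<le> real n * infdist (torus_embed p) C"
          using that pos by (intro mult_right_mono) auto
        then show ?thesis using m by (auto simp: F_def)
      qed
      then show ?thesis using False
        by (auto intro!: tendsto_eventually eventually_sequentiallyI)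
    qed
    have "(\<lambda>n. \<integral>p. F n (torus_embed p) \<partial>M) \<longlonglongrightarrow> (\<integral>p. indicator A p \<partial>M)"
    proof (rule integral_dominated_convergence[where w="\<lambda>_. 1"])
      show "AE p in M. (\<lambda>n. F n (torus_embed p)) \<longlonglongrightarrow> indicator A p"
        using torus_prob_AE[OF M] by eventually_elim (rule lim)
    qed (auto intro!: mM FE borel_measurable_indicator Aset simp: bnd[unfolded real_norm_def] sM sN)
    moreover have "(\<lambda>n. \<integral>p. F n (torus_embed p) \<partial>N) \<longlonglongrightarrow> (\<integral>p. indicator A p \<partial>N)"
    proof (rule integral_dominated_convergence[where w="\<lambda>_. 1"])
      show "AE p in N. (\<lambda>n. F n (torus_embed p)) \<longlonglongrightarrow> indicator A p"
        using torus_prob_AE[OF N] by eventually_elim (rule lim)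
    qed (auto intro!: mN FE borel_measurable_indicator Aset simp: bnd[unfolded real_norm_def] sM sN)
    ultimately have "(\<integral>p. indicator A p \<partial>M) = (\<integral>p. indicator A p \<partial>N :: real)"
      unfolding cont[OF contF] by (rule LIMSEQ_unique)
    then have "measure M A = measure N A"
      using Aset by (simp add: sM sN spM spN)
    then show ?thesis by (simp add: M.emeasure_eq_measure N.emeasure_eq_measure)
  qed simp
  show ?thesis
  proof (rule measure_eqI)
    show "sets M = sets N" using sM sN by simp
    fix X assume X: "X \<in> sets M"
    define Y where "Y = X \<inter> ({0..<1} \<times> {0..<1})"
    have Q: "({0..<1::real} \<times> {0..<1::real}) \<in> sets borel" by (simp add: borel_Times)
    have Y: "Y \<in> sets borel" using X Q sM by (auto simp: Y_def)
    have XY: "emeasure M X = emeasure M Y" "emeasure N X = emeasure N Y"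
      using torus_prob_AE[OF M] torus_prob_AE[OF N] X Y sM sN
      by (auto intro!: emeasure_eq_AE simp: Y_def)
    have "emeasure M Y = (SUP K \<in> {K. K \<subseteq> Y \<and> compact K}. emeasure M K)"
      by (rule inner_regular) (auto simp: sM Y)
    also have "\<dots> = (SUP K \<in> {K. K \<subseteq> Y \<and> compact K}. emeasure N K)"
      by (intro SUP_cong refl comp) (auto simp: Y_def)
    also have "\<dots> = emeasure N Y"
      by (rule inner_regular[symmetric]) (auto simp: sN Y)
    finally show "emeasure M X = emeasure N X" using XY by simp
  qed
qed

section \<open>Maps of the torus and their invariant measures\<close>

lemma torus_char_proj [simp]: "torus_char j k (torus_proj p) = torus_char j k p"
proof -
  have "2 * pi * (of_int j * fst p + of_int k * snd p) =
        2 * pi * (of_int j * fst (torus_proj p) + of_int k * snd (torus_proj p))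
        + 2 * pi * of_int (j * \<lfloor>fst p\<rfloor> + k * \<lfloor>snd p\<rfloor>)"
    by (simp add: torus_proj_def frac_def algebra_simps)
  then show ?thesis
    unfolding torus_char_def by (simp only: cis_mult[symmetric] cis_multiple_2pi[OF Ints_of_int]) simp
qed

lemma torus_proj_range: "torus_proj p \<in> {0..<1} \<times> {0..<1}"
  by (simp add: torus_proj_def frac_lt_1)

lemma torus_proj_id: "p \<in> {0..<1} \<times> {0..<1} \<Longrightarrow> torus_proj p = p"
  by (auto simp: torus_proj_def frac_eq)

lemma torus_proj_measurable [measurable]: "torus_proj \<in> borel_measurable borel"
proof -
  have "(\<lambda>p::real \<times> real. (frac (fst p), frac (snd p))) \<in> measurable (borel \<Otimes>\<^sub>M borel) (borel \<Otimes>\<^sub>M borel)"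
    unfolding frac_def by measurable
  then show ?thesis by (simp add: torus_proj_def[abs_def] borel_prod)
qed

lemma uniquely_ergodic_alt:
  "uniquely_ergodic F \<longleftrightarrow> (\<exists>!M. torus_prob M \<and> distr M borel (torus_proj \<circ> F) = M)"
  unfolding uniquely_ergodic_def torus_prob_def by (simp add: conj_assoc)

lemma torus_prob_distr:
  assumes "torus_prob M" "F \<in> borel_measurable borel"
  shows "torus_prob (distr M borel (torus_proj \<circ> F))"
proof -
  interpret prob_space M using assms by (simp add: torus_prob_def)
  have m: "torus_proj \<circ> F \<in> measurable M borel"
    using assms by (auto simp: torus_prob_def intro!: measurable_comp[OF _ torus_proj_measurable] cong: measurable_cong_sets)
  have "space M = UNIV" using assms by (metis torus_prob_def sets_eq_imp_space_eq space_borel)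
  then have "emeasure (distr M borel (torus_proj \<circ> F)) ({0..<1} \<times> {0..<1}) = 1"
    using m torus_proj_range emeasure_space_1
    by (subst emeasure_distr) (auto simp: borel_Times vimage_def)
  then show ?thesis
    using prob_space_distr[OF m] by (simp add: torus_prob_def)
qed

definition torus_commutes :: "(real \<times> real \<Rightarrow> real \<times> real) \<Rightarrow> bool" where
  "torus_commutes F \<longleftrightarrow> (\<forall>p. torus_proj (F (torus_proj p)) = torus_proj (F p))"

lemma torus_commutesI:
  assumes "\<And>x y m n. \<exists>m' n'. F (x + of_int m, y + of_int n) = F (x, y) + (of_int m', of_int n')"
  shows "torus_commutes F"
  unfolding torus_commutes_def
proof
  fix p
  define q where "q = torus_proj p"
  have "p = (fst q + of_int \<lfloor>fst p\<rfloor>, snd q + of_int \<lfloor>snd p\<rfloor>)"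
    by (auto simp: q_def torus_proj_def frac_def)
  then obtain m' n' where "F p = F (fst q, snd q) + (of_int m', of_int n')"
    using assms by metis
  then show "torus_proj (F (torus_proj p)) = torus_proj (F p)"
    unfolding q_def[symmetric] by (simp add: torus_proj_def frac_def)
qed

lemma torus_commutesD: "torus_commutes F \<Longrightarrow> torus_proj (F (torus_proj p)) = torus_proj (F p)"
  unfolding torus_commutes_def by (rule spec)

text \<open>Pushing forward by \<open>S\<close> and by \<open>T\<close> gives mutually inverse
  bijections between the invariant measures of \<open>H\<close> and those of
  \<open>S \<circ> H \<circ> T\<close>.\<close>

lemma uniquely_ergodic_conj:
  assumes H: "uniquely_ergodic H" and cont: "H \<in> borel_measurable borel"
    and T: "T \<in> borel_measurable borel" "torus_commutes T" and S: "S \<in> borel_measurable borel" "torus_commutes S"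
    and ST: "\<And>p. S (T p) = p" and TS: "\<And>p. T (S p) = p"
    and comm: "torus_commutes H"
  shows "uniquely_ergodic (S \<circ> H \<circ> T)"
proof -
  define G where "G = S \<circ> H \<circ> T"
  have G: "G \<in> borel_measurable borel" 
    unfolding G_def comp_assoc using S T cont by (auto intro!: measurable_comp)
  have GS: "G (S p) = S (H p)" for p by (simp add: G_def TS)
  have TG: "T (G p) = H (T p)" for p by (simp add: G_def TS)
  have comG: "torus_commutes G"
    unfolding torus_commutes_def
  proof
    fix p
    have "torus_proj (S (H (T (torus_proj p)))) = torus_proj (S (torus_proj (H (torus_proj (T (torus_proj p))))))"
      by (simp only: torus_commutesD[OF S(2)] torus_commutesD[OF comm])
    also have "\<dots> = torus_proj (S (H (T p)))"
      by (simp only: torus_commutesD[OF S(2)] torus_commutesD[OF T(2)] torus_commutesD[OF comm])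
    finally show "torus_proj (G (torus_proj p)) = torus_proj (G p)" by (simp add: G_def)
  qed
  obtain L where L: "torus_prob L" "distr L borel (torus_proj \<circ> H) = L"
    and uniq: "\<And>L'. torus_prob L' \<Longrightarrow> distr L' borel (torus_proj \<circ> H) = L' \<Longrightarrow> L' = L"
    using H unfolding uniquely_ergodic_alt by (elim ex1E) blast
  have m: "torus_proj \<circ> F \<in> measurable M borel" if "torus_prob M" "F \<in> borel_measurable borel" for M F
    using that by (auto simp: torus_prob_def intro!: measurable_comp[OF _ torus_proj_measurable] cong: measurable_cong_sets)
  have m': "torus_proj \<circ> F \<in> measurable borel borel" if "F \<in> borel_measurable borel" for F
    using that by (auto intro!: measurable_comp[OF _ torus_proj_measurable])
  \<comment> \<open>The general form, with a semiconjugacy \<open>P\<close> from \<open>A\<close> to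
    \<open>B\<close>, serves both directions: \<open>P = S\<close> for existence and
    \<open>P = T\<close> for uniqueness.\<close>
  have push: "torus_prob (distr M borel (torus_proj \<circ> P)) \<and>
         distr (distr M borel (torus_proj \<circ> P)) borel (torus_proj \<circ> B) = distr M borel (torus_proj \<circ> P)"
    if M: "torus_prob M" "distr M borel (torus_proj \<circ> A) = M"
      and P: "P \<in> borel_measurable borel" "torus_commutes P"
      and A: "A \<in> borel_measurable borel" and B: "B \<in> borel_measurable borel" "torus_commutes B"
      and pa: "\<And>p. B (P p) = P (A p)" for M P A B
  proof
    show "torus_prob (distr M borel (torus_proj \<circ> P))" using M P by (intro torus_prob_distr)
    have "distr (distr M borel (torus_proj \<circ> P)) borel (torus_proj \<circ> B)
        = distr M borel ((torus_proj \<circ> B) \<circ> (torus_proj \<circ> P))"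
      using M P B by (intro distr_distr m m')
    also have "(torus_proj \<circ> B) \<circ> (torus_proj \<circ> P) = (torus_proj \<circ> P) \<circ> (torus_proj \<circ> A)"
      by (auto simp: fun_eq_iff pa torus_commutesD[OF P(2)] torus_commutesD[OF B(2)])
    also have "distr M borel \<dots> = distr (distr M borel (torus_proj \<circ> A)) borel (torus_proj \<circ> P)"
      using M P A by (intro distr_distr[symmetric] m m')
    finally show "distr (distr M borel (torus_proj \<circ> P)) borel (torus_proj \<circ> B) = distr M borel (torus_proj \<circ> P)"
      unfolding M(2) .
  qed
  show ?thesis
    unfolding uniquely_ergodic_alt G_def[symmetric]
  proof (rule ex1I)
    show "torus_prob (distr L borel (torus_proj \<circ> S)) \<and>
         distr (distr L borel (torus_proj \<circ> S)) borel (torus_proj \<circ> G) = distr L borel (torus_proj \<circ> S)"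
      by (rule push[OF L S cont G comG GS])
  next
    fix M assume M: "torus_prob M \<and> distr M borel (torus_proj \<circ> G) = M"
    then have "distr M borel (torus_proj \<circ> T) = L"
      using push[OF _ _ T G cont comm TG[symmetric], of M] by (intro uniq) auto
    then have "distr L borel (torus_proj \<circ> S) = distr (distr M borel (torus_proj \<circ> T)) borel (torus_proj \<circ> S)"
      by simp
    also have "\<dots> = distr M borel ((torus_proj \<circ> S) \<circ> (torus_proj \<circ> T))"
      using M T S by (intro distr_distr m m') auto
    also have "(torus_proj \<circ> S) \<circ> (torus_proj \<circ> T) = torus_proj"
      by (auto simp: fun_eq_iff torus_commutesD[OF S(2)] ST)
    also have "distr M borel torus_proj = distr M M (\<lambda>p. p)"
    proof (rule distr_cong_AE)
      show "AE x in M. torus_proj x = x"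
        using torus_prob_AE[of M] M by (auto elim!: eventually_mono simp: torus_proj_id)
    qed (use M in \<open>auto simp: torus_prob_def cong: measurable_cong_sets\<close>)
    also have "\<dots> = M" by (simp add: distr_id2)
    finally show "M = distr L borel (torus_proj \<circ> S)" ..
  qed
qed

text \<open>Integrating a Birkhoff sum of length \<open>N\<close> against an invariant measure gives
  \<open>N\<close> times the Fourier coefficient, so uniform smallness at a single time
  \<open>N\<close> for each \<open>e\<close> already forces the coefficient to be 0. Every invariant
  measure then has the Fourier coefficients of \<open>L\<close>.\<close>

lemma uniquely_ergodicI:
  assumes H: "H \<in> borel_measurable borel" and comm: "torus_commutes H"
    and L: "torus_prob L" "distr L borel (torus_proj \<circ> H) = L"
    and avg: "\<And>j k e. (j, k) \<noteq> (0, 0) \<Longrightarrow> e > 0 \<Longrightarrow>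
       \<exists>N>0. \<forall>p. norm (\<Sum>n<N. torus_char j k ((H ^^ n) p)) \<le> e * real N"
  shows "uniquely_ergodic H"
proof -
  have zero: "(\<integral>p. torus_char j k p \<partial>M) = 0"
    if M: "torus_prob M" "distr M borel (torus_proj \<circ> H) = M" and jk: "(j, k) \<noteq> (0, 0)" for M j k
  proof -
    interpret prob_space M using M by (simp add: torus_prob_def)
    have sM: "sets M = sets borel" using M by (auto simp: torus_prob_def)
    have Hn: "H ^^ n \<in> borel_measurable borel" for n
    proof (induction n)
      case (Suc n)
      show ?case
        unfolding funpow_Suc_right by (rule measurable_comp[OF H Suc])
    qed (simp add: id_def)
    \<comment> \<open>Iterates of \<open>H\<close> are taken in the plane without reducing modulo 1
      in between; since \<open>H\<close> descends to the torus, characters do not notice the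
      difference.\<close>
    have comn: "torus_char j k ((H ^^ n) (torus_proj p)) = torus_char j k ((H ^^ n) p)" for n p
    proof (induction n arbitrary: p)
      case (Suc n)
      have "torus_char j k ((H ^^ n) (H (torus_proj p))) = torus_char j k ((H ^^ n) (torus_proj (H (torus_proj p))))"
        using Suc by simp
      also have "\<dots> = torus_char j k ((H ^^ n) (H p))"
        using Suc torus_commutesD[OF comm] by simp
      finally show ?case by (simp add: funpow_Suc_right del: funpow.simps(2))
    qed simp
    have mH: "(\<lambda>p. torus_char j k ((H ^^ n) p)) \<in> borel_measurable borel" for n
      using measurable_compose[OF Hn torus_char_measurable] .
    have mP: "torus_proj \<circ> H \<in> measurable M borel"
      using sM H by (auto intro!: measurable_comp[OF _ torus_proj_measurable] cong: measurable_cong_sets)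
    have inv: "(\<integral>p. torus_char j k ((H ^^ n) p) \<partial>M) = (\<integral>p. torus_char j k p \<partial>M)" for n
    proof (induction n)
      case (Suc n)
      have "(\<integral>p. torus_char j k ((H ^^ n) p) \<partial>M) = (\<integral>p. torus_char j k ((H ^^ n) p) \<partial>(distr M borel (torus_proj \<circ> H)))"
        using M by simp
      also have "\<dots> = (\<integral>p. torus_char j k ((H ^^ n) ((torus_proj \<circ> H) p)) \<partial>M)"
        by (rule integral_distr[OF mP mH])
      also have "\<dots> = (\<integral>p. torus_char j k ((H ^^ Suc n) p) \<partial>M)"
        by (simp add: comn funpow_Suc_right del: funpow.simps(2))
      finally show ?case using Suc by simp
    qed simp
    have "norm (\<integral>p. torus_char j k p \<partial>M) \<le> e" if e: "e > 0" for e
    proof -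
      obtain N where N: "N > 0" "\<And>p. norm (\<Sum>n<N. torus_char j k ((H ^^ n) p)) \<le> e * real N"
        using avg[OF jk e] by blast
      have int: "integrable M (\<lambda>p. torus_char j k ((H ^^ n) p))" for n
        by (rule prob_integrable_bounded_borel[where B=1]) (auto simp: sM mH prob_space_axioms)
      have "real N * norm (\<integral>p. torus_char j k p \<partial>M) = norm (\<Sum>n<N. \<integral>p. torus_char j k ((H ^^ n) p) \<partial>M)"
        by (simp add: inv norm_mult)
      also have "\<dots> = norm (\<integral>p. (\<Sum>n<N. torus_char j k ((H ^^ n) p)) \<partial>M)"
        using int by (subst Bochner_Integration.integral_sum) auto
      also have "\<dots> \<le> (\<integral>p. norm (\<Sum>n<N. torus_char j k ((H ^^ n) p)) \<partial>M)"
        by (rule integral_norm_bound)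
      also have "\<dots> \<le> (\<integral>p. e * real N \<partial>M)"
        using int N(2) by (intro integral_mono) auto
      finally show ?thesis using N(1) by (simp add: prob_space mult.commute)
    qed
    then have "norm (\<integral>p. torus_char j k p \<partial>M) \<le> 0" by (metis dense_ge)
    then show ?thesis by simp
  qed
  show ?thesis
    unfolding uniquely_ergodic_alt
  proof (rule ex1I[of _ L])
    fix M assume "torus_prob M \<and> distr M borel (torus_proj \<circ> H) = M"
    then have "torus_prob M" "distr M borel (torus_proj \<circ> H) = M" by blast+
    note M = zero[OF this]
    show "M = L"
      by (rule torus_prob_eqI) (use \<open>torus_prob M\<close> L(1) M zero[OF L] in simp_all)
  qed (use L in auto)
qed

section \<open>Equidistribution along good rational approximations\<close>

definition periodic_cont :: "(real \<Rightarrow> 'a::real_normed_vector) \<Rightarrow> bool" where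
  "periodic_cont g \<longleftrightarrow> continuous_on UNIV g \<and> (\<forall>x. g (x + 1) = g x)"

lemma periodic_cont_nat: "periodic_cont g \<Longrightarrow> g (x + real n) = g x"
proof (induction n)
  case (Suc n)
  then have "g ((x + real n) + 1) = g x" by (metis periodic_cont_def)
  then show ?case by (simp add: algebra_simps)
qed simp

lemma periodic_cont_int: "periodic_cont g \<Longrightarrow> g (x + of_int n) = g x"
proof (cases "n \<ge> 0")
  case False
  assume g: "periodic_cont g"
  have "g ((x + of_int n) + real (nat (- n))) = g (x + of_int n)"
    using g by (rule periodic_cont_nat)
  then show ?thesis using False by simp
qed (use periodic_cont_nat[of g x "nat n"] in auto)

lemma periodic_cont_uniform:
  fixes g :: "real \<Rightarrow> 'a::real_normed_vector"
  assumes g: "periodic_cont g" and e: "e > 0"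
  obtains d where "d > 0" "\<And>x y. \<bar>x - y\<bar> < d \<Longrightarrow> norm (g x - g y) < e"
proof -
  have "uniformly_continuous_on {-1..2} g"
    using g by (intro compact_uniformly_continuous) (auto simp: periodic_cont_def intro: continuous_on_subset)
  then obtain d where d: "d > 0" "\<And>x y. x \<in> {-1..2} \<Longrightarrow> y \<in> {-1..2} \<Longrightarrow> dist y x < d \<Longrightarrow> dist (g y) (g x) < e"
    unfolding uniformly_continuous_on_def using e by metis
  show ?thesis
  proof (rule that[of "min d 1"])
    fix x y :: real assume xy: "\<bar>x - y\<bar> < min d 1"
    define k where "k = \<lfloor>y\<rfloor>"
    have "y - k \<in> {-1..2}" "x - k \<in> {-1..2}" using xy unfolding k_def atLeastAtMost_iff by linarith+
    then have "dist (g (x - k)) (g (y - k)) < e" using xy by (intro d) (auto simp: dist_real_def)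
    then show "norm (g x - g y) < e"
      using periodic_cont_int[OF g, of "x - k" k] periodic_cont_int[OF g, of "y - k" k] by (simp add: dist_norm)
  qed (use d in auto)
qed

text \<open>As \<open>p\<close> is invertible modulo \<open>q\<close>, the map
  \<open>i \<mapsto> i p + k\<close> permutes the residues.\<close>

lemma sum_affine_mod:
  fixes h :: "int \<Rightarrow> 'a::comm_monoid_add"
  assumes per: "\<And>i. h (i mod q) = h i" and q: "q > 0" and cop: "coprime p q"
  shows "(\<Sum>i\<in>{0..<q}. h (i * p + k)) = (\<Sum>i\<in>{0..<q}. h i)"
proof -
  define f where "f i = (i * p + k) mod q" for i
  have inj: "inj_on f {0..<q}"
  proof (rule inj_onI)
    fix i j assume ij: "i \<in> {0..<q}" "j \<in> {0..<q}" "f i = f j"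
    then have "q dvd (i * p + k) - (j * p + k)"
      unfolding f_def by (simp add: mod_eq_dvd_iff)
    then have "q dvd (i - j) * p" by (simp add: algebra_simps)
    then have "q dvd i - j" using cop by (simp add: coprime_dvd_mult_left_iff coprime_commute)
    then have "i mod q = j mod q" by (simp add: mod_eq_dvd_iff)
    then show "i = j" using ij by simp
  qed
  have "f ` {0..<q} \<subseteq> {0..<q}" using q by (auto simp: f_def)
  then have "f ` {0..<q} = {0..<q}" using inj by (intro endo_inj_surj) auto
  then have "(\<Sum>i\<in>{0..<q}. h i) = (\<Sum>i\<in>f ` {0..<q}. h i)" by simp
  also have "\<dots> = (\<Sum>i\<in>{0..<q}. h (f i))" using inj by (simp add: sum.reindex)
  also have "\<dots> = (\<Sum>i\<in>{0..<q}. h (i * p + k))" by (simp add: f_def per)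
  finally show ?thesis by simp
qed

lemma sum_affine_mod_nat:
  fixes h :: "int \<Rightarrow> 'a::comm_monoid_add"
  assumes per: "\<And>i. h (i mod int q) = h i" and q: "q > 0" and cop: "coprime p (int q)"
  shows "(\<Sum>i<q. h (int i * p + k)) = (\<Sum>i<q. h (int i))"
proof -
  have "(\<Sum>i<q. h' (int i)) = (\<Sum>i\<in>{0..<int q}. h' i)" for h' :: "int \<Rightarrow> 'a"
    by (rule sum.reindex_bij_witness[of _ nat int]) auto
  from this[of h] this[of "\<lambda>i. h (i * p + k)"] show ?thesis
    using sum_affine_mod[of h "int q" p k] assms by simp
qed

abbreviation mean :: "(real \<Rightarrow> complex) \<Rightarrow> complex" where
  "mean g \<equiv> integral {0..1} g"

lemma riemann_sum_close:
  assumes g: "continuous_on UNIV g" and q: "q > 0" and e: "e \<ge> 0"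
    and d: "\<And>x y. \<bar>x - y\<bar> \<le> 1 / real q \<Longrightarrow> norm (g x - g y) \<le> e"
  shows "norm ((\<Sum>i<q. g (real i / real q)) - of_nat q * mean g) \<le> e * real q"
proof -
  have cont: "continuous_on S g" for S using g continuous_on_subset by blast
  have int: "g integrable_on {a..b}" for a b
    by (rule integrable_continuous_real) (rule cont)
  have split: "integral {0..real m / real q} g = (\<Sum>i<m. integral {real i / real q..real (Suc i) / real q} g)" for m
  proof (induction m)
    case (Suc m)
    have "integral {0..real m / real q} g + integral {real m / real q..real (Suc m) / real q} g
        = integral {0..real (Suc m) / real q} g"
      by (rule Henstock_Kurzweil_Integration.integral_combine[OF _ _ int]) (use q in \<open>auto simp: field_simps\<close>)
    then show ?case using Suc by simp
  qed simp
  have each: "norm (g (real i / real q) - of_nat q * integral {real i / real q..real (Suc i) / real q} g) \<le> e" for i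
  proof -
    let ?a = "real i / real q" and ?b = "real (Suc i) / real q"
    have ab: "?b - ?a = 1 / real q" "?a \<le> ?b" using q by (auto simp: field_simps)
    have "norm (integral {?a..?b} (\<lambda>t. g ?a - g t)) \<le> e * (?b - ?a)"
    proof (rule integral_bound)
      fix t assume "t \<in> {?a..?b}"
      then show "norm (g ?a - g t) \<le> e" using ab by (intro d) auto
    qed (use ab in \<open>auto intro!: continuous_intros cont\<close>)
    also have "integral {?a..?b} (\<lambda>t. g ?a - g t) = (1 / real q) *\<^sub>R g ?a - integral {?a..?b} g"
      using ab(2)
      by (subst Henstock_Kurzweil_Integration.integral_diff[OF _ int]) (auto simp: ab(1)[unfolded of_nat_Suc])
    finally have "norm ((1 / real q) *\<^sub>R g ?a - integral {?a..?b} g) * real q \<le> e"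
      using q by (simp add: ab(1) field_simps)
    also have "norm ((1 / real q) *\<^sub>R g ?a - integral {?a..?b} g) * real q
       = norm (of_nat q * ((1 / real q) *\<^sub>R g ?a - integral {?a..?b} g))"
      by (simp add: norm_mult)
    also have "of_nat q * ((1 / real q) *\<^sub>R g ?a - integral {?a..?b} g) = g ?a - of_nat q * integral {?a..?b} g"
      using q by (simp add: scaleR_conv_of_real right_diff_distrib)
    finally show ?thesis .
  qed
  have "(\<Sum>i<q. g (real i / real q)) - of_nat q * mean g
     = (\<Sum>i<q. g (real i / real q) - of_nat q * integral {real i / real q..real (Suc i) / real q} g)"
    using split[of q] q by (simp add: sum_subtractf sum_distrib_left)
  also have "norm \<dots> \<le> (\<Sum>i<q. e)"
    by (rule sum_norm_le) (rule each)
  finally show ?thesis by (simp add: mult.commute)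
qed

text \<open>Over \<open>q\<close> steps the orbit drifts at most \<open>1 / q\<close> from that of
  the rational rotation, and its start is within \<open>1 / q\<close> of a grid point
  \<open>k / q\<close>; the rational orbit visits every residue class once, leaving a Riemann sum.
  How large \<open>q\<close> must be depends on \<open>g\<close> and \<open>e\<close> only, hence
  the inner quantifiers over \<open>p\<close>, \<alpha> and \<open>x\<close>.\<close>

lemma equidistribution:
  assumes g: "periodic_cont g" and e: "e > 0"
  shows "\<forall>\<^sub>F q in sequentially. \<forall>p \<alpha> x. coprime p (int q) \<and> \<bar>\<alpha> - of_int p / real q\<bar> \<le> 1 / (real q)\<^sup>2 \<longrightarrow>
     norm ((\<Sum>n<q. g (x + real n * \<alpha>)) - of_nat q * mean g) \<le> e * real q"
proof -
  obtain d where d: "d > 0" "\<And>x y. \<bar>x - y\<bar> < d \<Longrightarrow> norm (g x - g y) < e / 2"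
    using periodic_cont_uniform[OF g, of "e / 2"] e by auto
  \<comment> \<open>The two errors add up to at most \<open>2 / q\<close>; the constant 3 leaves
    room for the strict inequality in the modulus of continuity.\<close>
  obtain Q where Q: "real Q > 3 / d" using reals_Archimedean2 by blast
  show ?thesis
  proof (rule eventually_sequentiallyI[of "max 1 Q"], intro allI impI, elim conjE)
    fix q p \<alpha> x
    assume q: "max 1 Q \<le> q" and cop: "coprime p (int q)" and al: "\<bar>\<alpha> - of_int p / real q\<bar> \<le> 1 / (real q)\<^sup>2"
    have q0: "q > 0" using q by simp
    have "3 / d < real q" using Q q by linarith
    then have qd: "3 / real q < d" using d(1) q0 by (simp add: field_simps)
    define k where "k = \<lfloor>real q * x\<rfloor>"
    define h where "h i = g (of_int i / real q)" for i :: int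
    have per: "h (i mod int q) = h i" for i
    proof -
      have "(of_int i :: real) = of_int (i mod int q) + real q * of_int (i div int q)"
        by (metis add.commute mult_div_mod_eq of_int_add of_int_mult of_int_of_nat_eq)
      then have "of_int i / real q = of_int (i mod int q) / real q + of_int (i div int q)"
        using q0 by (simp add: field_simps)
      then show ?thesis using periodic_cont_int[OF g] by (simp add: h_def)
    qed
    have near: "norm (g (x + real n * \<alpha>) - h (int n * p + k)) \<le> e / 2" if n: "n < q" for n
    proof -
      have xk: "\<bar>x - of_int k / real q\<bar> \<le> 1 / real q"
      proof -
        have "of_int k \<le> real q * x" "real q * x < of_int k + 1" unfolding k_def by linarith+
        then have "\<bar>real q * x - of_int k\<bar> \<le> 1" by linarith
        then have "\<bar>real q * x - of_int k\<bar> / real q \<le> 1 / real q" by (intro divide_right_mono) auto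
        moreover have "x - of_int k / real q = (real q * x - of_int k) / real q" using q0 by (simp add: field_simps)
        ultimately show ?thesis by (simp add: abs_divide)
      qed
      have "\<bar>real n * (\<alpha> - of_int p / real q)\<bar> \<le> real q * (1 / (real q)\<^sup>2)"
        unfolding abs_mult using n al by (intro mult_mono) auto
      also have "\<dots> = 1 / real q" using q0 by (simp add: power2_eq_square)
      finally have na: "\<bar>real n * (\<alpha> - of_int p / real q)\<bar> \<le> 1 / real q" .
      have "(x + real n * \<alpha>) - of_int (int n * p + k) / real q
         = (x - of_int k / real q) + real n * (\<alpha> - of_int p / real q)"
        by (simp add: algebra_simps add_divide_distrib)
      then have "\<bar>(x + real n * \<alpha>) - of_int (int n * p + k) / real q\<bar> \<le> 1 / real q + 1 / real q"
        using order_trans[OF abs_triangle_ineq add_mono[OF xk na]] by simp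
      also have "\<dots> = 2 / real q" by simp
      also have "\<dots> \<le> 3 / real q" by (intro divide_right_mono) auto
      also note qd
      finally show ?thesis unfolding h_def by (rule less_imp_le[OF d(2)])
    qed
    have "norm ((\<Sum>n<q. g (x + real n * \<alpha>)) - (\<Sum>n<q. h (int n * p + k))) \<le> (\<Sum>n<q. e / 2)"
      unfolding sum_subtractf[symmetric] by (rule sum_norm_le) (use near in auto)
    moreover have "(\<Sum>n<q. h (int n * p + k)) = (\<Sum>i<q. g (real i / real q))"
      using sum_affine_mod_nat[of h q p k] per q0 cop by (simp add: h_def)
    moreover have "norm ((\<Sum>i<q. g (real i / real q)) - of_nat q * mean g) \<le> e / 2 * real q"
    proof (rule riemann_sum_close)
      fix x y :: real assume "\<bar>x - y\<bar> \<le> 1 / real q"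
      also have "\<dots> \<le> 3 / real q" by (intro divide_right_mono) auto
      also note qd
      finally show "norm (g x - g y) \<le> e / 2" by (rule less_imp_le[OF d(2)])
    qed (use g e q0 in \<open>auto simp: periodic_cont_def\<close>)
    ultimately show "norm ((\<Sum>n<q. g (x + real n * \<alpha>)) - of_nat q * mean g) \<le> e * real q"
      using norm_triangle_le[of "(\<Sum>n<q. g (x + real n * \<alpha>)) - (\<Sum>i<q. g (real i / real q))"
          "(\<Sum>i<q. g (real i / real q)) - of_nat q * mean g" "e * real q"]
      by (simp add: field_simps)
  qed
qed

lemma equidistribution_equal_spacing:
  assumes g: "periodic_cont g" and e: "e > 0"
  shows "\<forall>\<^sub>F q in sequentially. \<forall>x. norm ((\<Sum>n<q. g (x + real n / real q)) - of_nat q * mean g) \<le> e * real q"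
  using equidistribution[OF assms]
proof eventually_elim
  case (elim q)
  show ?case
    using elim[rule_format, of 1 "1 / real q"] by simp
qed

text \<open>The factor \<open>w (q t)\<close> is constant along the progression \<open>t + l / q\<close>, so averaging \<open>g\<close>
  over that progression first separates the two means.\<close>
lemma mean_product_decouples:
  assumes g: "periodic_cont g" and w: "periodic_cont w" and w1: "\<And>t. norm (w t) \<le> 1" and e: "e > 0"
  shows "\<forall>\<^sub>F q in sequentially. norm (mean (\<lambda>t. g t * w (real q * t)) - mean g * mean w) \<le> e"
  using equidistribution_equal_spacing[OF g e] eventually_gt_at_top[of 0]
proof eventually_elim
  case (elim q)
  then have q: "q > 0" by simp
  define G where "G t = g t * w (real q * t)" for t
  have "w (real q * (t + 1)) = w (real q * t)" for t
    using periodic_cont_nat[OF w, of "real q * t" q] by (simp add: algebra_simps)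
  then have G: "periodic_cont G"
    using g w unfolding periodic_cont_def G_def
    by (auto intro!: continuous_intros intro: continuous_on_compose2[of UNIV w])
  have "norm (mean G - mean g * mean w) \<le> e + d" if d: "d > 0" for d
  proof -
    \<comment> \<open>Two auxiliary errors of relative size \<open>c\<close> must add up to
      \<open>d\<close>: one enters with weight 1, the other with weight
      \<open>norm (mean g)\<close>.\<close>
    define c where "c = d / (1 + norm (mean g))"
    have pos: "1 + norm (mean g) > 0" by (simp add: add_pos_nonneg)
    have c: "c > 0" using d pos by (simp add: c_def)
    \<comment> \<open>The mean of \<open>G\<close> is read off a grid of \<open>M * q\<close>
      points, with \<open>q\<close> fixed and \<open>M\<close> so large that this sum and the
      \<open>M\<close>-point sum of \<open>w\<close> are both accurate.\<close>
    have "\<forall>\<^sub>F M in sequentially. M > 0 \<and>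
       (\<forall>x. norm ((\<Sum>n<M * q. G (x + real n / real (M * q))) - of_nat (M * q) * mean G) \<le> c * real (M * q)) \<and>
       (\<forall>x. norm ((\<Sum>n<M. w (x + real n / real M)) - of_nat M * mean w) \<le> c * real M)"
      by (intro eventually_conj eventually_gt_at_top equidistribution_equal_spacing[OF w c]
          eventually_compose_filterlim[OF equidistribution_equal_spacing[OF G c], of "\<lambda>M. M * q" sequentially]
          mult_nat_right_at_top q)
    from eventually_happens'[OF sequentially_bot this] obtain M where M: "M > 0"
      and MG: "\<And>x. norm ((\<Sum>n<M * q. G (x + real n / real (M * q))) - of_nat (M * q) * mean G) \<le> c * real (M * q)"
      and Mw: "\<And>x. norm ((\<Sum>n<M. w (x + real n / real M)) - of_nat M * mean w) \<le> c * real M"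
      by blast
    note MG = MG[of 0, unfolded add_0] and Mw = Mw[of 0, unfolded add_0]
    \<comment> \<open>In the index \<open>n = a + l M\<close> the residue \<open>a\<close> alone
      determines the argument of \<open>w\<close> modulo 1, while \<open>l\<close> runs through the
      progression of step \<open>1 / q\<close> in the argument of \<open>g\<close>.\<close>
    have Gal: "G (real (a + l * M) / real (M * q)) = g (real a / real (M * q) + real l / real q) * w (real a / real M)" for a l
    proof -
      have "real q * (real (a + l * M) / real (M * q)) = real a / real M + real l"
        using q M by (simp add: field_simps)
      moreover have "real (a + l * M) / real (M * q) = real a / real (M * q) + real l / real q"
        using q M by (simp add: field_simps)
      ultimately show ?thesis unfolding G_def by (metis periodic_cont_nat[OF w])
    qed
    define R where "R a = (\<Sum>l<q. g (real a / real (M * q) + real l / real q))" for a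
    have "(\<Sum>n<M * q. G (real n / real (M * q))) = (\<Sum>l<q. sum (\<lambda>n. G (real n / real (M * q))) {l * M..<l * M + M})"
      by (simp add: sum.nat_group mult.commute)
    also have "\<dots> = (\<Sum>l<q. \<Sum>a<M. G (real (a + l * M) / real (M * q)))"
    proof (rule sum.cong[OF refl])
      fix l
      show "sum (\<lambda>n. G (real n / real (M * q))) {l * M..<l * M + M} = (\<Sum>a<M. G (real (a + l * M) / real (M * q)))"
        by (rule sum.reindex_bij_witness[of _ "\<lambda>a. a + l * M" "\<lambda>n. n - l * M"]) auto
    qed
    also have "\<dots> = (\<Sum>a<M. R a * w (real a / real M))"
      unfolding Gal R_def by (subst sum.swap) (simp add: sum_distrib_right)
    finally have sumG: "(\<Sum>n<M * q. G (real n / real (M * q))) = (\<Sum>a<M. R a * w (real a / real M))" .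
    have "norm (R a * w (real a / real M) - of_nat q * mean g * w (real a / real M)) \<le> e * real q" for a
    proof -
      have "norm (R a * w (real a / real M) - of_nat q * mean g * w (real a / real M))
         = norm (R a - of_nat q * mean g) * norm (w (real a / real M))"
        by (simp add: norm_mult[symmetric] left_diff_distrib)
      also have "\<dots> \<le> (e * real q) * 1"
        using elim(1) w1 e q unfolding R_def by (intro mult_mono) auto
      finally show ?thesis by simp
    qed
    then have "norm ((\<Sum>a<M. R a * w (real a / real M)) - (\<Sum>a<M. of_nat q * mean g * w (real a / real M))) \<le> (\<Sum>a<M. e * real q)"
      unfolding sum_subtractf[symmetric] by (intro sum_norm_le) auto
    then have A: "norm ((\<Sum>n<M * q. G (real n / real (M * q))) - of_nat q * mean g * (\<Sum>a<M. w (real a / real M))) \<le> e * real (M * q)"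
      unfolding sumG by (simp add: sum_distrib_left mult.commute mult.left_commute)
    have "norm (of_nat q * mean g * (\<Sum>a<M. w (real a / real M)) - of_nat q * mean g * (of_nat M * mean w))
       = (real q * norm (mean g)) * norm ((\<Sum>n<M. w (real n / real M)) - of_nat M * mean w)"
      unfolding right_diff_distrib[symmetric] by (simp add: norm_mult)
    also have "\<dots> \<le> (real q * norm (mean g)) * (c * real M)"
      by (intro mult_left_mono Mw) auto
    finally have B: "norm (of_nat q * mean g * (\<Sum>a<M. w (real a / real M)) - of_nat q * mean g * (of_nat M * mean w))
       \<le> c * norm (mean g) * real (M * q)" by (simp add: ac_simps)
    have tri: "norm (x - z) \<le> a + b + c'" if "norm (y - x) \<le> a" "norm (y - u) \<le> b" "norm (u - z) \<le> c'"
      for x y z u :: complex and a b c' :: real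
    proof -
      have "x - z = - (y - x) + (y - u) + (u - z)" by simp
      then have "norm (x - z) \<le> norm (- (y - x) + (y - u)) + norm (u - z)" by (metis norm_triangle_ineq)
      also have "norm (- (y - x) + (y - u)) \<le> norm (- (y - x)) + norm (y - u)" by (rule norm_triangle_ineq)
      finally show ?thesis using that norm_minus_commute[of x y] by simp
    qed
    have "real (M * q) * norm (mean G - mean g * mean w)
       = norm (of_nat (M * q) * mean G - of_nat q * mean g * (of_nat M * mean w))"
      unfolding norm_of_nat[symmetric, where 'a=complex] norm_mult[symmetric] by (simp add: algebra_simps)
    also have "\<dots> \<le> c * real (M * q) + e * real (M * q) + c * norm (mean g) * real (M * q)"
      by (rule tri[OF MG A B])
    also have "\<dots> = real (M * q) * (e + c * (1 + norm (mean g)))" by (simp add: algebra_simps)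
    also have "c * (1 + norm (mean g)) = d" using pos by (simp add: c_def)
    finally show ?thesis using M q by simp
  qed
  then have "norm (mean G - mean g * mean w) \<le> e" by (rule field_le_epsilon)
  then show ?case by (simp add: G_def[abs_def])
qed

text \<open>Equality in the triangle inequality would align \<open>w\<close> with one fixed
  direction \<open>s\<close>, yet \<open>w\<close> takes both values 1 and -1.\<close>

lemma mean_cis_cos_less_1:
  fixes k :: int
  assumes "k \<noteq> 0"
  shows "norm (mean (\<lambda>t. cis (2 * pi * (of_int k * cos (2 * pi * t))))) < 1"
proof (rule ccontr)
  define w where "w t = cis (2 * pi * (of_int k * cos (2 * pi * t)))" for t
  define u where "u = mean w"
  assume "\<not> ?thesis"
  then have u: "norm u \<ge> 1" by (simp add: u_def w_def[abs_def])
  define s where "s = sgn u"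
  have s1: "norm s = 1" using u by (auto simp: s_def norm_sgn)
  have wc: "continuous_on {0..1} w" unfolding w_def by (intro continuous_intros)
  \<comment> \<open>A nonnegative continuous function with integral \<open>1 - norm u\<close>; the
    assumption on \<open>u\<close> forces it to vanish on the whole interval.\<close>
  define f where "f t = 1 - Re (cnj s * w t)" for t
  have fc: "continuous_on {0..1} f" unfolding f_def by (intro continuous_intros wc)
  have f0: "f t \<ge> 0" for t
  proof -
    have "Re (cnj s * w t) \<le> norm (cnj s * w t)" by (rule complex_Re_le_cmod)
    then show ?thesis using s1 by (simp add: f_def w_def norm_mult)
  qed
  have bl: "bounded_linear (\<lambda>z. Re (cnj s * z))"
    by (intro bounded_linear_compose[OF bounded_linear_Re] bounded_linear_mult_right)
  have "integral {0..1} (\<lambda>t. Re (cnj s * w t)) = Re (cnj s * u)"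
    using integral_linear[OF integrable_continuous_real[OF wc] bl] by (simp add: o_def u_def)
  also have "cnj s * u = of_real (norm u)"
  proof -
    have "cnj u * u = of_real (norm u) * of_real (norm u)"
      using complex_norm_square[of u] by (simp only: power2_eq_square of_real_mult mult.commute[of "cnj u"])
    moreover have "complex_of_real (norm u) \<noteq> 0" using u by auto
    ultimately have "cnj u * u / of_real (norm u) = of_real (norm u)" by simp
    then show ?thesis by (simp add: s_def sgn_eq)
  qed
  finally have "integral {0..1} f = 1 - norm u"
    unfolding f_def
    by (subst Henstock_Kurzweil_Integration.integral_diff)
       (auto intro!: integrable_continuous_real continuous_intros wc)
  moreover have "integral {0..1} f \<ge> 0"
    using f0 fc by (intro integral_nonneg integrable_continuous_real) auto
  ultimately have "integral {0..1} f = 0" using u by simp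
  then have z: "f t = 0" if "t \<in> {0..1}" for t
    using integral_eq_0_iff[OF fc] f0 that by simp
  have "w (1/4) = 1" by (simp add: w_def)
  with z[of "1/4"] have "Re s = 1" by (simp add: f_def)
  \<comment> \<open>The value of the cosine at which the phase \<open>2 pi k v\<close> equals pi; it
    lies in [-1, 1] because \<open>k\<close> is a nonzero integer.\<close>
  define v where "v = 1 / (2 * real_of_int k)"
  define t where "t = arccos v / (2 * pi)"
  have "\<bar>v\<bar> \<le> 1"
    using assms by (simp add: v_def field_simps)
  then have v1: "-1 \<le> v" "v \<le> 1" by (auto simp: abs_le_iff)
  have "arccos v \<le> 2 * pi" using arccos_ubound[OF v1] pi_ge_zero by linarith
  then have "t \<in> {0..1}"
    using arccos_lbound[OF v1] by (simp add: t_def field_simps)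
  moreover have "w t = -1"
  proof -
    have "cos (2 * pi * t) = v"
      using v1 by (simp add: t_def cos_arccos)
    then show ?thesis using assms by (simp add: w_def v_def)
  qed
  ultimately show False using z[of t] \<open>Re s = 1\<close> by (simp add: f_def)
qed

lemma mean_cis_int:
  fixes j :: int
  assumes "j \<noteq> 0"
  shows "mean (\<lambda>t. cis (2 * pi * (of_int j * t))) = 0"
proof -
  define c where "c = 2 * pi * of_int j"
  have c: "c \<noteq> 0" using assms by (simp add: c_def)
  have "((\<lambda>t. cis (c * t)) has_integral (cis (c * 1) / (\<i> * of_real c) - cis (c * 0) / (\<i> * of_real c))) {0..1}"
  proof (rule fundamental_theorem_of_calculus)
    fix t :: real
    have "((\<lambda>z. exp (\<i> * of_real c * z) / (\<i> * of_real c)) has_field_derivative exp (\<i> * of_real c * of_real t)) (at (of_real t))"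
      using c by (auto intro!: derivative_eq_intros)
    then have "((\<lambda>t. exp (\<i> * of_real (c * t)) / (\<i> * of_real c)) has_vector_derivative exp (\<i> * of_real (c * t))) (at t within {0..1})"
      using has_vector_derivative_real_field by (fastforce simp: mult.assoc)
    then show "((\<lambda>t. cis (c * t) / (\<i> * of_real c)) has_vector_derivative cis (c * t)) (at t within {0..1})"
      by (simp add: cis_conv_exp)
  qed simp
  moreover have "cis (c * 1) = 1" unfolding c_def by (simp add: cis_multiple_2pi)
  ultimately have "((\<lambda>t. cis (c * t)) has_integral 0) {0..1}" by simp
  then show ?thesis unfolding c_def by (simp add: integral_unique mult.assoc)
qed

section \<open>Uniquely ergodic skew products over Liouville rotations\<close>

text \<open>Coprimality makes the multiples of \<open>p / q\<close> run through all residues modulo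
  \<open>q\<close>, as equidistribution requires; the clause \<open>q \<ge> n\<close> lets each
  stage of the construction ask for a denominator beyond its own threshold.\<close>

definition liouville :: "real \<Rightarrow> bool" where
  "liouville \<alpha> \<longleftrightarrow> (\<forall>n::nat. \<exists>q\<ge>n. \<exists>p::int. q > 0 \<and> coprime p (int q) \<and>
      \<bar>\<alpha> - of_int p / real q\<bar> < exp (- (real q)\<^sup>2))"

definition cos_cob :: "real \<Rightarrow> nat \<Rightarrow> complex \<Rightarrow> complex" where
  "cos_cob \<alpha> q z = cos (2 * of_real pi * of_nat q * (z + of_real \<alpha>)) - cos (2 * of_real pi * of_nat q * z)"

lemma cos_cob_of_real:
  "cos_cob \<alpha> q (of_real x) = of_real (cos (2 * pi * real q * (x + \<alpha>)) - cos (2 * pi * real q * x))"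
  by (simp add: cos_cob_def flip: cos_of_real)

lemma cos_cob_holomorphic: "cos_cob \<alpha> q holomorphic_on S"
  unfolding cos_cob_def by (intro holomorphic_intros)

text \<open>By the product formula the coboundary is, up to a constant, \<open>sin w\<close> times
  \<open>sin (pi q \<alpha>)\<close>. The second factor is small since \<open>q \<alpha>\<close> is
  near the integer \<open>p\<close>; the first costs the growth of a wave of frequency
  \<open>q\<close> on the strip.\<close>

lemma norm_cos_cob_le:
  assumes al: "\<bar>\<alpha> - of_int p / real q\<bar> < exp (- (real q)\<^sup>2)" and q: "q > 0" and z: "\<bar>Im z\<bar> < \<rho>"
  shows "norm (cos_cob \<alpha> q z) \<le> 2 * pi * real q * exp (2 * pi * real q * \<rho> - (real q)\<^sup>2)"
proof -
  have "\<bar>sin (pi * real q * \<alpha>)\<bar> = \<bar>sin (pi * (real q * \<alpha> - of_int p))\<bar>"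
  proof -
    have "sin (pi * real q * \<alpha> - of_int p * pi) = sin (pi * real q * \<alpha>) * cos (of_int p * pi)"
      by (simp add: sin_diff sin_int_times_real mult.commute)
    moreover have "\<bar>cos (of_int p * pi)\<bar> = 1" by (simp add: cos_int_times_real mult.commute)
    moreover have "pi * (real q * \<alpha> - of_int p) = pi * real q * \<alpha> - of_int p * pi"
      by (simp add: algebra_simps)
    ultimately show ?thesis by (simp add: abs_mult)
  qed
  also have "\<dots> \<le> \<bar>pi * (real q * \<alpha> - of_int p)\<bar>" by (rule abs_sin_x_le_abs_x)
  also have "\<dots> = pi * real q * \<bar>\<alpha> - of_int p / real q\<bar>"
  proof -
    have "pi * (real q * \<alpha> - of_int p) = pi * real q * (\<alpha> - of_int p / real q)"
      using q by (simp add: field_simps)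
    then show ?thesis by (simp add: abs_mult)
  qed
  also have "\<dots> \<le> pi * real q * exp (- (real q)\<^sup>2)"
    using al by (intro mult_left_mono) auto
  finally have s1: "\<bar>sin (pi * real q * \<alpha>)\<bar> \<le> pi * real q * exp (- (real q)\<^sup>2)" .
  define w where "w = 2 * of_real pi * of_nat q * z + of_real (pi * real q * \<alpha>)"
  have "Im w = 2 * pi * real q * Im z" by (simp add: w_def)
  then have "\<bar>Im w\<bar> \<le> 2 * pi * real q * \<rho>"
    using z mult_left_mono[of "\<bar>Im z\<bar>" \<rho> "real q"] by (simp add: abs_mult)
  then have s2: "norm (sin w) \<le> exp (2 * pi * real q * \<rho>)"
    using cmod_sin_le_exp[of 1 w] by (auto intro: order_trans)
  have "cos_cob \<alpha> q z = 2 * sin w * sin (- of_real (pi * real q * \<alpha>))"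
    unfolding cos_cob_def cos_diff_cos
    by (rule arg_cong2[where f="\<lambda>a b. 2 * sin a * sin b"]) (auto simp: w_def algebra_simps)
  also have "norm \<dots> = 2 * (norm (sin w) * \<bar>sin (pi * real q * \<alpha>)\<bar>)"
    by (simp only: sin_minus sin_of_real norm_mult norm_minus_cancel norm_of_real) simp
  also have "\<dots> \<le> 2 * (exp (2 * pi * real q * \<rho>) * (pi * real q * exp (- (real q)\<^sup>2)))"
    by (intro mult_left_mono mult_mono s1 s2) auto
  also have "\<dots> = 2 * pi * real q * exp (2 * pi * real q * \<rho> - (real q)\<^sup>2)"
    by (simp add: exp_diff exp_minus field_simps)
  finally show ?thesis .
qed

text \<open>The character \<open>torus_char j k\<close> along the graph of \<Psi>. For the skew
  product with transfer function \<Psi>, Birkhoff sums of the character equal those of this function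
  under the rotation, up to a factor of modulus 1.\<close>

definition twist :: "int \<Rightarrow> int \<Rightarrow> (real \<Rightarrow> real) \<Rightarrow> real \<Rightarrow> complex" where
  "twist j k \<Psi> t = cis (2 * pi * (of_int j * t + of_int k * \<Psi> t))"

lemma periodic_cont_twist:
  assumes "periodic_cont \<Psi>"
  shows "periodic_cont (twist j k \<Psi>)"
  unfolding periodic_cont_def
proof (intro conjI allI)
  show "continuous_on UNIV (twist j k \<Psi>)"
    using assms unfolding twist_def periodic_cont_def by (auto intro!: continuous_intros)
  fix x
  have "2 * pi * (of_int j * (x + 1) + of_int k * \<Psi> (x + 1))
      = 2 * pi * (of_int j * x + of_int k * \<Psi> x) + 2 * pi * of_int j"
    using periodic_cont_nat[OF assms, of x 1] by (simp add: algebra_simps)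
  then show "twist j k \<Psi> (x + 1) = twist j k \<Psi> x"
    unfolding twist_def by (simp only: cis_mult[symmetric] cis_multiple_2pi[OF Ints_of_int]) simp
qed

lemma periodic_cont_cos: "periodic_cont (\<lambda>t. cos (2 * pi * real q * t))"
proof -
  have "cos (2 * pi * real q * (x + 1)) = cos (2 * pi * real q * x)" for x
  proof -
    have "cos (2 * pi * real q * (x + 1)) = cos (2 * pi * real q * x + 2 * real q * pi)"
      by (simp add: algebra_simps)
    then show ?thesis unfolding cos_add by simp
  qed
  then show ?thesis unfolding periodic_cont_def by (auto intro!: continuous_intros)
qed

lemma periodic_cont_cos_sum: "periodic_cont (\<lambda>t. \<Sum>i<n. cos (2 * pi * real (qs i) * t))"
  using periodic_cont_cos unfolding periodic_cont_def by (auto intro!: continuous_intros)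

text \<open>The denominator \<open>q\<close> plays two roles: it is the frequency of the next summand
  \<open>cos (2 pi q t)\<close>, and it is a time at which the Birkhoff averages belonging to the
  transfer function \<open>\<Psi>\<close> built so far are close to their mean. The bound on \<open>cos_cob\<close> is
  weighted with \<open>q\<close> so that all later summands together stay invisible up to that time.\<close>
definition good_stage :: "real \<Rightarrow> real \<Rightarrow> real \<Rightarrow> nat \<Rightarrow> nat \<Rightarrow> (real \<Rightarrow> real) \<Rightarrow> bool" where
  "good_stage \<alpha> \<rho> \<epsilon> n q \<Psi> \<longleftrightarrow> q > 0 \<and>
     (\<forall>z. \<bar>Im z\<bar> < \<rho> \<longrightarrow> real q * norm (cos_cob \<alpha> q z) \<le> \<epsilon> / 2 ^ n) \<and>
     (\<forall>j\<in>{-int n..int n}. \<forall>k\<in>{-int n..int n}.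
        (\<forall>x. norm ((\<Sum>i<q. twist j k \<Psi> (x + real i * \<alpha>)) - of_nat q * mean (twist j k \<Psi>)) \<le> 1 / real (Suc n) * real q) \<and>
        norm (mean (twist j k (\<lambda>t. \<Psi> t + cos (2 * pi * real q * t)))
           - mean (twist j k \<Psi>) * mean (twist 0 k (\<lambda>t. cos (2 * pi * t)))) \<le> 1 / real (Suc n))"

text \<open>Equidistribution, decoupling and the decay of the weighted bound set in once
  \<open>q\<close> is large, as only finitely many \<open>j\<close>, \<open>k\<close> are involved;
  good approximations of \<alpha> are available for arbitrarily large \<open>q\<close>. The two
  kinds of condition meet at a common \<open>q\<close>.\<close>

lemma good_stage_exists:
  assumes al: "liouville \<alpha>" and eps: "\<epsilon> > 0" and Psi: "periodic_cont \<Psi>"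
  shows "\<exists>q\<ge>q0. good_stage \<alpha> \<rho> \<epsilon> n q \<Psi>"
proof -
  define J where "J = {-int n..int n}"
  have e: "1 / real (Suc n) > 0" by simp
  have 1: "\<forall>\<^sub>F q in sequentially. \<forall>j\<in>J. \<forall>k\<in>J. \<forall>p \<alpha> x. coprime p (int q) \<and> \<bar>\<alpha> - of_int p / real q\<bar> \<le> 1 / (real q)\<^sup>2 \<longrightarrow>
     norm ((\<Sum>i<q. twist j k \<Psi> (x + real i * \<alpha>)) - of_nat q * mean (twist j k \<Psi>)) \<le> 1 / real (Suc n) * real q"
    by (intro eventually_ball_finite ballI equidistribution periodic_cont_twist Psi e) (auto simp: J_def)
  have pc: "periodic_cont (twist 0 k (\<lambda>t. cos (2 * pi * t)))" for k
    using periodic_cont_twist[OF periodic_cont_cos[of 1]] by simp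
  have 2: "\<forall>\<^sub>F q in sequentially. \<forall>j\<in>J. \<forall>k\<in>J. norm (mean (\<lambda>t. twist j k \<Psi> t * twist 0 k (\<lambda>t. cos (2 * pi * t)) (real q * t))
           - mean (twist j k \<Psi>) * mean (twist 0 k (\<lambda>t. cos (2 * pi * t)))) \<le> 1 / real (Suc n)"
    by (intro eventually_ball_finite ballI mean_product_decouples periodic_cont_twist Psi pc e)
       (auto simp: J_def twist_def)
  \<comment> \<open>For each \<rho> the quadratic exponent dominates the linear one together with
    the polynomial factors, the extra weight \<open>q\<close> included.\<close>
  have "((\<lambda>q::real. q * (2 * pi * q * exp (2 * pi * q * \<rho> - q\<^sup>2))) \<longlongrightarrow> 0) at_top"
    by real_asymp
  then have "((\<lambda>q. real q * (2 * pi * real q * exp (2 * pi * real q * \<rho> - (real q)\<^sup>2))) \<longlongrightarrow> 0) sequentially"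
    by (rule filterlim_compose[OF _ filterlim_real_sequentially])
  then have 3: "\<forall>\<^sub>F q in sequentially. real q * (2 * pi * real q * exp (2 * pi * real q * \<rho> - (real q)\<^sup>2)) < \<epsilon> / 2 ^ n"
    using eps by (intro order_tendstoD) auto
  obtain N where N: "\<And>q. q \<ge> N \<Longrightarrow> (\<forall>j\<in>J. \<forall>k\<in>J. \<forall>p \<alpha> x. coprime p (int q) \<and> \<bar>\<alpha> - of_int p / real q\<bar> \<le> 1 / (real q)\<^sup>2 \<longrightarrow>
     norm ((\<Sum>i<q. twist j k \<Psi> (x + real i * \<alpha>)) - of_nat q * mean (twist j k \<Psi>)) \<le> 1 / real (Suc n) * real q) \<and>
     (\<forall>j\<in>J. \<forall>k\<in>J. norm (mean (\<lambda>t. twist j k \<Psi> t * twist 0 k (\<lambda>t. cos (2 * pi * t)) (real q * t))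
           - mean (twist j k \<Psi>) * mean (twist 0 k (\<lambda>t. cos (2 * pi * t)))) \<le> 1 / real (Suc n)) \<and>
     real q * (2 * pi * real q * exp (2 * pi * real q * \<rho> - (real q)\<^sup>2)) < \<epsilon> / 2 ^ n"
    using eventually_conj[OF 1 eventually_conj[OF 2 3]] unfolding eventually_sequentially by blast
  obtain q p where q: "q \<ge> max N q0" "q > 0" and p: "coprime p (int q)" "\<bar>\<alpha> - of_int p / real q\<bar> < exp (- (real q)\<^sup>2)"
    using al unfolding liouville_def by blast
  have "q \<ge> N" using q by simp
  note Nq = N[OF this]
  have "(real q)\<^sup>2 \<le> exp ((real q)\<^sup>2)" using exp_ge_add_one_self[of "(real q)\<^sup>2"] by linarith
  then have "exp (- (real q)\<^sup>2) \<le> 1 / (real q)\<^sup>2"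
    using q(2) by (simp add: exp_minus inverse_eq_divide frac_le)
  then have p2: "\<bar>\<alpha> - of_int p / real q\<bar> \<le> 1 / (real q)\<^sup>2" using p(2) by linarith
  \<comment> \<open>The new summand depends on \<open>q t\<close> only, so the twist splits into a
    product of the form that decouples.\<close>
  have tw: "twist j k (\<lambda>t. \<Psi> t + cos (2 * pi * real q * t)) =
     (\<lambda>t. twist j k \<Psi> t * twist 0 k (\<lambda>t. cos (2 * pi * t)) (real q * t))" for j k
    by (auto simp: twist_def cis_mult algebra_simps)
  have "good_stage \<alpha> \<rho> \<epsilon> n q \<Psi>"
    unfolding good_stage_def tw J_def[symmetric]
  proof (intro conjI ballI allI impI)
    fix z assume "\<bar>Im z\<bar> < \<rho>"
    then have "real q * norm (cos_cob \<alpha> q z) \<le> real q * (2 * pi * real q * exp (2 * pi * real q * \<rho> - (real q)\<^sup>2))"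
      using norm_cos_cob_le[OF p(2) q(2)] by (intro mult_left_mono) auto
    then show "real q * norm (cos_cob \<alpha> q z) \<le> \<epsilon> / 2 ^ n" using Nq by linarith
  next
    fix j k x assume "j \<in> J" "k \<in> J"
    then show "norm ((\<Sum>i<q. twist j k \<Psi> (x + real i * \<alpha>)) - of_nat q * mean (twist j k \<Psi>)) \<le> 1 / real (Suc n) * real q"
      using Nq p(1) p2 by blast
  next
    fix j k assume "j \<in> J" "k \<in> J"
    then show "norm (mean (\<lambda>t. twist j k \<Psi> t * twist 0 k (\<lambda>t. cos (2 * pi * t)) (real q * t))
           - mean (twist j k \<Psi>) * mean (twist 0 k (\<lambda>t. cos (2 * pi * t)))) \<le> 1 / real (Suc n)"
      using Nq by blast
  qed (use q in auto)
  then show ?thesis using q(1) by auto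
qed

text \<open>Each denominator depends on the sum built from all earlier ones, so a denominator and a
  transfer function are chosen together in a recursion. Monotonicity is recorded because it lets the
  weighted bounds of later stages be used at the time of an earlier one.\<close>

lemma good_stage_sequence:
  assumes al: "liouville \<alpha>" and eps: "\<epsilon> > 0"
  obtains qs where "\<And>n. good_stage \<alpha> \<rho> \<epsilon> n (qs n) (\<lambda>t. \<Sum>i<n. cos (2 * pi * real (qs i) * t))"
    and "mono qs"
proof -
  define P where "P n s \<longleftrightarrow> periodic_cont (snd s) \<and> good_stage \<alpha> \<rho> \<epsilon> n (fst s) (snd s)" for n s
  define step where "step s t = snd s t + cos (2 * pi * real (fst s) * t)" for s t
  define Q where "Q s s' \<longleftrightarrow> snd s' = step s \<and> fst s \<le> fst s'" for s s'
  have "\<exists>s. \<forall>n. P n (s n) \<and> (Q (s n) (s (Suc n)) \<and> (n = 0 \<longrightarrow> snd (s n) = (\<lambda>_. 0)))"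
  proof -
    \<comment> \<open>The clause for \<open>n = 0\<close> puts the empty sum as starting point into
      the invariant of the recursion.\<close>
    have "\<exists>s. \<forall>n. (P n (s n) \<and> (n = 0 \<longrightarrow> snd (s n) = (\<lambda>_. 0))) \<and> Q (s n) (s (Suc n))"
    proof (rule dependent_nat_choice)
      have pc: "periodic_cont (\<lambda>_. 0 :: real)" by (auto simp: periodic_cont_def)
      then obtain q where "good_stage \<alpha> \<rho> \<epsilon> 0 q (\<lambda>_. 0)" using good_stage_exists[OF al eps] by blast
      then show "\<exists>x. P 0 x \<and> (0 = 0 \<longrightarrow> snd x = (\<lambda>_. 0))"
        using pc by (intro exI[of _ "(q, \<lambda>_. 0)"]) (simp add: P_def)
    next
      fix s n assume "P n s \<and> (n = 0 \<longrightarrow> snd s = (\<lambda>_. 0))"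
      then have pc: "periodic_cont (step s)"
        using periodic_cont_cos[of "fst s"] unfolding P_def periodic_cont_def step_def
        by (auto intro!: continuous_intros)
      then obtain q where "q \<ge> fst s" "good_stage \<alpha> \<rho> \<epsilon> (Suc n) q (step s)"
        using good_stage_exists[OF al eps] by blast
      then show "\<exists>s'. (P (Suc n) s' \<and> (Suc n = 0 \<longrightarrow> snd s' = (\<lambda>_. 0))) \<and> Q s s'"
        using pc by (intro exI[of _ "(q, step s)"]) (simp add: P_def Q_def)
    qed
    then show ?thesis by blast
  qed
  then obtain s where s: "\<And>n. P n (s n)" "\<And>n. Q (s n) (s (Suc n))" "snd (s 0) = (\<lambda>_. 0)"
    by blast
  define qs where "qs n = fst (s n)" for n
  have snd_s: "snd (s n) = (\<lambda>t. \<Sum>i<n. cos (2 * pi * real (qs i) * t))" for n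
  proof (induction n)
    case (Suc n)
    then show ?case using s(2)[of n] by (auto simp: Q_def step_def qs_def)
  qed (simp add: s)
  show ?thesis
  proof (rule that)
    show "good_stage \<alpha> \<rho> \<epsilon> n (qs n) (\<lambda>t. \<Sum>i<n. cos (2 * pi * real (qs i) * t))" for n
      using s(1)[of n] snd_s[of n] by (simp add: P_def qs_def)
    show "mono qs" using s(2) by (auto simp: mono_iff_le_Suc Q_def qs_def)
  qed
qed

text \<open>If \<open>a\<close> stayed above \<open>e\<close>, the contraction would outweigh
  \<open>b\<close> and lower \<open>a\<close> by a fixed amount in each late step, which
  nonnegativity forbids.\<close>

lemma contraction_small:
  fixes a b :: "nat \<Rightarrow> real"
  assumes r: "r < 1" and e: "e > 0" and b: "b \<longlonglongrightarrow> 0"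
    and a: "\<And>n. n \<ge> n0 \<Longrightarrow> a (Suc n) \<le> r * a n + b n" and a0: "\<And>n. a n \<ge> 0"
  shows "\<exists>m\<ge>n1. a m \<le> e"
proof (rule ccontr)
  assume "\<not> ?thesis"
  then have big: "a m > e" if "m \<ge> n1" for m using that by force
  \<comment> \<open>Half of the gain \<open>e (1 - r)\<close> of a step; the other half absorbs
    \<open>b n\<close>.\<close>
  define c where "c = e * (1 - r) / 2"
  have c: "c > 0" using r e by (simp add: c_def)
  obtain n2 where n2: "\<And>n. n \<ge> n2 \<Longrightarrow> b n < c"
    using order_tendstoD(2)[OF b c] unfolding eventually_sequentially by blast
  define N where "N = max n0 (max n1 n2)"
  have step: "a (Suc n) \<le> a n - c" if "n \<ge> N" for n
  proof -
    have "(1 - r) * a n \<ge> (1 - r) * e"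
      using big[of n] that r by (intro mult_left_mono) (auto simp: N_def)
    moreover have "(1 - r) * a n = a n - r * a n" "(1 - r) * e = 2 * c"
      by (simp_all add: c_def algebra_simps)
    ultimately have "a n - r * a n \<ge> 2 * c" by linarith
    moreover have "a (Suc n) \<le> r * a n + b n" using a that by (simp add: N_def)
    moreover have "b n < c" using n2 that by (simp add: N_def)
    ultimately show ?thesis by linarith
  qed
  have "a (N + k) \<le> a N - real k * c" for k
  proof (induction k)
    case (Suc k)
    then show ?case using step[of "N + k"] by (simp add: algebra_simps)
  qed simp
  moreover obtain k where "a N < real k * c" using ex_less_of_nat_mult[OF c] by blast
  ultimately show False using a0[of "N + k"] by (smt (verit))
qed

lemma norm_cis_diff_le: "norm (cis a - cis b) \<le> \<bar>a - b\<bar>"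
proof -
  have "norm (cis (a - b) - 1) \<le> \<bar>a - b\<bar>"
    using iexp_approx1[of "a - b" 0] by (simp add: cis_conv_exp)
  moreover have "cis a - cis b = cis b * (cis (a - b) - 1)"
    by (simp add: right_diff_distrib cis_mult)
  ultimately show ?thesis by (simp add: norm_mult)
qed

section \<open>Lebesgue measure on the torus and its invariance under skew products\<close>

definition unit_lebesgue :: "real measure" where
  "unit_lebesgue = density lborel (\<lambda>x. ennreal (indicator {0..1} x))"

lemma integral_unit_lebesgue:
  fixes f :: "real \<Rightarrow> complex"
  assumes "continuous_on UNIV f"
  shows "(\<integral>x. f x \<partial>unit_lebesgue) = mean f"
proof -
  have "f \<in> borel_measurable borel" using assms by (rule borel_measurable_continuous_onI)
  then have "(\<integral>x. f x \<partial>unit_lebesgue) = (LINT x : {0..1} | lborel. f x)"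
    unfolding unit_lebesgue_def set_lebesgue_integral_def by (subst integral_density) auto
  also have "\<dots> = mean f"
    by (rule set_borel_integral_eq_integral(2))
       (use assms in \<open>auto intro!: borel_integrable_atLeastAtMost' intro: continuous_on_subset\<close>)
  finally show ?thesis .
qed

lemma emeasure_unit_lebesgue:
  assumes "A \<in> sets borel"
  shows "emeasure unit_lebesgue A = emeasure lborel (A \<inter> {0..1})"
  unfolding unit_lebesgue_def using assms
  by (subst emeasure_density) (auto simp: ennreal_indicator indicator_inter_arith[symmetric] mult.commute Int_commute)

lemma prob_space_unit_lebesgue: "prob_space unit_lebesgue"
  by (rule prob_spaceI) (simp add: emeasure_unit_lebesgue[unfolded unit_lebesgue_def] unit_lebesgue_def)

definition torus_lebesgue :: "(real \<times> real) measure" where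
  "torus_lebesgue = unit_lebesgue \<Otimes>\<^sub>M unit_lebesgue"

lemma sets_unit_lebesgue [simp]: "sets unit_lebesgue = sets borel"
  by (simp add: unit_lebesgue_def)

lemma torus_prob_lebesgue: "torus_prob torus_lebesgue"
proof -
  interpret U: prob_space unit_lebesgue by (rule prob_space_unit_lebesgue)
  interpret pair_prob_space unit_lebesgue unit_lebesgue ..
  have "sets torus_lebesgue = sets borel"
    unfolding torus_lebesgue_def borel_prod[symmetric] by (rule sets_pair_measure_cong) auto
  moreover have "emeasure torus_lebesgue ({0..<1} \<times> {0..<1}) = 1"
    unfolding torus_lebesgue_def
    by (subst U.emeasure_pair_measure_Times) (auto simp: emeasure_unit_lebesgue Int_absorb2 atLeastLessThan_subseteq_atLeastAtMost_iff)
  moreover have "prob_space torus_lebesgue"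
    unfolding torus_lebesgue_def by (rule P.prob_space_axioms)
  ultimately show ?thesis by (simp add: torus_prob_def)
qed

definition skew :: "real \<Rightarrow> (real \<Rightarrow> real) \<Rightarrow> real \<times> real \<Rightarrow> real \<times> real" where
  "skew \<alpha> \<phi> p = (fst p + \<alpha>, snd p + \<phi> (fst p))"

lemma skew_continuous: "continuous_on UNIV \<phi> \<Longrightarrow> continuous_on S (skew \<alpha> \<phi>)"
  unfolding skew_def[abs_def] by (auto intro!: continuous_intros intro: continuous_on_compose2[of UNIV \<phi>])

lemma skew_measurable: "continuous_on UNIV \<phi> \<Longrightarrow> skew \<alpha> \<phi> \<in> borel_measurable borel"
  by (intro borel_measurable_continuous_onI skew_continuous)

lemma skew_shift:
  assumes "periodic_cont \<phi>"
  shows "skew \<alpha> \<phi> (x + of_int m, y + of_int n) = skew \<alpha> \<phi> (x, y) + (of_int m, of_int n)"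
  using periodic_cont_int[OF assms] by (simp add: skew_def)

lemma skew_commutes: "periodic_cont \<phi> \<Longrightarrow> torus_commutes (skew \<alpha> \<phi>)"
  by (rule torus_commutesI) (metis skew_shift)

text \<open>On both sides all nontrivial Fourier coefficients vanish. Integrating over the fibre
  first settles \<open>k \<noteq> 0\<close>, where \<phi> contributes only a phase; for
  \<open>k = 0\<close> the character does not see the fibre.\<close>

lemma skew_preserves_lebesgue:
  assumes phi: "periodic_cont \<phi>"
  shows "distr torus_lebesgue borel (torus_proj \<circ> skew \<alpha> \<phi>) = torus_lebesgue"
proof (rule torus_prob_eqI)
  have c: "continuous_on UNIV \<phi>" using phi by (simp add: periodic_cont_def)
  show "torus_prob torus_lebesgue" by (rule torus_prob_lebesgue)
  show "torus_prob (distr torus_lebesgue borel (torus_proj \<circ> skew \<alpha> \<phi>))"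
    by (intro torus_prob_distr torus_prob_lebesgue skew_measurable c)
  interpret U: prob_space unit_lebesgue by (rule prob_space_unit_lebesgue)
  interpret pair_prob_space unit_lebesgue unit_lebesgue ..
  have sets: "sets torus_lebesgue = sets borel" and pr: "prob_space torus_lebesgue"
    using torus_prob_lebesgue by (auto simp: torus_prob_def)
  \<comment> \<open>Angle and fibre function are kept general so that the trivial skew product
    yields the coefficients of \<open>torus_lebesgue\<close> itself.\<close>
  have zero: "(\<integral>p. torus_char j k (skew a \<psi> p) \<partial>torus_lebesgue) = 0"
    if jk: "(j, k) \<noteq> (0, 0)" and cc: "continuous_on UNIV \<psi>" for j k a \<psi>
  proof -
    have m: "(\<lambda>p. torus_char j k (skew a \<psi> p)) \<in> borel_measurable borel"
      using measurable_compose[OF skew_measurable[OF cc] torus_char_measurable] .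
    have int: "integrable torus_lebesgue (\<lambda>p. torus_char j k (skew a \<psi> p))"
      by (rule prob_integrable_bounded_borel[OF pr sets m, of 1]) simp
    have inner: "(\<integral>y. torus_char j k (skew a \<psi> (x, y)) \<partial>unit_lebesgue) =
         cis (2 * pi * (of_int j * (x + a) + of_int k * \<psi> x)) * mean (\<lambda>y. cis (2 * pi * (of_int k * y)))" for x
    proof -
      have "(\<integral>y. torus_char j k (skew a \<psi> (x, y)) \<partial>unit_lebesgue)
         = (\<integral>y. cis (2 * pi * (of_int j * (x + a) + of_int k * \<psi> x)) * cis (2 * pi * (of_int k * y)) \<partial>unit_lebesgue)"
        by (simp add: torus_char_def skew_def cis_mult algebra_simps)
      also have "\<dots> = cis (2 * pi * (of_int j * (x + a) + of_int k * \<psi> x)) * (\<integral>y. cis (2 * pi * (of_int k * y)) \<partial>unit_lebesgue)"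
        by simp
      finally show ?thesis
        by (subst (asm) integral_unit_lebesgue) (auto intro!: continuous_intros)
    qed
    have "(\<integral>p. torus_char j k (skew a \<psi> p) \<partial>torus_lebesgue)
       = (\<integral>x. (\<integral>y. torus_char j k (skew a \<psi> (x, y)) \<partial>unit_lebesgue) \<partial>unit_lebesgue)"
      using integral_fst'[OF int[unfolded torus_lebesgue_def]] by (simp add: torus_lebesgue_def)
    also have "\<dots> = 0"
    proof (cases "k = 0")
      case False
      then show ?thesis unfolding inner by (simp add: mean_cis_int)
    next
      case True
      then have j: "j \<noteq> 0" using jk by simp
      have "(\<integral>x. (\<integral>y. torus_char j k (skew a \<psi> (x, y)) \<partial>unit_lebesgue) \<partial>unit_lebesgue)
         = (\<integral>x. cis (2 * pi * (of_int j * a)) * cis (2 * pi * (of_int j * x)) \<partial>unit_lebesgue)"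
        unfolding inner using True by (simp add: cis_mult algebra_simps)
      also have "\<dots> = cis (2 * pi * (of_int j * a)) * (\<integral>x. cis (2 * pi * (of_int j * x)) \<partial>unit_lebesgue)"
        by simp
      also have "\<dots> = 0"
        using mean_cis_int[OF j] by (subst integral_unit_lebesgue) (auto intro!: continuous_intros)
      finally show ?thesis .
    qed
    finally show ?thesis .
  qed
  fix j k :: int assume jk: "(j, k) \<noteq> (0, 0)"
  have mP: "torus_proj \<circ> skew \<alpha> \<phi> \<in> measurable torus_lebesgue borel"
    using sets skew_measurable[OF c] by (auto intro!: measurable_comp[OF _ torus_proj_measurable] cong: measurable_cong_sets)
  have "(\<integral>p. torus_char j k p \<partial>distr torus_lebesgue borel (torus_proj \<circ> skew \<alpha> \<phi>))
     = (\<integral>p. torus_char j k (skew \<alpha> \<phi> p) \<partial>torus_lebesgue)"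
    by (subst integral_distr[OF mP]) auto
  also have "\<dots> = 0" using zero[OF jk c] .
  also have "\<dots> = (\<integral>p. torus_char j k (skew 0 (\<lambda>_. 0) p) \<partial>torus_lebesgue)"
    using zero[OF jk] by simp
  finally show "(\<integral>p. torus_char j k p \<partial>distr torus_lebesgue borel (torus_proj \<circ> skew \<alpha> \<phi>))
     = (\<integral>p. torus_char j k p \<partial>torus_lebesgue)" by (simp add: skew_def)
qed

lemma skew_funpow:
  "(skew \<alpha> \<phi> ^^ n) (x, y) = (x + real n * \<alpha>, y + (\<Sum>i<n. \<phi> (x + real i * \<alpha>)))"
  by (induction n) (auto simp: skew_def algebra_simps)

text \<open>Up to the time \<open>qs m\<close> the Birkhoff sums of \<phi> agree within
  \<open>\<epsilon> / 2 ^ m\<close> with those of the coboundary of the first \<open>m\<close>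
  waves, so the averages of a character at that time are governed by the mean of
  \<open>twist j k (\<Psi> m)\<close>. The tail estimate has two uses later: \<open>m = 0\<close>
  bounds \<Phi>, and large \<open>m\<close> shows that the limit is approached by
  coboundaries.\<close>

lemma uniquely_ergodic_skew_exists:
  assumes al: "liouville \<alpha>" and eps: "\<epsilon> > 0" and rho: "\<rho> > 0"
  obtains qs \<Phi> \<phi> where
    "\<Phi> holomorphic_on {z. \<bar>Im z\<bar> < \<rho>}"
    "\<And>z m. \<bar>Im z\<bar> < \<rho> \<Longrightarrow> norm (\<Phi> z - (\<Sum>i<m. cos_cob \<alpha> (qs i) z)) \<le> \<epsilon> / 2 ^ m"
    "\<And>x. \<Phi> (of_real x) = of_real (\<phi> x)"
    "periodic_cont \<phi>" "uniquely_ergodic (skew \<alpha> \<phi>)"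
proof -
  define S where "S = {z. \<bar>Im z\<bar> < \<rho>}"
  have opS: "open S" unfolding S_def by (rule open_Im_strip)
  \<comment> \<open>Half of \<epsilon>, because a geometric tail of ratio 1/2 is twice its first
    term.\<close>
  obtain qs where qs: "\<And>n. good_stage \<alpha> \<rho> (\<epsilon> / 2) n (qs n) (\<lambda>t. \<Sum>i<n. cos (2 * pi * real (qs i) * t))"
    and mono: "mono qs"
    using good_stage_sequence[OF al, of "\<epsilon> / 2" \<rho>] eps by auto
  define \<Psi> where "\<Psi> n t = (\<Sum>i<n. cos (2 * pi * real (qs i) * t))" for n t
  have qpos: "qs n > 0" for n using qs[of n] by (simp add: good_stage_def)
  have qb: "real (qs n) * norm (cos_cob \<alpha> (qs n) z) \<le> \<epsilon> / 2 / 2 ^ n" if "z \<in> S" for n z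
    using qs[of n] that by (simp add: good_stage_def S_def)
  have b: "norm (cos_cob \<alpha> (qs n) z) \<le> \<epsilon> / 2 / 2 ^ n" if "z \<in> S" for n z
  proof -
    have "1 * norm (cos_cob \<alpha> (qs n) z) \<le> real (qs n) * norm (cos_cob \<alpha> (qs n) z)"
      using qpos[of n] by (intro mult_right_mono) auto
    then show ?thesis using qb[OF that, of n] by simp
  qed
  have sums: "(\<lambda>n. \<epsilon> / 2 / 2 ^ (n + m)) sums (\<epsilon> / 2 ^ m)" for m
    using sums_mult[OF geometric_sums[of "1/2 :: real"], of "\<epsilon> / 2 / 2 ^ m"]
    by (simp add: power_add power_divide field_simps)
  have summ: "summable (\<lambda>n. \<epsilon> / 2 / 2 ^ n)" using sums[of 0] by (simp add: sums_iff)
  define \<Phi> where "\<Phi> z = (\<Sum>i. cos_cob \<alpha> (qs i) z)" for z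
  have sc: "summable (\<lambda>i. cos_cob \<alpha> (qs i) z)" if "z \<in> S" for z
    by (rule summable_comparison_test'[OF summ, of 0]) (use b[OF that] in auto)
  \<comment> \<open>Since \<open>qs\<close> is monotone, the weight \<open>qs m\<close> of the whole
    tail is at most the weight \<open>qs (i + m)\<close> that each summand can bear.\<close>
  have tail: "real (qs m) * norm (\<Phi> z - (\<Sum>i<m. cos_cob \<alpha> (qs i) z)) \<le> \<epsilon> / 2 ^ m" if z: "z \<in> S" for z m
  proof -
    have "\<Phi> z - (\<Sum>i<m. cos_cob \<alpha> (qs i) z) = (\<Sum>i. cos_cob \<alpha> (qs (i + m)) z)"
      unfolding \<Phi>_def using suminf_minus_initial_segment[OF sc[OF z]] by simp
    then have "real (qs m) * norm (\<Phi> z - (\<Sum>i<m. cos_cob \<alpha> (qs i) z))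
       = norm (of_nat (qs m) * (\<Sum>i. cos_cob \<alpha> (qs (i + m)) z))"
      by (simp add: norm_mult)
    also have "of_nat (qs m) * (\<Sum>i. cos_cob \<alpha> (qs (i + m)) z) = (\<Sum>i. of_nat (qs m) * cos_cob \<alpha> (qs (i + m)) z)"
      by (rule suminf_mult[symmetric, OF summable_ignore_initial_segment[OF sc[OF z]]])
    also have "norm \<dots> \<le> (\<Sum>i. \<epsilon> / 2 / 2 ^ (i + m))"
    proof (rule norm_suminf_le)
      fix i
      have "norm (of_nat (qs m) * cos_cob \<alpha> (qs (i + m)) z) \<le> real (qs (i + m)) * norm (cos_cob \<alpha> (qs (i + m)) z)"
        unfolding norm_mult using monoD[OF mono, of m "i + m"] by (auto intro!: mult_right_mono)
      also have "\<dots> \<le> \<epsilon> / 2 / 2 ^ (i + m)" by (rule qb[OF z])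
      finally show "norm (of_nat (qs m) * cos_cob \<alpha> (qs (i + m)) z) \<le> \<epsilon> / 2 / 2 ^ (i + m)" .
    qed (use sums in \<open>auto simp: sums_iff\<close>)
    also have "\<dots> = \<epsilon> / 2 ^ m" using sums by (simp add: sums_iff)
    finally show ?thesis .
  qed
  have tail1: "norm (\<Phi> z - (\<Sum>i<m. cos_cob \<alpha> (qs i) z)) \<le> \<epsilon> / 2 ^ m" if z: "z \<in> S" for z m
  proof -
    have "1 * norm (\<Phi> z - (\<Sum>i<m. cos_cob \<alpha> (qs i) z)) \<le> real (qs m) * norm (\<Phi> z - (\<Sum>i<m. cos_cob \<alpha> (qs i) z))"
      using qpos[of m] by (intro mult_right_mono) auto
    then show ?thesis using tail[OF z, of m] by simp
  qed
  have ulim: "uniform_limit S (\<lambda>n z. \<Sum>i<n. cos_cob \<alpha> (qs i) z) \<Phi> sequentially"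
    unfolding \<Phi>_def by (rule Weierstrass_m_test[OF _ summ]) (rule b)
  have hol: "\<Phi> holomorphic_on S"
  proof (rule holomorphic_uniform_sequence[OF opS])
    show "(\<lambda>z. \<Sum>i<n. cos_cob \<alpha> (qs i) z) holomorphic_on S" for n
      by (intro holomorphic_intros cos_cob_holomorphic)
    fix x assume "x \<in> S"
    then obtain d where "d > 0" "cball x d \<subseteq> S" using opS open_contains_cball by blast
    then show "\<exists>d>0. cball x d \<subseteq> S \<and> uniform_limit (cball x d) (\<lambda>n z. \<Sum>i<n. cos_cob \<alpha> (qs i) z) \<Phi> sequentially"
      using uniform_limit_on_subset[OF ulim] by blast
  qed
  have rS: "complex_of_real x \<in> S" for x using rho by (simp add: S_def)
  define \<phi> where "\<phi> x = (\<Sum>i. cos (2 * pi * real (qs i) * (x + \<alpha>)) - cos (2 * pi * real (qs i) * x))" for x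
  have real_ext: "\<Phi> (of_real x) = of_real (\<phi> x)" for x
  proof -
    have "summable (\<lambda>i. complex_of_real (cos (2 * pi * real (qs i) * (x + \<alpha>)) - cos (2 * pi * real (qs i) * x)))"
      using sc[OF rS[of x]] unfolding cos_cob_of_real .
    then have "summable (\<lambda>i. cos (2 * pi * real (qs i) * (x + \<alpha>)) - cos (2 * pi * real (qs i) * x))"
      by (simp only: summable_complex_of_real)
    then show ?thesis
      unfolding \<Phi>_def \<phi>_def cos_cob_of_real by (rule suminf_of_real[symmetric])
  qed
  have pc: "periodic_cont \<phi>"
    unfolding periodic_cont_def
  proof (intro conjI allI)
    have "continuous_on UNIV (\<lambda>x. Re (\<Phi> (complex_of_real x)))"
      using rS by (intro continuous_intros continuous_on_compose2[OF holomorphic_on_imp_continuous_on[OF hol]]) auto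
    then show "continuous_on UNIV \<phi>" by (simp add: real_ext)
    fix x
    have per: "cos (2 * pi * real (qs i) * (t + 1)) = cos (2 * pi * real (qs i) * t)" for i t
      using periodic_cont_cos[of "qs i"] by (simp add: periodic_cont_def)
    show "\<phi> (x + 1) = \<phi> x"
      unfolding \<phi>_def using per[of _ "x + \<alpha>"] per[of _ x] by (simp add: add.assoc add.commute[of 1])
  qed
  have mean_step: "norm (mean (twist j k (\<Psi> (Suc n)))) \<le>
        norm (mean (twist 0 k (\<lambda>t. cos (2 * pi * t)))) * norm (mean (twist j k (\<Psi> n))) + 1 / real (Suc n)"
    and avg_step: "norm (\<Sum>i<qs n. twist j k (\<Psi> n) (x + real i * \<alpha>)) \<le> (norm (mean (twist j k (\<Psi> n))) + 1 / real (Suc n)) * real (qs n)"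
    if jk: "nat \<bar>j\<bar> \<le> n" "nat \<bar>k\<bar> \<le> n" for j k n x
  proof -
    have Psi: "\<Psi> n = (\<lambda>t. \<Sum>i<n. cos (2 * pi * real (qs i) * t))" by (simp add: \<Psi>_def[abs_def])
    have PsiS: "\<Psi> (Suc n) = (\<lambda>t. \<Psi> n t + cos (2 * pi * real (qs n) * t))" by (simp add: \<Psi>_def[abs_def])
    have "j \<in> {-int n..int n}" "k \<in> {-int n..int n}" using jk by auto
    then have A: "norm ((\<Sum>i<qs n. twist j k (\<Psi> n) (x + real i * \<alpha>)) - of_nat (qs n) * mean (twist j k (\<Psi> n))) \<le> 1 / real (Suc n) * real (qs n)"
      and B: "norm (mean (twist j k (\<Psi> (Suc n)))
           - mean (twist j k (\<Psi> n)) * mean (twist 0 k (\<lambda>t. cos (2 * pi * t)))) \<le> 1 / real (Suc n)"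
      using qs[of n] unfolding good_stage_def Psi[symmetric] PsiS by blast+
    show "norm (mean (twist j k (\<Psi> (Suc n)))) \<le>
        norm (mean (twist 0 k (\<lambda>t. cos (2 * pi * t)))) * norm (mean (twist j k (\<Psi> n))) + 1 / real (Suc n)"
      using norm_triangle_sub[of "mean (twist j k (\<Psi> (Suc n)))" "mean (twist j k (\<Psi> n)) * mean (twist 0 k (\<lambda>t. cos (2 * pi * t)))"] B
      by (simp add: norm_mult mult.commute)
    show "norm (\<Sum>i<qs n. twist j k (\<Psi> n) (x + real i * \<alpha>)) \<le> (norm (mean (twist j k (\<Psi> n))) + 1 / real (Suc n)) * real (qs n)"
      using norm_triangle_sub[of "\<Sum>i<qs n. twist j k (\<Psi> n) (x + real i * \<alpha>)" "of_nat (qs n) * mean (twist j k (\<Psi> n))"] A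
      by (simp add: norm_mult algebra_simps)
  qed
  have mean_small: "\<exists>m\<ge>n1. norm (mean (twist j k (\<Psi> m))) \<le> e"
    if jk: "(j, k) \<noteq> (0, 0)" and e: "e > 0" for j k e n1
  proof (cases "k = 0")
    \<comment> \<open>For \<open>k = 0\<close> the contraction factor would be 1, but then \<Psi>
      drops out and a nontrivial character of the circle has mean exactly 0.\<close>
    case True
    then have "mean (twist j k (\<Psi> m)) = 0" for m
      using jk mean_cis_int[of j] by (simp add: twist_def[abs_def])
    then show ?thesis using e by auto
  next
    case False
    show ?thesis
    proof (rule contraction_small[OF _ e, where b="\<lambda>n. 1 / real (Suc n)"])
      show "norm (mean (twist 0 k (\<lambda>t. cos (2 * pi * t)))) < 1"
        using mean_cis_cos_less_1[OF False] by (simp add: twist_def[abs_def])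
      show "(\<lambda>n. 1 / real (Suc n)) \<longlonglongrightarrow> 0"
        using LIMSEQ_inverse_real_of_nat by (simp add: inverse_eq_divide)
      show "norm (mean (twist j k (\<Psi> (Suc n)))) \<le>
        norm (mean (twist 0 k (\<lambda>t. cos (2 * pi * t)))) * norm (mean (twist j k (\<Psi> n))) + 1 / real (Suc n)"
        if "n \<ge> nat \<bar>j\<bar> + nat \<bar>k\<bar>" for n
        using mean_step[of j n k] that by simp
    qed simp
  qed
  \<comment> \<open>The coboundary telescopes; what remains is at most \<open>qs m\<close> terms,
    each bounded by \<open>\<epsilon> / 2 ^ m / qs m\<close>.\<close>
  have birkhoff: "\<bar>(\<Sum>i<n. \<phi> (x + real i * \<alpha>)) - (\<Psi> m (x + real n * \<alpha>) - \<Psi> m x)\<bar> \<le> \<epsilon> / 2 ^ m"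
    if n: "n \<le> qs m" for n m x
  proof -
    define d where "d y = \<phi> y - (\<Psi> m (y + \<alpha>) - \<Psi> m y)" for y
    have dy: "real (qs m) * \<bar>d y\<bar> \<le> \<epsilon> / 2 ^ m" for y
    proof -
      have "complex_of_real (d y) = \<Phi> (of_real y) - (\<Sum>i<m. cos_cob \<alpha> (qs i) (of_real y))"
        unfolding real_ext cos_cob_of_real d_def \<Psi>_def by (simp add: sum_subtractf)
      then have "\<bar>d y\<bar> = norm (\<Phi> (of_real y) - (\<Sum>i<m. cos_cob \<alpha> (qs i) (of_real y)))"
        by (metis norm_of_real)
      then show ?thesis using tail[OF rS, of m y] by simp
    qed
    have dy': "\<bar>d y\<bar> \<le> \<epsilon> / 2 ^ m / real (qs m)" for y
      using dy[of y] qpos[of m] by (simp add: pos_le_divide_eq ac_simps)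
    have "(\<Sum>i<n. \<Psi> m (x + real i * \<alpha> + \<alpha>) - \<Psi> m (x + real i * \<alpha>)) = \<Psi> m (x + real n * \<alpha>) - \<Psi> m x"
      using sum_lessThan_telescope[of "\<lambda>i. \<Psi> m (x + real i * \<alpha>)" n] by (simp add: algebra_simps)
    then have "(\<Sum>i<n. \<phi> (x + real i * \<alpha>)) - (\<Psi> m (x + real n * \<alpha>) - \<Psi> m x) = (\<Sum>i<n. d (x + real i * \<alpha>))"
      by (simp add: d_def sum_subtractf)
    also have "\<bar>\<dots>\<bar> \<le> (\<Sum>i<n. \<epsilon> / 2 ^ m / real (qs m))"
      unfolding real_norm_def[symmetric]
      by (rule sum_norm_le) (simp only: real_norm_def dy')
    also have "\<dots> = real n * (\<epsilon> / 2 ^ m / real (qs m))" by simp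
    also have "\<dots> \<le> real (qs m) * (\<epsilon> / 2 ^ m / real (qs m))"
      using n eps by (intro mult_right_mono) auto
    also have "\<dots> = \<epsilon> / 2 ^ m" using qpos[of m] by simp
    finally show ?thesis .
  qed
  have ue: "uniquely_ergodic (skew \<alpha> \<phi>)"
  proof (rule uniquely_ergodicI[OF skew_measurable skew_commutes[OF pc] torus_prob_lebesgue skew_preserves_lebesgue[OF pc]])
    show "continuous_on UNIV \<phi>" using pc by (simp add: periodic_cont_def)
    fix j k :: int and e :: real
    assume jk: "(j, k) \<noteq> (0, 0)" and e: "e > 0"
    have "(\<lambda>m. 1 / real (Suc m) + 2 * pi * \<bar>of_int k\<bar> * (\<epsilon> / 2 ^ m)) \<longlonglongrightarrow> 0 + 2 * pi * \<bar>of_int k\<bar> * 0"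
    proof (intro tendsto_intros)
      show "(\<lambda>n. 1 / real (Suc n)) \<longlonglongrightarrow> 0"
        using LIMSEQ_inverse_real_of_nat by (simp add: inverse_eq_divide)
      show "(\<lambda>m. \<epsilon> / 2 ^ m) \<longlonglongrightarrow> 0" by real_asymp
    qed
    then have "\<forall>\<^sub>F m in sequentially. 1 / real (Suc m) + 2 * pi * \<bar>of_int k\<bar> * (\<epsilon> / 2 ^ m) < e / 2"
      using e by (intro order_tendstoD) auto
    then obtain n1 where n1: "\<And>m. m \<ge> n1 \<Longrightarrow> 1 / real (Suc m) + 2 * pi * \<bar>of_int k\<bar> * (\<epsilon> / 2 ^ m) < e / 2"
      unfolding eventually_sequentially by blast
    \<comment> \<open>Some stage beyond any given index is enough, as one good time suffices for
      unique ergodicity. One half of \<open>e\<close> pays for the mean of the twist, the other for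
      the equidistribution and phase errors together.\<close>
    obtain m where m: "m \<ge> max n1 (nat \<bar>j\<bar> + nat \<bar>k\<bar>)" "norm (mean (twist j k (\<Psi> m))) \<le> e / 2"
      using mean_small[OF jk, of "e / 2"] e by (meson half_gt_zero)
    show "\<exists>N>0. \<forall>p. norm (\<Sum>n<N. torus_char j k ((skew \<alpha> \<phi> ^^ n) p)) \<le> e * real N"
    proof (intro exI[of _ "qs m"] conjI allI qpos)
      fix p :: "real \<times> real"
      obtain x y where p: "p = (x, y)" by (cases p)
      \<comment> \<open>The phase of the starting point: independent of the time and of modulus 1,
        it factors out of the Birkhoff sum.\<close>
      define c where "c = cis (2 * pi * (of_int k * y - of_int k * \<Psi> m x))"
      have near: "norm (torus_char j k ((skew \<alpha> \<phi> ^^ n) p) - c * twist j k (\<Psi> m) (x + real n * \<alpha>)) \<le> 2 * pi * \<bar>of_int k\<bar> * (\<epsilon> / 2 ^ m)"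
        if n: "n < qs m" for n
      proof -
        define D where "D = (\<Sum>i<n. \<phi> (x + real i * \<alpha>)) - (\<Psi> m (x + real n * \<alpha>) - \<Psi> m x)"
        have "norm (torus_char j k ((skew \<alpha> \<phi> ^^ n) p) - c * twist j k (\<Psi> m) (x + real n * \<alpha>)) \<le> \<bar>2 * pi * of_int k * D\<bar>"
          unfolding p skew_funpow torus_char_def c_def twist_def cis_mult
          by (rule order_trans[OF norm_cis_diff_le]) (simp add: D_def algebra_simps)
        also have "\<dots> = 2 * pi * \<bar>of_int k\<bar> * \<bar>D\<bar>" by (simp add: abs_mult)
        also have "\<dots> \<le> 2 * pi * \<bar>of_int k\<bar> * (\<epsilon> / 2 ^ m)"
          unfolding D_def using n by (intro mult_left_mono birkhoff) auto
        finally show ?thesis .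
      qed
      have "norm (\<Sum>n<qs m. torus_char j k ((skew \<alpha> \<phi> ^^ n) p))
         \<le> norm (c * (\<Sum>n<qs m. twist j k (\<Psi> m) (x + real n * \<alpha>)))
           + norm ((\<Sum>n<qs m. torus_char j k ((skew \<alpha> \<phi> ^^ n) p)) - c * (\<Sum>n<qs m. twist j k (\<Psi> m) (x + real n * \<alpha>)))"
        by (rule norm_triangle_sub)
      also have "norm (c * (\<Sum>n<qs m. twist j k (\<Psi> m) (x + real n * \<alpha>))) \<le> (norm (mean (twist j k (\<Psi> m))) + 1 / real (Suc m)) * real (qs m)"
        using avg_step[of j m k x] m(1) by (simp add: norm_mult c_def)
      also have "norm ((\<Sum>n<qs m. torus_char j k ((skew \<alpha> \<phi> ^^ n) p)) - c * (\<Sum>n<qs m. twist j k (\<Psi> m) (x + real n * \<alpha>)))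
          \<le> (\<Sum>n<qs m. 2 * pi * \<bar>of_int k\<bar> * (\<epsilon> / 2 ^ m))"
        unfolding sum_distrib_left sum_subtractf[symmetric] by (rule sum_norm_le) (use near in auto)
      also have "(norm (mean (twist j k (\<Psi> m))) + 1 / real (Suc m)) * real (qs m) + (\<Sum>n<qs m. 2 * pi * \<bar>of_int k\<bar> * (\<epsilon> / 2 ^ m))
         = (norm (mean (twist j k (\<Psi> m))) + (1 / real (Suc m) + 2 * pi * \<bar>of_int k\<bar> * (\<epsilon> / 2 ^ m))) * real (qs m)"
        by (simp add: algebra_simps)
      also have "\<dots> \<le> e * real (qs m)"
        using n1[of m] m by (intro mult_right_mono) auto
      finally show "norm (\<Sum>n<qs m. torus_char j k ((skew \<alpha> \<phi> ^^ n) p)) \<le> e * real (qs m)" by simp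
    qed
  qed
  show ?thesis
    by (rule that[OF hol[unfolded S_def] _ real_ext pc ue]) (use tail1 in \<open>auto simp: S_def\<close>)
qed

section \<open>Conjugates of skew products by torus diffeomorphisms\<close>

lemma real_analytic2_continuous:
  assumes "real_analytic2 f"
  shows "continuous_on UNIV f"
proof -
  obtain U g where U: "open U" "\<And>x y. (complex_of_real x, complex_of_real y) \<in> U"
    and g: "holo2 g U" "\<And>x y. g (complex_of_real x, complex_of_real y) = complex_of_real (f (x, y))"
    using assms unfolding real_analytic2_def by blast
  have "continuous_on UNIV (\<lambda>p. Re (g (complex_of_real (fst p), complex_of_real (snd p))))"
    by (intro continuous_intros continuous_on_compose2[OF holo2_continuous_on[OF g(1)]]) (use U in auto)
  then show ?thesis by (simp add: g(2))
qed

lemma real_analytic2_compose: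
  assumes "real_analytic2 f" "real_analytic2 g1" "real_analytic2 g2"
  shows "real_analytic2 (\<lambda>p. f (g1 p, g2 p))"
proof -
  obtain U F where U: "open U" "\<And>x y. (complex_of_real x, complex_of_real y) \<in> U"
    and F: "holo2 F U" "\<And>x y. F (complex_of_real x, complex_of_real y) = complex_of_real (f (x, y))"
    using assms(1) unfolding real_analytic2_def by blast
  obtain U1 G1 where U1: "open U1" "\<And>x y. (complex_of_real x, complex_of_real y) \<in> U1"
    and G1: "holo2 G1 U1" "\<And>x y. G1 (complex_of_real x, complex_of_real y) = complex_of_real (g1 (x, y))"
    using assms(2) unfolding real_analytic2_def by blast
  obtain U2 G2 where U2: "open U2" "\<And>x y. (complex_of_real x, complex_of_real y) \<in> U2"
    and G2: "holo2 G2 U2" "\<And>x y. G2 (complex_of_real x, complex_of_real y) = complex_of_real (g2 (x, y))"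
    using assms(3) unfolding real_analytic2_def by blast
  define V where "V = (U1 \<inter> U2) \<inter> ((\<lambda>z. (G1 z, G2 z)) -` U)"
  have h1: "holo2 G1 (U1 \<inter> U2)" and h2: "holo2 G2 (U1 \<inter> U2)"
    using G1(1) G2(1) holo2_subset by blast+
  have "open V"
    unfolding V_def using h1 h2
    by (intro continuous_open_preimage continuous_on_Pair holo2_continuous_on open_Int U(1) U1(1) U2(1))
  moreover have "holo2 (\<lambda>z. F (G1 z, G2 z)) V"
    by (rule holo2_compose2[OF holo2_subset[OF h1] holo2_subset[OF h2] F(1)]) (auto simp: V_def)
  ultimately show ?thesis
    unfolding real_analytic2_def using U U1 U2 F G1 G2
    by (intro exI[of _ V] exI[of _ "\<lambda>z. F (G1 z, G2 z)"]) (auto simp: V_def)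
qed

lemma real_analytic2_ext:
  assumes "open V" "\<And>x. complex_of_real x \<in> V" "\<Phi> holomorphic_on V"
    and "\<And>x. \<Phi> (complex_of_real x) = complex_of_real (\<phi> x)"
  shows "real_analytic2 (\<lambda>p. snd p + \<phi> (fst p))"
  unfolding real_analytic2_def
proof (intro exI conjI)
  show "open (V \<times> (UNIV :: complex set))" using assms(1) by (intro open_Times) auto
  show "holo2 (\<lambda>z. snd z + \<Phi> (fst z)) (V \<times> UNIV)"
    by (intro holo2_add holo2_snd holo2_compose1[OF holo2_fst assms(3,1)]) auto
qed (use assms in auto)

lemma real_analytic2_fst_add: "real_analytic2 (\<lambda>p. fst p + a)"
  unfolding real_analytic2_def
  by (intro exI[of _ UNIV] exI[of _ "\<lambda>z. fst z + complex_of_real a"])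
     (auto intro!: holo2_add holo2_fst holo2_const)

lemma ra_diffeo2_comp:
  assumes "ra_diffeo2 F" "ra_diffeo2 G"
  shows "ra_diffeo2 (F \<circ> G)"
proof -
  have c: "real_analytic2 (\<lambda>p. f (B p))"
    if "real_analytic2 f" "real_analytic2 (\<lambda>p. fst (B p))" "real_analytic2 (\<lambda>p. snd (B p))"
    for f and B :: "real \<times> real \<Rightarrow> real \<times> real"
    using real_analytic2_compose[OF that] by simp
  have "bij F" "bij G" using assms by (auto simp: ra_diffeo2_def)
  then have "inv (F \<circ> G) = inv G \<circ> inv F" "bij (F \<circ> G)"
    by (auto intro: o_inv_distrib bij_comp)
  then show ?thesis
    using assms c[of "\<lambda>p. fst (F p)" G] c[of "\<lambda>p. snd (F p)" G]
      c[of "\<lambda>p. fst (inv G p)" "inv F"] c[of "\<lambda>p. snd (inv G p)" "inv F"]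
    by (simp add: ra_diffeo2_def)
qed

lemma ra_diffeo2_inv: "ra_diffeo2 F \<Longrightarrow> ra_diffeo2 (inv F)"
  by (simp add: ra_diffeo2_def bij_imp_bij_inv inv_inv_eq)

lemma skew_inv:
  shows bij_skew: "bij (skew \<alpha> \<phi>)" and inv_skew: "inv (skew \<alpha> \<phi>) = skew (- \<alpha>) (\<lambda>x. - \<phi> (x - \<alpha>))"
proof -
  have 1: "skew \<alpha> \<phi> \<circ> skew (- \<alpha>) (\<lambda>x. - \<phi> (x - \<alpha>)) = id"
    and 2: "skew (- \<alpha>) (\<lambda>x. - \<phi> (x - \<alpha>)) \<circ> skew \<alpha> \<phi> = id"
    by (auto simp: skew_def)
  show "bij (skew \<alpha> \<phi>)" using 1 2 by (rule o_bij[rotated])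
  show "inv (skew \<alpha> \<phi>) = skew (- \<alpha>) (\<lambda>x. - \<phi> (x - \<alpha>))" using 2 1 by (rule inv_unique_comp[rotated])
qed

lemma ra_diffeo2_skew:
  assumes hol: "\<Phi> holomorphic_on {z. \<bar>Im z\<bar> < \<rho>}" and "\<rho> > 0"
    and re: "\<And>x. \<Phi> (complex_of_real x) = complex_of_real (\<phi> x)"
  shows "ra_diffeo2 (skew \<alpha> \<phi>)"
proof -
  have r: "\<And>x. complex_of_real x \<in> {z. \<bar>Im z\<bar> < \<rho>}" using assms by simp
  have hol': "(\<lambda>z. - \<Phi> (z - complex_of_real \<alpha>)) holomorphic_on {z. \<bar>Im z\<bar> < \<rho>}"
    by (intro holomorphic_intros holomorphic_on_compose_gen[OF _ hol, unfolded o_def]) auto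
  have re': "- \<Phi> (complex_of_real x - complex_of_real \<alpha>) = complex_of_real (- \<phi> (x - \<alpha>))" for x
    using re[of "x - \<alpha>"] by simp
  show ?thesis
    unfolding ra_diffeo2_def inv_skew
    using bij_skew real_analytic2_ext[OF open_Im_strip r hol re]
      real_analytic2_ext[OF open_Im_strip r hol' re'] real_analytic2_fst_add[of \<alpha>] real_analytic2_fst_add[of "- \<alpha>"]
    by (simp add: skew_def)
qed

text \<open>Each vertical fibre is translated, so slices keep their length and Fubini
  concludes.\<close>

lemma skew_area_preserving:
  assumes "continuous_on UNIV \<psi>"
  shows "distr lborel lborel (skew 0 \<psi>) = lborel"
proof (rule measure_eqI)
  fix A assume "A \<in> sets (distr lborel lborel (skew 0 \<psi>))"
  then have A: "A \<in> sets (borel :: (real \<times> real) measure)" by simp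
  have m: "skew 0 \<psi> \<in> borel_measurable borel" by (rule skew_measurable[OF assms])
  then have B: "skew 0 \<psi> -` A \<in> sets (borel :: (real \<times> real) measure)"
    using measurable_sets[OF m A] by simp
  have slice: "emeasure lborel (Pair x -` (skew 0 \<psi> -` A)) = emeasure lborel (Pair x -` A)" for x
  proof -
    have Ax: "Pair x -` A \<in> sets borel"
      using sets_Pair1[of A borel borel x] A by (simp only: borel_prod)
    have "Pair x -` (skew 0 \<psi> -` A) = (+) (\<psi> x) -` (Pair x -` A)"
      by (auto simp: skew_def add.commute)
    then have "emeasure lborel (Pair x -` (skew 0 \<psi> -` A)) = emeasure (distr lborel borel ((+) (\<psi> x))) (Pair x -` A)"
      using Ax by (simp add: emeasure_distr)
    then show ?thesis by (simp add: lborel_distr_plus)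
  qed
  have pair: "emeasure (lborel :: (real \<times> real) measure) X = (\<integral>\<^sup>+ x. emeasure lborel (Pair x -` X) \<partial>lborel)"
    if "X \<in> sets borel" for X
  proof -
    have "X \<in> sets (lborel \<Otimes>\<^sub>M (lborel :: real measure) :: (real \<times> real) measure)"
      using that by (simp only: lborel_prod sets_lborel)
    then show ?thesis
      using lborel.emeasure_pair_measure_alt[of X lborel] by (simp add: lborel_prod)
  qed
  have "emeasure (distr lborel lborel (skew 0 \<psi>)) A = emeasure lborel (skew 0 \<psi> -` A)"
    using m A by (subst emeasure_distr) auto
  also have "\<dots> = emeasure lborel A" unfolding pair[OF A] pair[OF B] slice ..
  finally show "emeasure (distr lborel lborel (skew 0 \<psi>)) A = emeasure lborel A" .
qed simp

lemma equivariant_if_real_equivariant: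
  assumes g: "holo2 g (strip r)" and r: "r > 0"
    and re: "\<And>x y. g (complex_of_real x, complex_of_real y) = complex_of_real (f (x, y))"
    and eqv: "\<And>x y m n. f (x + of_int m, y + of_int n) = f (x, y) + c (m, n)"
  shows "equivariant r (\<lambda>k. complex_of_real (c k)) g"
  unfolding equivariant_def
proof (intro ballI allI)
  fix z k assume z: "z \<in> strip r"
  have "g (fst z + of_int (fst k), snd z + of_int (snd k)) = g z + complex_of_real (c k)"
  proof (rule holo2_identity_strip[OF _ _ r _ z])
    show "holo2 (\<lambda>z. g (fst z + of_int (fst k), snd z + of_int (snd k))) (strip r)"
      by (rule holo2_compose2[OF _ _ g]) (auto intro!: holo2_add holo2_fst holo2_snd holo2_const simp: strip_def)
    show "holo2 (\<lambda>z. g z + complex_of_real (c k)) (strip r)"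
      by (intro holo2_add g holo2_const)
    fix x y
    have "g (complex_of_real (x + of_int (fst k)), complex_of_real (y + of_int (snd k)))
            = g (complex_of_real x, complex_of_real y) + complex_of_real (c k)"
      unfolding re using eqv[of x "fst k" y "snd k"] by simp
    then show "g (fst (complex_of_real x, complex_of_real y) + of_int (fst k), snd (complex_of_real x, complex_of_real y) + of_int (snd k))
            = g (complex_of_real x, complex_of_real y) + complex_of_real (c k)" by simp
  qed
  then show "g (z + shift2 k) = g z + complex_of_real (c k)" by (simp add: shift2_def plus_prod_def)
qed

text \<open>The same \<rho> bounds the width and the size: near the real plane the extension of
  \<open>T\<close> has imaginary parts below \<rho>, and adding \<Phi> keeps them below 2 \<rho>,
  the width on which the inverse of \<open>T\<close> is extended.\<close>

definition small_ext :: "real \<Rightarrow> (real \<Rightarrow> real) \<Rightarrow> (complex \<Rightarrow> complex) \<Rightarrow> bool" where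
  "small_ext \<rho> \<phi> \<Phi> \<longleftrightarrow> \<Phi> holomorphic_on {z. \<bar>Im z\<bar> < \<rho>} \<and> (\<forall>z. \<bar>Im z\<bar> < \<rho> \<longrightarrow> norm (\<Phi> z) < \<rho>) \<and>
     (\<forall>x. \<Phi> (complex_of_real x) = complex_of_real (\<phi> x)) \<and> periodic_cont \<phi>"

text \<open>An integer matrix of determinant 1 or -1 has an integer inverse, so the inverse lift is
  equivariant too.\<close>

lemma area_pres_lift_inverse:
  assumes T: "area_pres_torus_diffeo_lift T"
  obtains a b c d a' b' c' d' :: int where
    "\<And>x y m n. T (x + of_int m, y + of_int n) = T (x, y) + (of_int (a * m + b * n), of_int (c * m + d * n))"
    "\<And>x y m n. inv T (x + of_int m, y + of_int n) = inv T (x, y) + (of_int (a' * m + b' * n), of_int (c' * m + d' * n))"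
    "\<And>x y m n. inv T ((x, y) + (of_int (a * m + b * n), of_int (c * m + d * n))) = inv T (x, y) + (of_int m, of_int n)"
proof -
  obtain a b c d :: int where det: "\<bar>a * d - b * c\<bar> = 1"
    and eqT: "\<And>x y m n. T (x + of_int m, y + of_int n) = T (x, y) + (of_int (a * m + b * n), of_int (c * m + d * n))"
    using T unfolding area_pres_torus_diffeo_lift_def by blast
  have bij: "bij T" using T by (simp add: area_pres_torus_diffeo_lift_def ra_diffeo2_def)
  define D where "D = a * d - b * c"
  have DD: "D * D = 1" using det unfolding D_def[symmetric] by (metis abs_mult_self_eq mult_1)
  have eqS: "inv T ((x, y) + (of_int (a * m + b * n), of_int (c * m + d * n))) = inv T (x, y) + (of_int m, of_int n)"
    for x y m n
  proof -
    define p where "p = inv T (x, y)"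
    have Tp: "T p = (x, y)" using bij by (simp add: p_def bij_is_surj surj_f_inv_f)
    have "T (p + (of_int m, of_int n)) = (x, y) + (of_int (a * m + b * n), of_int (c * m + d * n))"
      using eqT[of "fst p" m "snd p" n] Tp by (simp add: plus_prod_def)
    then show ?thesis using bij by (metis p_def bij_inv_eq_iff)
  qed
  show ?thesis
  proof (rule that[OF eqT _ eqS])
    fix x y :: real and m n :: int
    \<comment> \<open>The inverse matrix is \<open>D\<close> times the adjugate, because
      \<open>D\<close> is its own inverse.\<close>
    have "a * (D * d * m + (- D * b) * n) + b * ((- D * c) * m + D * a * n) = D * D * m"
      "c * (D * d * m + (- D * b) * n) + d * ((- D * c) * m + D * a * n) = D * D * n"
      unfolding D_def by (simp_all add: algebra_simps)
    then show "inv T (x + of_int m, y + of_int n)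
       = inv T (x, y) + (of_int (D * d * m + (- D * b) * n), of_int ((- D * c) * m + D * a * n))"
      using eqS[of x y "D * d * m + (- D * b) * n" "(- D * c) * m + D * a * n"] DD by simp
  qed
qed

lemma strip_dist_real:
  assumes "z \<in> strip r"
  shows "dist z (complex_of_real (Re (fst z)), complex_of_real (Re (snd z))) < 2 * r"
proof -
  have "dist z (complex_of_real (Re (fst z)), complex_of_real (Re (snd z)))
     \<le> dist (fst z) (complex_of_real (Re (fst z))) + dist (snd z) (complex_of_real (Re (snd z)))"
    using sqrt_sum_squares_le_sum[of "dist (fst z) (complex_of_real (Re (fst z)))" "dist (snd z) (complex_of_real (Re (snd z)))"]
    by (simp add: dist_prod_def)
  also have "\<dots> = \<bar>Im (fst z)\<bar> + \<bar>Im (snd z)\<bar>"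
    by (simp add: dist_complex_def cmod_def)
  also have "\<dots> < 2 * r" using assms by (auto simp: strip_def)
  finally show ?thesis .
qed

text \<open>The widths depend on \<open>T\<close> alone and \<delta> only on \<open>T\<close> and
  \<open>e\<close>; this uniformity in \<alpha> and \<phi> places all conjugates in one
  \<open>Diff_r r\<close>, compared by one metric. Extensions arise by composing those of
  \<open>T\<close> and its inverse with the complexified fibre map; equivariance supplies uniform
  continuity on unbounded strips.\<close>

lemma conjugated_skew_products:
  assumes T: "area_pres_torus_diffeo_lift T"
  obtains r \<rho> where "r > 0" "\<rho> > 0"
    "\<And>\<alpha> \<phi> \<Phi>. small_ext \<rho> \<phi> \<Phi> \<Longrightarrow> inv T \<circ> skew \<alpha> \<phi> \<circ> T \<in> Diff_r r"
    "\<And>e. e > 0 \<Longrightarrow> \<exists>\<delta>>0. \<forall>\<alpha> \<phi> \<Phi> \<phi>' \<Phi>'. small_ext \<rho> \<phi> \<Phi> \<and> small_ext \<rho> \<phi>' \<Phi>' \<and>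
        (\<forall>z. \<bar>Im z\<bar> < \<rho> \<longrightarrow> norm (\<Phi> z - \<Phi>' z) < \<delta>) \<longrightarrow>
        dist_r r (inv T \<circ> skew \<alpha> \<phi> \<circ> T) (inv T \<circ> skew \<alpha> \<phi>' \<circ> T) < e"
proof -
  define S where "S = inv T"
  have raT: "ra_diffeo2 T" using T by (simp add: area_pres_torus_diffeo_lift_def)
  have raS: "ra_diffeo2 S" unfolding S_def by (rule ra_diffeo2_inv[OF raT])
  obtain a b c d a' b' c' d' :: int where
    eqT: "\<And>x y m n. T (x + of_int m, y + of_int n) = T (x, y) + (of_int (a * m + b * n), of_int (c * m + d * n))"
    and eqS: "\<And>x y m n. S (x + of_int m, y + of_int n) = S (x, y) + (of_int (a' * m + b' * n), of_int (c' * m + d' * n))"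
    and eqST: "\<And>x y m n. S ((x, y) + (of_int (a * m + b * n), of_int (c * m + d * n))) = S (x, y) + (of_int m, of_int n)"
    using area_pres_lift_inverse[OF T] unfolding S_def by metis
  have ext: "\<exists>r g k. r > 0 \<and> holo2 g (strip r) \<and>
      (\<forall>x y. g (complex_of_real x, complex_of_real y) = complex_of_real (f (x, y))) \<and> equivariant r k g"
    if "real_analytic2 f" "\<And>x y m n. f (x + of_int m, y + of_int n) = f (x, y) + c (m, n)" for f c
    using real_analytic2_extension[OF that] by metis
  obtain r1 T1 k1 where T1: "r1 > 0" "holo2 T1 (strip r1)"
      "\<And>x y. T1 (complex_of_real x, complex_of_real y) = complex_of_real (fst (T (x, y)))" "equivariant r1 k1 T1"
    using ext[of "\<lambda>p. fst (T p)" "\<lambda>k. of_int (a * fst k + b * snd k)"] raT eqT unfolding ra_diffeo2_def by auto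
  obtain r2 T2 k2 where T2: "r2 > 0" "holo2 T2 (strip r2)"
      "\<And>x y. T2 (complex_of_real x, complex_of_real y) = complex_of_real (snd (T (x, y)))" "equivariant r2 k2 T2"
    using ext[of "\<lambda>p. snd (T p)" "\<lambda>k. of_int (c * fst k + d * snd k)"] raT eqT unfolding ra_diffeo2_def by auto
  obtain r3 S1 k3 where S1: "r3 > 0" "holo2 S1 (strip r3)"
      "\<And>x y. S1 (complex_of_real x, complex_of_real y) = complex_of_real (fst (S (x, y)))" "equivariant r3 k3 S1"
    using ext[of "\<lambda>p. fst (S p)" "\<lambda>k. of_int (a' * fst k + b' * snd k)"] raS eqS unfolding ra_diffeo2_def by auto
  obtain r4 S2 k4 where S2: "r4 > 0" "holo2 S2 (strip r4)"
      "\<And>x y. S2 (complex_of_real x, complex_of_real y) = complex_of_real (snd (S (x, y)))" "equivariant r4 k4 S2"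
    using ext[of "\<lambda>p. snd (S p)" "\<lambda>k. of_int (c' * fst k + d' * snd k)"] raS eqS unfolding ra_diffeo2_def by auto
  define s where "s = min r3 r4 / 2"
  have s: "s > 0" "s < r3" "s < r4" using S1(1) S2(1) by (auto simp: s_def)
  have ucS: "uniformly_continuous_on (strip s) S1" "uniformly_continuous_on (strip s) S2"
    using equivariant_uniformly_continuous[OF S1(2,4) s(2)] equivariant_uniformly_continuous[OF S2(2,4) s(3)] by auto
  have hS: "holo2 S1 (strip s)" "holo2 S2 (strip s)"
    using holo2_subset[OF S1(2)] holo2_subset[OF S2(2)] strip_mono[of s r3] strip_mono[of s r4] s by auto
  define \<rho> where "\<rho> = s / 2"
  have rho: "\<rho> > 0" using s by (simp add: \<rho>_def)
  define t where "t = min r1 r2 / 2"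
  have t: "t > 0" "t < r1" "t < r2" using T1(1) T2(1) by (auto simp: t_def)
  obtain d1 where d1: "d1 > 0" "\<forall>z\<in>strip t. \<forall>w\<in>strip t. dist w z < d1 \<longrightarrow> dist (T1 w) (T1 z) < \<rho>"
    using equivariant_uniformly_continuous[OF T1(2,4) t(2)] rho unfolding uniformly_continuous_on_def by metis
  obtain d2 where d2: "d2 > 0" "\<forall>z\<in>strip t. \<forall>w\<in>strip t. dist w z < d2 \<longrightarrow> dist (T2 w) (T2 z) < \<rho>"
    using equivariant_uniformly_continuous[OF T2(2,4) t(3)] rho unfolding uniformly_continuous_on_def by metis
  \<comment> \<open>A point of \<open>strip r0\<close> is closer than \<open>2 * r0\<close> to its
    real part, hence the halves of \<open>d1\<close> and \<open>d2\<close>.\<close>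
  define r0 where "r0 = min t (min d1 d2 / 2)"
  have r0: "r0 > 0" "r0 \<le> t" "2 * r0 \<le> d1" "2 * r0 \<le> d2" using t d1(1) d2(1) by (auto simp: r0_def)
  have hT: "holo2 T1 (strip r0)" "holo2 T2 (strip r0)"
    using holo2_subset[OF T1(2)] holo2_subset[OF T2(2)] strip_mono[of r0 r1] strip_mono[of r0 r2] t r0 by auto
  \<comment> \<open>At the real part of \<open>z\<close> the values of \<open>T1\<close> and
    \<open>T2\<close> are real, so their imaginary parts at \<open>z\<close> are bounded by the
    variation in between.\<close>
  have ImT: "\<bar>Im (T1 z)\<bar> < \<rho>" "\<bar>Im (T2 z)\<bar> < \<rho>" if z: "z \<in> strip r0" for z
  proof -
    define w where "w = (complex_of_real (Re (fst z)), complex_of_real (Re (snd z)))"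
    have zt: "z \<in> strip t" using z strip_mono[OF r0(2)] by blast
    have wt: "w \<in> strip t" using t by (simp add: w_def strip_def)
    have dist: "dist z w < 2 * r0" unfolding w_def by (rule strip_dist_real[OF z])
    then have "dist (T1 z) (T1 w) < \<rho>" "dist (T2 z) (T2 w) < \<rho>"
      using d1(2) d2(2) zt wt r0 by (meson less_le_trans)+
    moreover have "Im (T1 w) = 0" "Im (T2 w) = 0" unfolding w_def T1(3) T2(3) by auto
    ultimately show "\<bar>Im (T1 z)\<bar> < \<rho>" "\<bar>Im (T2 z)\<bar> < \<rho>"
      using abs_Im_le_cmod[of "T1 z - T1 w"] abs_Im_le_cmod[of "T2 z - T2 w"] by (auto simp: dist_norm)
  qed
  define H where "H \<alpha> \<Phi> z = (T1 z + complex_of_real \<alpha>, T2 z + \<Phi> (T1 z))" for \<alpha> \<Phi> z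
  \<comment> \<open>The periodic displacements are holomorphic on \<open>strip r0\<close>;
    boundedness is obtained on a strictly smaller strip.\<close>
  define r where "r = r0 / 2"
  have r: "r > 0" "r < r0" using r0 by (auto simp: r_def)
  have Hs: "H \<alpha> \<Phi> z \<in> strip s" if "small_ext \<rho> \<phi> \<Phi>" "z \<in> strip r0" for \<alpha> \<phi> \<Phi> z
  proof -
    have "norm (\<Phi> (T1 z)) < \<rho>" using that ImT(1)[OF that(2)] by (simp add: small_ext_def)
    then have "\<bar>Im (\<Phi> (T1 z))\<bar> < \<rho>" using abs_Im_le_cmod[of "\<Phi> (T1 z)"] by linarith
    then have "\<bar>Im (T2 z) + Im (\<Phi> (T1 z))\<bar> < s"
      using ImT(2)[OF that(2)] by (auto simp: \<rho>_def)
    moreover have "\<bar>Im (T1 z)\<bar> < s" using ImT(1)[OF that(2)] s by (auto simp: \<rho>_def)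
    ultimately show ?thesis by (simp add: H_def strip_def)
  qed
  have comp: "holo2 (\<lambda>z. g (H \<alpha> \<Phi> z)) (strip r0)" if "small_ext \<rho> \<phi> \<Phi>" "holo2 g (strip s)" for g \<alpha> \<phi> \<Phi>
    unfolding H_def
  proof (rule holo2_compose2[OF _ _ that(2)])
    show "holo2 (\<lambda>z. T1 z + complex_of_real \<alpha>) (strip r0)" by (intro holo2_add hT holo2_const)
    show "holo2 (\<lambda>z. T2 z + \<Phi> (T1 z)) (strip r0)"
      by (intro holo2_add hT holo2_compose1[OF hT(1) _ open_Im_strip[of \<rho>]])
         (use that ImT in \<open>auto simp: small_ext_def\<close>)
  qed (use Hs[OF that(1)] in \<open>auto simp: H_def\<close>)
  have Hreal: "H \<alpha> \<Phi> (complex_of_real x, complex_of_real y) =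
       (complex_of_real (fst (skew \<alpha> \<phi> (T (x, y)))), complex_of_real (snd (skew \<alpha> \<phi> (T (x, y)))))"
    if "small_ext \<rho> \<phi> \<Phi>" for \<alpha> \<phi> \<Phi> x y
    using that unfolding H_def T1(3) T2(3) by (simp add: small_ext_def skew_def)
  define G where "G \<alpha> \<phi> = S \<circ> skew \<alpha> \<phi> \<circ> T" for \<alpha> \<phi>
  have Gshift: "G \<alpha> \<phi> (x + of_int m, y + of_int n) = G \<alpha> \<phi> (x, y) + (of_int m, of_int n)"
    if "small_ext \<rho> \<phi> \<Phi>" for \<alpha> \<phi> \<Phi> x y m n
  proof -
    have pc: "periodic_cont \<phi>" using that by (simp add: small_ext_def)
    obtain u v where uv: "T (x, y) = (u, v)" by (cases "T (x, y)")
    obtain u' v' where uv': "skew \<alpha> \<phi> (u, v) = (u', v')" by (cases "skew \<alpha> \<phi> (u, v)")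
    have "T (x + of_int m, y + of_int n) = (u + of_int (a * m + b * n), v + of_int (c * m + d * n))"
      unfolding eqT uv by simp
    then have "G \<alpha> \<phi> (x + of_int m, y + of_int n) = S ((u', v') + (of_int (a * m + b * n), of_int (c * m + d * n)))"
      unfolding G_def o_def using skew_shift[OF pc, of \<alpha> u "a * m + b * n" v "c * m + d * n"] uv' by simp
    then show ?thesis unfolding eqST by (simp add: G_def uv uv')
  qed
  have bext: "bounded_holo_ext r (disp1 (G \<alpha> \<phi>)) (\<lambda>z. S1 (H \<alpha> \<Phi> z) - fst z)"
       "bounded_holo_ext r (disp2 (G \<alpha> \<phi>)) (\<lambda>z. S2 (H \<alpha> \<Phi> z) - snd z)"
    if sm: "small_ext \<rho> \<phi> \<Phi>" for \<alpha> \<phi> \<Phi>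
  proof -
    have h: "holo2 (\<lambda>z. S1 (H \<alpha> \<Phi> z) - fst z) (strip r0)" "holo2 (\<lambda>z. S2 (H \<alpha> \<Phi> z) - snd z) (strip r0)"
      using comp[OF sm] hS by (auto intro!: holo2_diff holo2_fst holo2_snd)
    have re: "S1 (H \<alpha> \<Phi> (complex_of_real x, complex_of_real y)) - fst (complex_of_real x, complex_of_real y) = complex_of_real (disp1 (G \<alpha> \<phi>) (x, y))"
       "S2 (H \<alpha> \<Phi> (complex_of_real x, complex_of_real y)) - snd (complex_of_real x, complex_of_real y) = complex_of_real (disp2 (G \<alpha> \<phi>) (x, y))" for x y
      unfolding Hreal[OF sm] S1(3) S2(3) by (auto simp: disp1_def disp2_def G_def)
    have "equivariant r0 (\<lambda>k. complex_of_real 0) (\<lambda>z. S1 (H \<alpha> \<Phi> z) - fst z)"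
      "equivariant r0 (\<lambda>k. complex_of_real 0) (\<lambda>z. S2 (H \<alpha> \<Phi> z) - snd z)"
      by (rule equivariant_if_real_equivariant[OF h(1) r0(1) re(1)], simp add: disp1_def Gshift[OF sm])
         (rule equivariant_if_real_equivariant[OF h(2) r0(1) re(2)], simp add: disp2_def Gshift[OF sm])
    then have "\<exists>B. \<forall>z\<in>strip r. norm (S1 (H \<alpha> \<Phi> z) - fst z) \<le> B" "\<exists>B. \<forall>z\<in>strip r. norm (S2 (H \<alpha> \<Phi> z) - snd z) \<le> B"
      using periodic_bounded_on_strip[OF h(1) _ r(2)] periodic_bounded_on_strip[OF h(2) _ r(2)] by simp_all
    moreover have "holo2 (\<lambda>z. S1 (H \<alpha> \<Phi> z) - fst z) (strip r)" "holo2 (\<lambda>z. S2 (H \<alpha> \<Phi> z) - snd z) (strip r)"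
      using h holo2_subset strip_mono[of r r0] r by (metis less_imp_le)+
    ultimately show "bounded_holo_ext r (disp1 (G \<alpha> \<phi>)) (\<lambda>z. S1 (H \<alpha> \<Phi> z) - fst z)"
       "bounded_holo_ext r (disp2 (G \<alpha> \<phi>)) (\<lambda>z. S2 (H \<alpha> \<Phi> z) - snd z)"
      unfolding bounded_holo_ext_def using re by blast+
  qed
  show ?thesis
  proof (rule that[OF r(1) rho])
    fix \<alpha> \<phi> \<Phi> assume sm: "small_ext \<rho> \<phi> \<Phi>"
    have "ra_diffeo2 (skew \<alpha> \<phi>)"
      using sm rho unfolding small_ext_def by (intro ra_diffeo2_skew[of \<Phi> \<rho>]) auto
    then have "ra_diffeo2 (G \<alpha> \<phi>)"
      unfolding G_def by (intro ra_diffeo2_comp raS raT)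
    then have "torus_diffeo_lift (G \<alpha> \<phi>)"
      unfolding torus_diffeo_lift_def using Gshift[OF sm] by simp
    then have "G \<alpha> \<phi> \<in> Diff_r r"
      unfolding Diff_r_def using bext[OF sm] by blast
    then show "inv T \<circ> skew \<alpha> \<phi> \<circ> T \<in> Diff_r r" by (simp add: G_def S_def)
  next
    fix e :: real assume e: "e > 0"
    obtain \<delta>1 where \<delta>1: "\<delta>1 > 0" "\<And>z w. z \<in> strip s \<Longrightarrow> w \<in> strip s \<Longrightarrow> dist w z < \<delta>1 \<Longrightarrow> dist (S1 w) (S1 z) < e / 2"
      using ucS(1) half_gt_zero[OF e] unfolding uniformly_continuous_on_def by metis
    obtain \<delta>2 where \<delta>2: "\<delta>2 > 0" "\<And>z w. z \<in> strip s \<Longrightarrow> w \<in> strip s \<Longrightarrow> dist w z < \<delta>2 \<Longrightarrow> dist (S2 w) (S2 z) < e / 2"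
      using ucS(2) half_gt_zero[OF e] unfolding uniformly_continuous_on_def by metis
    \<comment> \<open>A supremum passes on only the weak inequality, so \<open>e / 2\<close> is
      aimed at to end strictly below \<open>e\<close>.\<close>
    have "dist_r r (G \<alpha> \<phi>) (G \<alpha> \<phi>') \<le> e / 2"
      if sm: "small_ext \<rho> \<phi> \<Phi>" "small_ext \<rho> \<phi>' \<Phi>'"
        and close: "\<And>z. \<bar>Im z\<bar> < \<rho> \<Longrightarrow> norm (\<Phi> z - \<Phi>' z) < min \<delta>1 \<delta>2" for \<alpha> \<phi> \<Phi> \<phi>' \<Phi>'
    proof (rule dist_r_le[OF bext[OF sm(1)] bext[OF sm(2)] r(1)])
      fix z assume "z \<in> strip r"
      then have z: "z \<in> strip r0" using strip_mono[of r r0] r by auto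
      have "dist (H \<alpha> \<Phi> z) (H \<alpha> \<Phi>' z) = norm (\<Phi> (T1 z) - \<Phi>' (T1 z))"
        by (simp add: H_def dist_prod_def dist_norm)
      also have "\<dots> < min \<delta>1 \<delta>2" using close[OF ImT(1)[OF z]] .
      finally have dH: "dist (H \<alpha> \<Phi> z) (H \<alpha> \<Phi>' z) < \<delta>1" "dist (H \<alpha> \<Phi> z) (H \<alpha> \<Phi>' z) < \<delta>2" by auto
      show "norm (S1 (H \<alpha> \<Phi> z) - fst z - (S1 (H \<alpha> \<Phi>' z) - fst z)) \<le> e / 2"
        using less_imp_le[OF \<delta>1(2)[OF Hs[OF sm(2) z] Hs[OF sm(1) z] dH(1)]] by (simp add: dist_norm)
      show "norm (S2 (H \<alpha> \<Phi> z) - snd z - (S2 (H \<alpha> \<Phi>' z) - snd z)) \<le> e / 2"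
        using less_imp_le[OF \<delta>2(2)[OF Hs[OF sm(2) z] Hs[OF sm(1) z] dH(2)]] by (simp add: dist_norm)
    qed
    then have "dist_r r (G \<alpha> \<phi>) (G \<alpha> \<phi>') < e"
      if "small_ext \<rho> \<phi> \<Phi>" "small_ext \<rho> \<phi>' \<Phi>'"
        and "\<forall>z. \<bar>Im z\<bar> < \<rho> \<longrightarrow> norm (\<Phi> z - \<Phi>' z) < min \<delta>1 \<delta>2" for \<alpha> \<phi> \<Phi> \<phi>' \<Phi>'
      by (rule le_less_trans[of _ "e / 2"]) (use that e in auto)
    then show "\<exists>\<delta>>0. \<forall>\<alpha> \<phi> \<Phi> \<phi>' \<Phi>'. small_ext \<rho> \<phi> \<Phi> \<and> small_ext \<rho> \<phi>' \<Phi>' \<and>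
        (\<forall>z. \<bar>Im z\<bar> < \<rho> \<longrightarrow> norm (\<Phi> z - \<Phi>' z) < \<delta>) \<longrightarrow>
        dist_r r (inv T \<circ> skew \<alpha> \<phi> \<circ> T) (inv T \<circ> skew \<alpha> \<phi>' \<circ> T) < e"
      unfolding G_def S_def[symmetric] using \<delta>1(1) \<delta>2(1) by (intro exI[of _ "min \<delta>1 \<delta>2"]) auto
  qed
qed

text \<open>The shear \<open>h\<close> preserves area and is homotopic to the identity, so
  \<open>h \<circ> T\<close> is again an admissible conjugacy, with the integer matrix of
  \<open>T\<close>.\<close>

lemma cohomologous_skew_in_A_conj:
  assumes T: "area_pres_torus_diffeo_lift T"
    and F: "F = inv T \<circ> skew \<alpha> (\<lambda>x. \<Psi> (x + \<alpha>) - \<Psi> x) \<circ> T" "F \<in> Diff"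
    and Psi: "\<Psi> = (\<lambda>t. \<Sum>i<m. cos (2 * pi * real (qs i) * t))"
  shows "F \<in> A_conj \<alpha>"
proof -
  define h where "h = skew 0 (\<lambda>x. - \<Psi> x)"
  have pc: "periodic_cont (\<lambda>x. - \<Psi> x)"
    using periodic_cont_cos_sum[where n=m and qs=qs] unfolding Psi periodic_cont_def
    by (auto intro: continuous_on_minus)
  have bijT: "bij T" and raT: "ra_diffeo2 T" and areaT: "distr lborel lborel T = lborel"
    using T by (auto simp: area_pres_torus_diffeo_lift_def ra_diffeo2_def)
  have rah: "ra_diffeo2 h"
    unfolding h_def
  proof (rule ra_diffeo2_skew)
    show "(\<lambda>z. - (\<Sum>i<m. cos (2 * of_real pi * of_nat (qs i) * z))) holomorphic_on {z. \<bar>Im z\<bar> < 1}"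
      by (intro holomorphic_intros)
    show "- (\<Sum>i<m. cos (2 * of_real pi * of_nat (qs i) * complex_of_real x)) = complex_of_real (- \<Psi> x)" for x
      unfolding Psi by (simp flip: cos_of_real)
  qed simp
  have bijh: "bij h" unfolding h_def by (rule bij_skew)
  have Tm: "T \<in> borel_measurable borel"
  proof -
    have "continuous_on UNIV (\<lambda>p. (fst (T p), snd (T p)))"
      using raT unfolding ra_diffeo2_def by (intro continuous_on_Pair real_analytic2_continuous) auto
    then show ?thesis by (intro borel_measurable_continuous_onI) simp
  qed
  have cont: "continuous_on UNIV (\<lambda>x. - \<Psi> x)" using pc by (simp add: periodic_cont_def)
  have hm: "h \<in> borel_measurable borel" unfolding h_def by (rule skew_measurable[OF cont])
  have "distr lborel lborel (h \<circ> T) = distr (distr lborel lborel T) lborel h"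
    by (rule distr_distr[symmetric]) (use Tm hm in \<open>simp_all add: measurable_lborel1 measurable_lborel2\<close>)
  also have "\<dots> = lborel"
    unfolding areaT h_def by (rule skew_area_preserving[OF cont])
  finally have area: "distr lborel lborel (h \<circ> T) = lborel" .
  obtain a b c d :: int where det: "\<bar>a * d - b * c\<bar> = 1"
    and eqT: "\<And>x y m n. T (x + of_int m, y + of_int n) = T (x, y) + (of_int (a * m + b * n), of_int (c * m + d * n))"
    using T unfolding area_pres_torus_diffeo_lift_def by blast
  have "(h \<circ> T) (x + of_int m, y + of_int n) = (h \<circ> T) (x, y) + (of_int (a * m + b * n), of_int (c * m + d * n))" for x y m n
    unfolding o_def eqT h_def
    using skew_shift[OF pc, of 0 "fst (T (x, y))" "a * m + b * n" "snd (T (x, y))" "c * m + d * n"]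
    by (simp add: plus_prod_def)
  then have "area_pres_torus_diffeo_lift (h \<circ> T)"
    unfolding area_pres_torus_diffeo_lift_def using det area ra_diffeo2_comp[OF rah raT] by blast
  moreover have "F = inv (h \<circ> T) \<circ> rot \<alpha> \<circ> (h \<circ> T)"
  proof -
    have "inv h = skew 0 \<Psi>" unfolding h_def inv_skew by simp
    then have conj: "inv h \<circ> rot \<alpha> \<circ> h = skew \<alpha> (\<lambda>x. \<Psi> (x + \<alpha>) - \<Psi> x)"
      by (auto simp: fun_eq_iff h_def skew_def rot_def)
    show ?thesis
      unfolding F(1) o_inv_distrib[OF bijh bijT] conj[symmetric] by (simp only: comp_assoc)
  qed
  ultimately show ?thesis using F(2) unfolding A_conj_def by blast
qed

lemma uniquely_ergodic_near_conjugate: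
  assumes al: "liouville \<alpha>" and F0: "F0 \<in> A_conj \<alpha>" and W: "tau_open W" "F0 \<in> W"
  shows "\<exists>G\<in>W. G \<in> tau_closure (A_conj \<alpha>) \<and> uniquely_ergodic G"
proof -
  obtain T where T: "area_pres_torus_diffeo_lift T" and F0T: "F0 = inv T \<circ> rot \<alpha> \<circ> T"
    using F0 unfolding A_conj_def by blast
  obtain r \<rho> where r: "r > 0" and rho: "\<rho> > 0"
    and Dr: "\<And>\<alpha> \<phi> \<Phi>. small_ext \<rho> \<phi> \<Phi> \<Longrightarrow> inv T \<circ> skew \<alpha> \<phi> \<circ> T \<in> Diff_r r"
    and cl: "\<And>e. e > 0 \<Longrightarrow> \<exists>\<delta>>0. \<forall>\<alpha> \<phi> \<Phi> \<phi>' \<Phi>'. small_ext \<rho> \<phi> \<Phi> \<and> small_ext \<rho> \<phi>' \<Phi>' \<and>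
        (\<forall>z. \<bar>Im z\<bar> < \<rho> \<longrightarrow> norm (\<Phi> z - \<Phi>' z) < \<delta>) \<longrightarrow>
        dist_r r (inv T \<circ> skew \<alpha> \<phi> \<circ> T) (inv T \<circ> skew \<alpha> \<phi>' \<circ> T) < e"
    using conjugated_skew_products[OF T] by metis
  have zero: "small_ext \<rho> (\<lambda>_. 0) (\<lambda>_. 0)" using rho by (simp add: small_ext_def periodic_cont_def)
  have F0': "F0 = inv T \<circ> skew \<alpha> (\<lambda>_. 0) \<circ> T"
    unfolding F0T by (simp add: skew_def[abs_def] rot_def[abs_def])
  have "F0 \<in> Diff_r r" unfolding F0' by (rule Dr[OF zero])
  then obtain e where e: "e > 0" "\<And>G. G \<in> Diff_r r \<Longrightarrow> dist_r r F0 G < e \<Longrightarrow> G \<in> W"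
    using W r unfolding tau_open_def by blast
  obtain \<delta> where \<delta>: "\<delta> > 0" "\<And>\<alpha> \<phi> \<Phi> \<phi>' \<Phi>'. small_ext \<rho> \<phi> \<Phi> \<Longrightarrow> small_ext \<rho> \<phi>' \<Phi>' \<Longrightarrow>
        (\<forall>z. \<bar>Im z\<bar> < \<rho> \<longrightarrow> norm (\<Phi> z - \<Phi>' z) < \<delta>) \<Longrightarrow>
        dist_r r (inv T \<circ> skew \<alpha> \<phi> \<circ> T) (inv T \<circ> skew \<alpha> \<phi>' \<circ> T) < e"
    using cl[OF e(1)] by blast
  \<comment> \<open>Being below \<delta> puts \<open>G\<close> near \<open>F0\<close>; twice
    \<epsilon> must stay below \<rho> because a partial sum can exceed the bound on \<Phi> by
    another \<epsilon> and still has to be admissible.\<close>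
  define \<epsilon> where "\<epsilon> = min \<delta> \<rho> / 4"
  have eps: "\<epsilon> > 0" "\<epsilon> < \<delta>" "2 * \<epsilon> < \<rho>" using \<delta>(1) rho by (auto simp: \<epsilon>_def)
  obtain qs \<Phi> \<phi> where hol: "\<Phi> holomorphic_on {z. \<bar>Im z\<bar> < \<rho>}"
    and tail: "\<And>z m. \<bar>Im z\<bar> < \<rho> \<Longrightarrow> norm (\<Phi> z - (\<Sum>i<m. cos_cob \<alpha> (qs i) z)) \<le> \<epsilon> / 2 ^ m"
    and re: "\<And>x. \<Phi> (of_real x) = of_real (\<phi> x)"
    and pc: "periodic_cont \<phi>" and ue: "uniquely_ergodic (skew \<alpha> \<phi>)"
    using uniquely_ergodic_skew_exists[OF al eps(1) rho] by metis
  have nPhi: "norm (\<Phi> z) \<le> \<epsilon>" if "\<bar>Im z\<bar> < \<rho>" for z using tail[OF that, of 0] by simp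
  have sm: "small_ext \<rho> \<phi> \<Phi>"
    unfolding small_ext_def using hol re pc nPhi eps by fastforce
  define G where "G = inv T \<circ> skew \<alpha> \<phi> \<circ> T"
  have GD: "G \<in> Diff_r r" unfolding G_def by (rule Dr[OF sm])
  have "dist_r r F0 G < e"
    unfolding F0' G_def using nPhi eps by (intro \<delta>(2)[OF zero sm]) fastforce
  then have GW: "G \<in> W" using e(2) GD by blast
  have GDiff: "G \<in> Diff" using GD r by (auto simp: Diff_def)
  \<comment> \<open>Truncating the series for \<Phi> gives elements of
    \<open>A_conj \<alpha>\<close> in the same \<open>Diff_r r\<close>, and \<open>W'\<close>
    contains a full \<open>dist_r r\<close> ball of that set around \<open>G\<close>.\<close>
  have "W' \<inter> A_conj \<alpha> \<noteq> {}" if W': "tau_open W'" "G \<in> W'" for W'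
  proof -
    obtain e' where e': "e' > 0" "\<And>G'. G' \<in> Diff_r r \<Longrightarrow> dist_r r G G' < e' \<Longrightarrow> G' \<in> W'"
      using W' r GD unfolding tau_open_def by blast
    obtain \<delta>' where \<delta>': "\<delta>' > 0" "\<And>\<alpha> \<phi> \<Phi> \<phi>' \<Phi>'. small_ext \<rho> \<phi> \<Phi> \<Longrightarrow> small_ext \<rho> \<phi>' \<Phi>' \<Longrightarrow>
        (\<forall>z. \<bar>Im z\<bar> < \<rho> \<longrightarrow> norm (\<Phi> z - \<Phi>' z) < \<delta>') \<Longrightarrow>
        dist_r r (inv T \<circ> skew \<alpha> \<phi> \<circ> T) (inv T \<circ> skew \<alpha> \<phi>' \<circ> T) < e'"
      using cl[OF e'(1)] by blast
    have "(\<lambda>m. \<epsilon> / 2 ^ m) \<longlonglongrightarrow> 0" by real_asymp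
    then have "\<forall>\<^sub>F m in sequentially. \<epsilon> / 2 ^ m < \<delta>'" using \<delta>'(1) by (rule order_tendstoD)
    then obtain m where m: "\<epsilon> / 2 ^ m < \<delta>'" by (auto simp: eventually_sequentially)
    define \<Psi> where "\<Psi> = (\<lambda>t. \<Sum>i<m. cos (2 * pi * real (qs i) * t))"
    define \<Phi>m where "\<Phi>m z = (\<Sum>i<m. cos_cob \<alpha> (qs i) z)" for z
    have pcm: "periodic_cont (\<lambda>x. \<Psi> (x + \<alpha>) - \<Psi> x)"
    proof -
      have P: "periodic_cont \<Psi>" unfolding \<Psi>_def by (rule periodic_cont_cos_sum)
      then have "\<Psi> (x + 1 + \<alpha>) = \<Psi> (x + \<alpha>)" for x
        using periodic_cont_nat[OF P, of "x + \<alpha>" 1] by (simp add: algebra_simps)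
      moreover have "continuous_on UNIV (\<lambda>x. \<Psi> (x + \<alpha>))"
        using P unfolding periodic_cont_def
        by (intro continuous_on_compose2[of UNIV \<Psi> UNIV "\<lambda>x. x + \<alpha>"] continuous_intros) auto
      ultimately show ?thesis
        using P unfolding periodic_cont_def by (auto intro!: continuous_on_diff)
    qed
    have "norm (\<Phi>m z) < \<rho>" if "\<bar>Im z\<bar> < \<rho>" for z
    proof -
      have "norm (\<Phi>m z) \<le> norm (\<Phi> z) + norm (\<Phi> z - \<Phi>m z)"
        using norm_triangle_sub[of "\<Phi>m z" "\<Phi> z"] by (simp add: norm_minus_commute)
      also have "\<dots> \<le> \<epsilon> + \<epsilon> / 2 ^ m"
        unfolding \<Phi>m_def by (intro add_mono nPhi[OF that] tail[OF that])
      also have "\<epsilon> / 2 ^ m \<le> \<epsilon>" using eps(1) by (simp add: divide_le_eq)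
      finally show ?thesis using eps(3) by simp
    qed
    then have smm: "small_ext \<rho> (\<lambda>x. \<Psi> (x + \<alpha>) - \<Psi> x) \<Phi>m"
      unfolding small_ext_def using pcm
      by (auto simp: \<Phi>m_def[abs_def] cos_cob_of_real \<Psi>_def sum_subtractf intro!: holomorphic_intros cos_cob_holomorphic)
    define Gm where "Gm = inv T \<circ> skew \<alpha> (\<lambda>x. \<Psi> (x + \<alpha>) - \<Psi> x) \<circ> T"
    have GmD: "Gm \<in> Diff_r r" unfolding Gm_def by (rule Dr[OF smm])
    have "dist_r r G Gm < e'"
      unfolding G_def Gm_def
    proof (rule \<delta>'(2)[OF sm smm], intro allI impI)
      fix z assume "\<bar>Im z\<bar> < \<rho>"
      then show "norm (\<Phi> z - \<Phi>m z) < \<delta>'" using tail[of z m] m by (simp add: \<Phi>m_def)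
    qed
    then have "Gm \<in> W'" using e'(2) GmD by blast
    moreover have "Gm \<in> A_conj \<alpha>"
      by (rule cohomologous_skew_in_A_conj[OF T Gm_def _ \<Psi>_def]) (use GmD r in \<open>auto simp: Diff_def\<close>)
    ultimately show ?thesis by blast
  qed
  then have cl: "G \<in> tau_closure (A_conj \<alpha>)" unfolding tau_closure_def using GDiff by blast
  have ra: "ra_diffeo2 T" using T by (simp add: area_pres_torus_diffeo_lift_def)
  have meas: "F \<in> borel_measurable borel" if "ra_diffeo2 F" for F
  proof -
    have "continuous_on UNIV (\<lambda>p. (fst (F p), snd (F p)))"
      using that unfolding ra_diffeo2_def by (intro continuous_on_Pair real_analytic2_continuous) auto
    then show ?thesis by (intro borel_measurable_continuous_onI) simp
  qed
  have bij: "bij T" using ra by (simp add: ra_diffeo2_def)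
  have "torus_commutes T" "torus_commutes (inv T)"
    by (rule area_pres_lift_inverse[OF T], rule torus_commutesI, blast)+
  then have "uniquely_ergodic G"
    unfolding G_def using pc bij
    by (intro uniquely_ergodic_conj ue skew_measurable meas ra ra_diffeo2_inv skew_commutes)
       (auto simp: periodic_cont_def bij_is_inj bij_is_surj surj_f_inv_f)
  then show ?thesis using GW cl by blast
qed

section \<open>Genericity of Liouville numbers\<close>

definition liouville_nbhd :: "nat \<Rightarrow> real set" where
  "liouville_nbhd n = {\<alpha>\<in>{0..1}. \<exists>q\<ge>n. \<exists>p::int. q > 0 \<and> coprime p (int q) \<and>
      \<bar>\<alpha> - of_int p / real q\<bar> < exp (- (real q)\<^sup>2)}"

lemma openin_liouville_nbhd: "openin (top_of_set {0..1}) (liouville_nbhd n)"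
proof -
  have op: "open (\<Union>(q, p)\<in>{(q, p :: int). q \<ge> n \<and> q > 0 \<and> coprime p (int q)}. ball (of_int p / real q) (exp (- (real q)\<^sup>2)))"
    by (intro open_UN ballI) auto
  have eq: "liouville_nbhd n = {0..1} \<inter>
     (\<Union>(q, p)\<in>{(q, p :: int). q \<ge> n \<and> q > 0 \<and> coprime p (int q)}. ball (of_int p / real q) (exp (- (real q)\<^sup>2)))"
    by (auto simp: liouville_nbhd_def dist_real_def abs_minus_commute) blast
  show ?thesis unfolding eq by (rule openin_open_Int[OF op])
qed

text \<open>Fractions with large prime denominator come close to \<open>x\<close>, and each belongs
  to the set, being at distance 0 from itself.\<close>

lemma liouville_nbhd_dense: "{0..1} \<subseteq> closure (liouville_nbhd n)"
proof
  fix x :: real assume x: "x \<in> {0..1}"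
  show "x \<in> closure (liouville_nbhd n)"
    unfolding closure_approachable
  proof (intro allI impI)
    fix e :: real assume e: "e > 0"
    obtain N where N: "real N > 2 / e" using reals_Archimedean2 by blast
    obtain q where q: "prime q" "q > n + N + 2" using bigger_prime by blast
    \<comment> \<open>Clamping the numerator between 1 and \<open>q - 1\<close> means that the prime
      \<open>q\<close> cannot divide it and that the quotient stays in [0, 1]; the error remains at
      most one unit of the grid.\<close>
    define p where "p = max 1 (min \<lfloor>real q * x\<rfloor> (int q - 1))"
    have p: "1 \<le> p" "p < int q" using q(2) by (auto simp: p_def)
    have q0: "real q > 0" using q(2) by simp
    have cop: "coprime p (int q)"
    proof -
      have "\<not> int q dvd p" using p zdvd_not_zless by auto
      moreover have "prime (int q)" using q(1) by simp
      ultimately have "coprime (int q) p" by (rule prime_imp_coprime[rotated])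
      then show ?thesis by (simp only: coprime_commute)
    qed
    have xq: "0 \<le> real q * x" "real q * x \<le> real q" using x q0 by (auto simp: mult_left_le)
    have "\<bar>of_int p - real q * x\<bar> \<le> 1"
      using xq q(2) unfolding p_def by linarith
    then have "\<bar>of_int p - real q * x\<bar> / real q \<le> 1 / real q" using q0 by (intro divide_right_mono) auto
    moreover have "of_int p / real q - x = (of_int p - real q * x) / real q" using q0 by (simp add: field_simps)
    ultimately have "dist (of_int p / real q) x \<le> 1 / real q" by (simp add: dist_real_def abs_divide)
    also have "1 / real q < e"
    proof -
      have "real q > 2 / e" using N q(2) by linarith
      then have "2 < e * real q" using e by (simp add: field_simps)
      then show ?thesis using q0 by (simp add: field_simps)
    qed
    finally have "dist (of_int p / real q) x < e" .
    moreover have "of_int p / real q \<in> liouville_nbhd n"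
      unfolding liouville_nbhd_def using p q(2) q0 cop by (auto simp: field_simps intro!: exI[of _ q] exI[of _ p])
    ultimately show "\<exists>y\<in>liouville_nbhd n. dist y x < e" by blast
  qed
qed

theorem theoremA:
  shows "\<exists>E :: real set. E \<subseteq> {0..1}
     \<and> (\<exists>U :: nat \<Rightarrow> real set. (\<forall>n. openin (top_of_set {0..1}) (U n)) \<and> E = (\<Inter>n. U n))
     \<and> {0..1} \<subseteq> closure E
     \<and> (\<forall>\<alpha>\<in>E. \<exists>D. tau_dense_in D (tau_closure (A_conj \<alpha>)) \<and> (\<forall>F\<in>D. uniquely_ergodic F))"
proof (intro exI[of _ "\<Inter>n. liouville_nbhd n"] conjI exI[of _ liouville_nbhd] ballI allI refl)
  show "(\<Inter>n. liouville_nbhd n) \<subseteq> {0..1}" by (auto simp: liouville_nbhd_def)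
  show "openin (top_of_set {0..1}) (liouville_nbhd n)" for n by (rule openin_liouville_nbhd)
  show "{0..1} \<subseteq> closure (\<Inter>n. liouville_nbhd n)"
    by (rule Baire) (auto simp: openin_liouville_nbhd liouville_nbhd_dense[THEN subsetD])
  fix \<alpha> assume "\<alpha> \<in> (\<Inter>n. liouville_nbhd n)"
  then have al: "liouville \<alpha>" unfolding liouville_def liouville_nbhd_def by blast
  define D where "D = {G \<in> tau_closure (A_conj \<alpha>). uniquely_ergodic G}"
  have "W \<inter> D \<noteq> {}" if F: "F \<in> tau_closure (A_conj \<alpha>)" "tau_open W" "F \<in> W" for F W
  proof -
    \<comment> \<open>An open set that meets the closure meets \<open>A_conj \<alpha>\<close>
      itself, so only neighbourhoods of genuine conjugates of the rotation have to be
      treated.\<close>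
    obtain F0 where "F0 \<in> W" "F0 \<in> A_conj \<alpha>"
      using F unfolding tau_closure_def by blast
    then show ?thesis using uniquely_ergodic_near_conjugate[OF al _ F(2)] unfolding D_def by blast
  qed
  then have "tau_dense_in D (tau_closure (A_conj \<alpha>))" unfolding tau_dense_in_def D_def by blast
  then show "\<exists>D. tau_dense_in D (tau_closure (A_conj \<alpha>)) \<and> (\<forall>F\<in>D. uniquely_ergodic F)"
    unfolding D_def by blast
qed

end
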